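(* Let $m\ge2$ and $c>-1$. For all $f\in\mathcal{L}^2_{0,c}(\mathbb{R}^m)$, the deformed Fourier transform satisfies $$\|\underline{x}f(x)\|\cdot\|\underline{x}\,(\mathcal{F}_{0,c}f)(x)\|\ \ge\ \frac{\delta}{2}\,\|f(x)\|^2 .$$ Equality holds if and only if $f$ is of the form $f(x)=a\,e^{-r^2/\alpha}$ with a constant $a\in\mathbb{C}\otimes\mathcal{C}l_m$ and $\alpha>0$.
   Context: $\mathcal{C}l_m$ is the real associative Clifford algebra generated by $e_1,\dots,e_m$ with $e_ie_j+e_je_i=0$ ($i\ne j$), $e_i^2=-1$. Functions take values in $\mathbb{C}\otimes\mathcal{C}l_m$. $\overline{\,\cdot\,}$ is the ($\mathbb{C}$-linear) anti-involution with $\overline{ab}=\overline{b}\,\overline{a}$, $\overline{e_i}=-e_i$; $f^c$ is complex conjugation of the complex coefficients; $[\cdot]_0$ is the scalar part. A point $x\in\mathbb{R}^m$ is identified with $\underline{x}=\sum_i e_ix_i$, $r=|x|$. $\partial_{\underline{x}}=\sum_i e_i\partial_{x_i}$, $\mathbb{E}=\sum_i x_i\partial_{x_i}$, $\mathbf{D}=\partial_{\underline{x}}+c\,r^{-2}\underline{x}\,\mathbb{E}$, $L=\mathbf{D}^2-(1+c)^2\underline{x}^2$. Constants: $\delta=1+\frac{m-1}{1+c}$, $\beta_\ell=-\frac{c}{1+c}\ell$, $\gamma_\ell=\frac{2}{1+c}\left(\ell+\frac{m-2}{2}\right)+\frac{c+2}{1+c}$. $h(r)=r^{1-\frac{1+mc}{1+c}}$;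 $\mathcal{L}^2_{0,c}(\mathbb{R}^m)=L^2(\mathbb{R}^m,h(r)dx)\otimes\mathcal{C}l_m$ with $\langle f,g\rangle=\left[\int_{\mathbb{R}^m}\overline{f^c}\,g\,h(r)\,dx\right]_0$, $\|f\|^2=\langle f,f\rangle$ (norms of functions not in the space are $+\infty$; for $f=0$ both sides are $0$). $\mathcal{M}_\ell$ is the space of $\mathcal{C}l_m$-valued homogeneous polynomials $M$ of degree $\ell$ with $\partial_{\underline{x}}M=0$, with basis $\{M_\ell^{(j)}\}$ orthonormal for $[\int_{\mathbb{S}^{m-1}}\overline{M}N\,d\sigma]_0$. The functions ($L_t^\alpha$ generalized Laguerre polynomials) $$\phi_{2t,\ell,j}=2^{2t}(1+c)^{2t}t!\,L_t^{\frac{\gamma_\ell}{2}-1}(r^2)\,r^{\beta_\ell}M_\ell^{(j)}e^{-r^2/2},\qquad \phi_{2t+1,\ell,j}=-2^{2t+1}(1+c)^{2t+1}t!\,L_t^{\frac{\gamma_\ell}{2}}(r^2)\,\underline{x}\,r^{\beta_\ell}M_\ell^{(j)}e^{-r^2/2}$$ form an orthogonal basis of $\mathcal{L}^2_{0,c}(\mathbb{R}^m)$. The deformed Fourier transform is $\mathcal{F}_{0,c}=e^{i\pi\delta/4}e^{-\frac{i\pi}{4(1+c)^2}L}$ (functional calculus of the selfadjoint closure of $L$ on the span of the $\phi_{t,\ell,j}$); equivalently, it is the unitary operator with $\mathcal{F}_{0,c}\phi_{t,\ell,j}=(-i)^te^{-\frac{i\pi\ell}{2(1+c)}}\phi_{t,\ell,j}$.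 *)

theory Defs
  imports "HOL-Analysis.Analysis"
begin

section \<open>The complexified Clifford algebra\<close>

text \<open>
  An element of the complexification of the real Clifford algebra with generators \<open>e\<^sub>i\<close>
  (\<open>i :: 'm\<close>) is given by its coefficients with respect to the \<open>2 ^ CARD('m)\<close> blades
  \<open>e\<^sub>A = e\<^sub>i\<^sub>1 \<dots> e\<^sub>i\<^sub>k\<close>, where \<open>A = {i\<^sub>1 < \<dots> < i\<^sub>k}\<close>; the order on \<open>'m\<close> serves only to
  fix these blades. Topology, norm and measurability are those of the
  coefficient space. The multiplication of the type, which is componentwise, plays no role.
\<close>

type_synonym 'm clifford = "complex ^ ('m set)"

type_synonym 'm cl_fun = "(real, 'm) vec \<Rightarrow> 'm clifford"

text \<open>
  \<open>e\<^sub>A e\<^sub>B\<close> equals \<open>e\<close> of the symmetric difference up to sign: sorting the factors costs one sign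
  for each pair \<open>j < i\<close> with \<open>i \<in> A\<close>, \<open>j \<in> B\<close>, and \<open>e\<^sub>i\<^sup>2 = -1\<close> one sign for each common index.
\<close>

definition blade_sign :: "'m::{finite,linorder} set \<Rightarrow> 'm set \<Rightarrow> complex" where
  "blade_sign A B = (-1) ^ card {(i, j). i \<in> A \<and> j \<in> B \<and> j \<le> i}"

definition cl_mult :: "'m::{finite,linorder} clifford \<Rightarrow> 'm clifford \<Rightarrow> 'm clifford"
    (infixl \<open>\<odot>\<close> 70) where
  "a \<odot> b = (\<chi> C. \<Sum>A\<in>UNIV. \<Sum>B\<in>UNIV.
     if sym_diff A B = C then blade_sign A B * (a $ A) * (b $ B) else 0)"

definition cl_blade :: "'m::{finite,linorder} set \<Rightarrow> 'm clifford" where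
  "cl_blade A = axis A 1"

abbreviation cl_one :: "'m::{finite,linorder} clifford" where
  "cl_one \<equiv> cl_blade {}"

abbreviation cl_gen :: "'m::{finite,linorder} \<Rightarrow> 'm clifford" where
  "cl_gen i \<equiv> cl_blade {i}"

text \<open>The reversal of \<open>k\<close> factors and the \<open>k\<close> changes of sign contribute \<open>(-1) ^ (k(k-1)/2 + k)\<close>.\<close>

definition cl_bar :: "'m::{finite,linorder} clifford \<Rightarrow> 'm clifford" where
  "cl_bar a = (\<chi> A. (-1) ^ (card A * (card A + 1) div 2) * (a $ A))"

definition cl_cnj :: "'m::{finite,linorder} clifford \<Rightarrow> 'm clifford" where
  "cl_cnj a = (\<chi> A. cnj (a $ A))"

definition cl_scalar :: "'m::{finite,linorder} clifford \<Rightarrow> complex" where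
  "cl_scalar a = a $ {}"

definition cl_real :: "'m::{finite,linorder} clifford \<Rightarrow> bool" where
  "cl_real a \<longleftrightarrow> (\<forall>A. a $ A \<in> \<real>)"

definition cl_vec :: "real ^ 'm::{finite,linorder} \<Rightarrow> 'm clifford" where
  "cl_vec x = (\<Sum>i\<in>UNIV. (x $ i) *\<^sub>R cl_gen i)"


subsection \<open>The model satisfies the defining properties\<close>

lemma blade_sign_prod:
  "blade_sign A B = (\<Prod>i\<in>A. \<Prod>j\<in>B. if j \<le> i then -1 else 1)"
proof -
  have "(\<Prod>i\<in>A. \<Prod>j\<in>B. if j \<le> i then -1 else (1::complex))
      = (\<Prod>p\<in>A \<times> B. if snd p \<le> fst p then -1 else 1)"
    by (simp add: prod.cartesian_product case_prod_unfold)
  also have "\<dots> = (\<Prod>p\<in>{p \<in> A \<times> B. snd p \<le> fst p}. -1)"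
    by (subst prod.inter_filter) auto
  also have "\<dots> = (-1) ^ card {p \<in> A \<times> B. snd p \<le> fst p}"
    by simp
  also have "{p \<in> A \<times> B. snd p \<le> fst p} = {(i, j). i \<in> A \<and> j \<in> B \<and> j \<le> i}"
    by auto
  finally show ?thesis by (simp add: blade_sign_def)
qed

lemma prod_sym_diff:
  fixes u :: "'a::finite \<Rightarrow> complex"
  assumes "\<And>i. u i * u i = 1"
  shows "prod u (sym_diff A B) = prod u A * prod u B"
proof -
  have "prod u A = prod u (A - B) * prod u (A \<inter> B)"
    by (metis Int_Diff_Un Int_Diff_disjoint finite mult.commute prod.union_disjoint)
  moreover have "prod u B = prod u (B - A) * prod u (A \<inter> B)"
    by (metis Int_Diff_Un Int_Diff_disjoint Int_commute finite mult.commute prod.union_disjoint)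
  moreover have "prod u (sym_diff A B) = prod u (A - B) * prod u (B - A)"
    by (rule prod.union_disjoint) auto
  moreover have "prod u (A \<inter> B) * prod u (A \<inter> B) = 1"
    by (simp add: assms flip: prod.distrib)
  ultimately show ?thesis
    by (simp add: algebra_simps)
qed

lemma blade_sign_square: "blade_sign A B * blade_sign A B = 1"
  by (simp add: blade_sign_def flip: power_add mult_2)

lemma blade_sign_sym_diff_left:
  "blade_sign (sym_diff A B) C = blade_sign A C * blade_sign B C"
  unfolding blade_sign_prod
  by (rule prod_sym_diff) (auto simp: prod.distrib[symmetric] intro!: prod.neutral)

lemma blade_sign_sym_diff_right:
  "blade_sign A (sym_diff B C) = blade_sign A B * blade_sign A C"
  unfolding blade_sign_prod prod.distrib[symmetric]
  by (intro prod.cong refl prod_sym_diff) auto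

lemma cl_mult_nth:
  "(a \<odot> b) $ C = (\<Sum>A\<in>UNIV. blade_sign A (sym_diff A C) * a $ A * b $ (sym_diff A C))"
proof -
  have eq: "sym_diff A B = C \<longleftrightarrow> B = sym_diff A C" for A B :: "'a set"
    by blast
  show ?thesis
    by (simp add: cl_mult_def eq)
qed

lemma cl_mult_add_left: "(a + b) \<odot> c = a \<odot> c + b \<odot> c"
  by (simp add: vec_eq_iff cl_mult_nth algebra_simps sum.distrib)

lemma cl_mult_add_right: "a \<odot> (b + c) = a \<odot> b + a \<odot> c"
  by (simp add: vec_eq_iff cl_mult_nth algebra_simps sum.distrib)

lemma cl_mult_scale_left: "(z *s a) \<odot> b = z *s (a \<odot> b)"
  by (simp add: vec_eq_iff cl_mult_nth algebra_simps sum_distrib_left)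

lemma cl_mult_scale_right: "a \<odot> (z *s b) = z *s (a \<odot> b)"
  by (simp add: vec_eq_iff cl_mult_nth algebra_simps sum_distrib_left)

lemma cl_mult_blade: "cl_blade A \<odot> cl_blade B = blade_sign A B *s cl_blade (sym_diff A B)"
proof -
  have "(cl_blade A \<odot> cl_blade B) $ C = (blade_sign A B *s cl_blade (sym_diff A B)) $ C" for C
  proof -
    have "sym_diff A C = B \<longleftrightarrow> sym_diff A B = C"
      by blast
    moreover have "(cl_blade A \<odot> cl_blade B) $ C =
        (\<Sum>D\<in>UNIV. if D = A then blade_sign A (sym_diff A C) * cl_blade B $ (sym_diff A C) else 0)"
      unfolding cl_mult_nth by (rule sum.cong) (simp_all add: cl_blade_def axis_def)
    ultimately show ?thesis
      by (cases "sym_diff A B = C") (simp_all add: cl_blade_def axis_def)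
  qed
  then show ?thesis by (simp add: vec_eq_iff)
qed

lemma cl_mult_assoc: "(a \<odot> b) \<odot> c = a \<odot> (b \<odot> c)"
proof -
  have "((a \<odot> b) \<odot> c) $ D = (a \<odot> (b \<odot> c)) $ D" for D
  proof -
    have "((a \<odot> b) \<odot> c) $ D = (\<Sum>E\<in>UNIV. \<Sum>A\<in>UNIV. blade_sign E (sym_diff E D) *
        (blade_sign A (sym_diff A E) * a $ A * b $ (sym_diff A E)) * c $ (sym_diff E D))"
      by (simp add: cl_mult_nth sum_distrib_left sum_distrib_right)
    also have "\<dots> = (\<Sum>A\<in>UNIV. \<Sum>E\<in>UNIV. blade_sign E (sym_diff E D) *
        (blade_sign A (sym_diff A E) * a $ A * b $ (sym_diff A E)) * c $ (sym_diff E D))"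
      by (rule sum.swap)
    also have "\<dots> = (\<Sum>A\<in>UNIV. \<Sum>B\<in>UNIV. blade_sign A (sym_diff A D) * a $ A *
        (blade_sign B (sym_diff B (sym_diff A D)) * b $ B * c $ (sym_diff B (sym_diff A D))))"
    proof (rule sum.cong[OF refl])
      fix A :: "'a set"
      have inv: "sym_diff A (sym_diff A B) = B" for B by blast
      have bij: "bij_betw (sym_diff A) UNIV UNIV"
        by (rule bij_betw_byWitness[where f' = "sym_diff A"]) (use inv in auto)
      have "(\<Sum>E\<in>UNIV. blade_sign E (sym_diff E D) *
          (blade_sign A (sym_diff A E) * a $ A * b $ (sym_diff A E)) * c $ (sym_diff E D))
        = (\<Sum>B\<in>UNIV. blade_sign (sym_diff A B) (sym_diff (sym_diff A B) D) *
          (blade_sign A (sym_diff A (sym_diff A B)) * a $ A * b $ (sym_diff A (sym_diff A B))) *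
          c $ (sym_diff (sym_diff A B) D))"
        by (rule sum.reindex_bij_betw[OF bij, symmetric])
      also have "\<dots> = (\<Sum>B\<in>UNIV. blade_sign A (sym_diff A D) * a $ A *
        (blade_sign B (sym_diff B (sym_diff A D)) * b $ B * c $ (sym_diff B (sym_diff A D))))"
      proof (rule sum.cong[OF refl])
        fix B :: "'a set"
        have e: "sym_diff (sym_diff A B) D = sym_diff B (sym_diff A D)" by blast
        have "blade_sign (sym_diff A B) (sym_diff B (sym_diff A D)) * blade_sign A B
          = (blade_sign A B * blade_sign A B) * blade_sign A (sym_diff A D)
              * blade_sign B (sym_diff B (sym_diff A D))"
          by (simp only: blade_sign_sym_diff_left blade_sign_sym_diff_right[of A B]
              mult_ac)
        then have s: "blade_sign (sym_diff A B) (sym_diff B (sym_diff A D)) * blade_sign A B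
          = blade_sign A (sym_diff A D) * blade_sign B (sym_diff B (sym_diff A D))"
          by (simp only: blade_sign_square mult_1)
        from s show "blade_sign (sym_diff A B) (sym_diff (sym_diff A B) D) *
          (blade_sign A (sym_diff A (sym_diff A B)) * a $ A * b $ (sym_diff A (sym_diff A B))) *
          c $ (sym_diff (sym_diff A B) D)
          = blade_sign A (sym_diff A D) * a $ A *
        (blade_sign B (sym_diff B (sym_diff A D)) * b $ B * c $ (sym_diff B (sym_diff A D)))"
          unfolding e inv by algebra
      qed
      finally show "(\<Sum>E\<in>UNIV. blade_sign E (sym_diff E D) *
          (blade_sign A (sym_diff A E) * a $ A * b $ (sym_diff A E)) * c $ (sym_diff E D))
        = (\<Sum>B\<in>UNIV. blade_sign A (sym_diff A D) * a $ A *
        (blade_sign B (sym_diff B (sym_diff A D)) * b $ B * c $ (sym_diff B (sym_diff A D))))" .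
    qed
    also have "\<dots> = (a \<odot> (b \<odot> c)) $ D"
      by (simp add: cl_mult_nth sum_distrib_left sum_distrib_right)
    finally show ?thesis .
  qed
  then show ?thesis by (simp add: vec_eq_iff)
qed

lemma cl_mult_one_left: "cl_one \<odot> a = a"
proof -
  have "(cl_one \<odot> a) $ C = (\<Sum>A\<in>(UNIV :: 'a set set). if A = {} then a $ C else 0)" for C
    unfolding cl_mult_nth
    by (rule sum.cong) (auto simp: cl_blade_def axis_def blade_sign_def)
  then show ?thesis by (simp add: vec_eq_iff)
qed

lemma cl_mult_one_right: "a \<odot> cl_one = a"
proof -
  have "(a \<odot> cl_one) $ C = (\<Sum>A\<in>UNIV. if A = C then a $ C else 0)" for C
    unfolding cl_mult_nth
  proof (rule sum.cong[OF refl])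
    fix A
    have "sym_diff A C = {} \<longleftrightarrow> A = C" by blast
    then show "blade_sign A (sym_diff A C) * a $ A * cl_one $ sym_diff A C
        = (if A = C then a $ C else 0)"
      by (cases "A = C") (auto simp: cl_blade_def axis_def blade_sign_def)
  qed
  then show ?thesis by (simp add: vec_eq_iff)
qed

lemma cl_gen_square: "cl_gen i \<odot> cl_gen i = - cl_one"
  by (simp add: cl_mult_blade blade_sign_prod vec_eq_iff)

lemma cl_gen_anticommute:
  assumes "i \<noteq> j"
  shows "cl_gen i \<odot> cl_gen j + cl_gen j \<odot> cl_gen i = 0"
proof -
  have "sym_diff {i} {j} = {i, j}" "sym_diff {j} {i} = {i, j}" using assms by auto
  then show ?thesis
    using assms by (auto simp: cl_mult_blade blade_sign_prod vec_eq_iff)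
qed

lemma cl_blade_insert:
  assumes "\<And>j. j \<in> A \<Longrightarrow> i < j"
  shows "cl_blade (insert i A) = cl_gen i \<odot> cl_blade A"
proof -
  have "sym_diff {i} A = insert i A" using assms by auto
  moreover have "\<not> j \<le> i" if "j \<in> A" for j using assms[OF that] by simp
  then have "blade_sign {i} A = 1"
    by (auto simp: blade_sign_prod intro!: prod.neutral)
  ultimately show ?thesis by (simp add: cl_mult_blade)
qed

lemma cl_expansion: "a = (\<Sum>A\<in>UNIV. (a $ A) *s cl_blade A)"
proof -
  have "(\<Sum>A\<in>UNIV. (a $ A) *s cl_blade A) $ C = (\<Sum>A\<in>UNIV. if A = C then a $ C else 0)" for C
    unfolding sum_component by (rule sum.cong) (auto simp: cl_blade_def axis_def)
  then show ?thesis by (simp add: vec_eq_iff)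
qed

lemma blade_sign_self:
  "blade_sign A A = (-1) ^ (card A * (card A + 1) div 2)"
  using finite[of A]
proof (induction A rule: finite_linorder_max_induct)
  case empty
  then show ?case by (simp add: blade_sign_def)
next
  case (insert b A)
  then have b: "b \<notin> A" by blast
  then have eq: "insert b A = sym_diff {b} A" by auto
  have "blade_sign {b} A = (-1) ^ card A"
  proof -
    have "(\<Prod>j\<in>A. if j \<le> b then -1 else 1) = (\<Prod>j\<in>A. -1 :: complex)"
      using insert.hyps by (intro prod.cong refl) (auto dest: less_imp_le)
    then have "blade_sign {b} A = (\<Prod>j\<in>A. -1)"
      by (simp add: blade_sign_prod)
    then show ?thesis by simp
  qed
  moreover have "blade_sign A {b} = 1"
    unfolding blade_sign_prod using insert by (auto intro!: prod.neutral dest: leD)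
  moreover have "blade_sign {b} {b} = -1"
    by (simp add: blade_sign_prod)
  ultimately have "blade_sign (insert b A) (insert b A)
      = (-1) ^ (card A * (card A + 1) div 2 + (card A + 1))"
    unfolding eq blade_sign_sym_diff_left blade_sign_sym_diff_right
    by (simp add: insert.IH power_add)
  also have "card A * (card A + 1) div 2 + (card A + 1) = (card A + 1) * (card A + 2) div 2"
  proof -
    have "(card A + 1) * (card A + 2) = card A * (card A + 1) + (card A + 1) * 2"
      by (simp add: algebra_simps)
    then show ?thesis by simp
  qed
  finally show ?case using b insert.hyps by simp
qed

lemma cl_bar_gen: "cl_bar (cl_gen i) = - cl_gen i"
  by (simp add: vec_eq_iff cl_bar_def cl_blade_def axis_def)

lemma cl_bar_mult: "cl_bar (a \<odot> b) = cl_bar b \<odot> cl_bar a"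
proof -
  have "cl_bar (a \<odot> b) $ C = (cl_bar b \<odot> cl_bar a) $ C" for C
  proof -
    have inv: "sym_diff C (sym_diff C B) = B" "sym_diff (sym_diff C B) C = B" for B by blast+
    have bij: "bij_betw (sym_diff C) UNIV UNIV"
      by (rule bij_betw_byWitness[where f' = "sym_diff C"]) (use inv in auto)
    have "cl_bar (a \<odot> b) $ C = (\<Sum>A\<in>UNIV. blade_sign C C *
        (blade_sign A (sym_diff A C) * a $ A * b $ (sym_diff A C)))"
      by (simp add: cl_bar_def cl_mult_nth sum_distrib_left blade_sign_self)
    also have "\<dots> = (\<Sum>B\<in>UNIV. blade_sign C C * (blade_sign (sym_diff C B)
        (sym_diff (sym_diff C B) C) * a $ (sym_diff C B) * b $ (sym_diff (sym_diff C B) C)))"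
      by (rule sum.reindex_bij_betw[OF bij, symmetric])
    also have "\<dots> = (\<Sum>B\<in>UNIV. blade_sign B (sym_diff B C) * (blade_sign B B * b $ B) *
        (blade_sign (sym_diff B C) (sym_diff B C) * a $ (sym_diff B C)))"
    proof (rule sum.cong[OF refl])
      fix B :: "'a set"
      have c: "sym_diff C B = sym_diff B C" and d: "sym_diff (sym_diff B C) C = B"
        by blast+
      have "blade_sign C C * blade_sign (sym_diff B C) B
          = blade_sign B (sym_diff B C) * blade_sign B B
            * blade_sign (sym_diff B C) (sym_diff B C)"
        unfolding blade_sign_sym_diff_left blade_sign_sym_diff_right
        using blade_sign_square[of B B] blade_sign_square[of B C] by algebra
      then show "blade_sign C C * (blade_sign (sym_diff C B)
        (sym_diff (sym_diff C B) C) * a $ (sym_diff C B) * b $ (sym_diff (sym_diff C B) C))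
        = blade_sign B (sym_diff B C) * (blade_sign B B * b $ B) *
        (blade_sign (sym_diff B C) (sym_diff B C) * a $ (sym_diff B C))"
        unfolding c d by algebra
    qed
    also have "\<dots> = (cl_bar b \<odot> cl_bar a) $ C"
      by (simp add: cl_bar_def cl_mult_nth blade_sign_self)
    finally show ?thesis .
  qed
  then show ?thesis by (simp add: vec_eq_iff)
qed


section \<open>Spherical monogenics\<close>

definition dirac :: "'m::{finite,linorder} cl_fun \<Rightarrow> 'm::{finite,linorder} cl_fun" where
  "dirac f x = (\<Sum>i\<in>UNIV. cl_gen i \<odot> frechet_derivative f (at x) (axis i 1))"

definition monogenics :: "nat \<Rightarrow> 'm::{finite,linorder} cl_fun set" where
  "monogenics l = {M. polynomial_function M \<and> (\<forall>t x. M (t *\<^sub>R x) = t ^ l *\<^sub>R M x) \<and>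
     (\<forall>x. cl_real (M x)) \<and> (\<forall>x. dirac M x = 0)}"

text \<open>
  The surface measure of the unit sphere as a cone measure: by polar coordinates, a set \<open>S\<close> of
  unit vectors has area \<open>m\<close> times the volume of the cone \<open>{t *\<^sub>R x | x \<in> S, 0 < t \<le> 1}\<close>.
  The origin, which is sent to itself, is a null set.
\<close>

definition sphere_measure :: "(real ^ 'm) measure" where
  "sphere_measure = scale_measure (of_nat CARD('m))
     (distr (restrict_space lborel (cball 0 1)) borel (\<lambda>x. x /\<^sub>R norm x))"

definition sphere_inner ::
    "'m::{finite,linorder} cl_fun \<Rightarrow> 'm::{finite,linorder} cl_fun \<Rightarrow> complex" where
  "sphere_inner M N = cl_scalar (\<integral>x. cl_bar (M x) \<odot> N x \<partial>sphere_measure)"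

text \<open>
  \<open>Mb l 0, \<dots>, Mb l (d l - 1)\<close> is an orthonormal basis of the real vector space \<open>monogenics l\<close>,
  for every degree \<open>l\<close>; linear independence follows from orthonormality.
\<close>

definition monogenic_basis ::
    "(nat \<Rightarrow> nat) \<Rightarrow> (nat \<Rightarrow> nat \<Rightarrow> 'm::{finite,linorder} cl_fun) \<Rightarrow> bool" where
  "monogenic_basis d Mb \<longleftrightarrow> (\<forall>l.
     (\<forall>j<d l. Mb l j \<in> monogenics l) \<and>
     (\<forall>j<d l. \<forall>k<d l. sphere_inner (Mb l j) (Mb l k) = (if j = k then 1 else 0)) \<and>
     (\<forall>M\<in>monogenics l. \<exists>a :: nat \<Rightarrow> real. \<forall>x. M x = (\<Sum>j<d l. a j *\<^sub>R Mb l j x)))"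


section \<open>The weighted space of square integrable functions\<close>

definition weight :: "real \<Rightarrow> real ^ 'm \<Rightarrow> real" where
  "weight c x = norm x powr (1 - (1 + real CARD('m) * c) / (1 + c))"

definition L2 :: "real \<Rightarrow> 'm::{finite,linorder} cl_fun set" where
  "L2 c = {f \<in> borel_measurable lborel.
     \<forall>A. integrable lborel (\<lambda>x. (cmod (f x $ A))\<^sup>2 * weight c x)}"

definition L2_inner ::
    "real \<Rightarrow> 'm::{finite,linorder} cl_fun \<Rightarrow> 'm::{finite,linorder} cl_fun \<Rightarrow> complex" where
  "L2_inner c f g =
     cl_scalar (\<integral>x. weight c x *\<^sub>R (cl_bar (cl_cnj (f x)) \<odot> g x) \<partial>lborel)"

definition L2_norm :: "real \<Rightarrow> 'm::{finite,linorder} cl_fun \<Rightarrow> ennreal" where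
  "L2_norm c f = (if f \<in> L2 c then ennreal (sqrt (Re (L2_inner c f f))) else \<infinity>)"


section \<open>The deformed Fourier transform\<close>

definition delta :: "'m::finite itself \<Rightarrow> real \<Rightarrow> real" where
  "delta _ c = 1 + (real CARD('m) - 1) / (1 + c)"

definition beta :: "real \<Rightarrow> nat \<Rightarrow> real" where
  "beta c l = - (c / (1 + c)) * real l"

definition gam :: "'m::finite itself \<Rightarrow> real \<Rightarrow> nat \<Rightarrow> real" where
  "gam _ c l = 2 / (1 + c) * (real l + (real CARD('m) - 2) / 2) + (c + 2) / (1 + c)"

definition laguerre :: "nat \<Rightarrow> real \<Rightarrow> real \<Rightarrow> real" where
  "laguerre t \<alpha> s =
     (\<Sum>k\<le>t. (-1) ^ k * ((real t + \<alpha>) gchoose (t - k)) * s ^ k / fact k)"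

definition phi ::
    "real \<Rightarrow> nat \<Rightarrow> nat \<Rightarrow> 'm::{finite,linorder} cl_fun \<Rightarrow> 'm::{finite,linorder} cl_fun" where
  "phi c n l M x =
     (let t = n div 2 in
      if even n then
        (2 ^ n * (1 + c) ^ n * fact t * laguerre t (gam TYPE('m) c l / 2 - 1) ((norm x)\<^sup>2)
          * norm x powr beta c l * exp (- (norm x)\<^sup>2 / 2)) *\<^sub>R M x
      else
        (- (2 ^ n) * (1 + c) ^ n * fact t * laguerre t (gam TYPE('m) c l / 2) ((norm x)\<^sup>2)
          * norm x powr beta c l * exp (- (norm x)\<^sup>2 / 2)) *\<^sub>R (cl_vec x \<odot> M x))"

text \<open>
  Operators act on functions rather than on classes modulo null sets, so they are required to
  respect equality almost everywhere, and all identities hold almost everywhere. Off the origin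
  the weight is positive, so its null sets are the Lebesgue null sets.
\<close>

definition unitary_on_L2 ::
    "real \<Rightarrow> ('m::{finite,linorder} cl_fun \<Rightarrow> 'm::{finite,linorder} cl_fun) \<Rightarrow> bool" where
  "unitary_on_L2 c F \<longleftrightarrow>
     (\<forall>f\<in>L2 c. F f \<in> L2 c) \<and>
     (\<forall>f\<in>L2 c. \<forall>g\<in>L2 c. (AE x in lborel. f x = g x) \<longrightarrow> (AE x in lborel. F f x = F g x)) \<and>
     (\<forall>f\<in>L2 c. \<forall>g\<in>L2 c. AE x in lborel. F (\<lambda>y. f y + g y) x = F f x + F g x) \<and>
     (\<forall>z. \<forall>f\<in>L2 c. AE x in lborel. F (\<lambda>y. z *s f y) x = z *s F f x) \<and>
     (\<forall>f\<in>L2 c. \<forall>g\<in>L2 c. L2_inner c (F f) (F g) = L2_inner c f g) \<and>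
     (\<forall>g\<in>L2 c. \<exists>f\<in>L2 c. AE x in lborel. F f x = g x)"

text \<open>
  The transform is characterised as the unitary operator that is diagonal with respect to the
  orthogonal basis \<open>phi c n l (Mb l j)\<close> with the given eigenvalues.
\<close>

definition deformed_fourier ::
    "real \<Rightarrow> (nat \<Rightarrow> nat) \<Rightarrow> (nat \<Rightarrow> nat \<Rightarrow> 'm::{finite,linorder} cl_fun) \<Rightarrow>
     ('m::{finite,linorder} cl_fun \<Rightarrow> 'm::{finite,linorder} cl_fun) \<Rightarrow> bool" where
  "deformed_fourier c d Mb F \<longleftrightarrow> unitary_on_L2 c F \<and>
     (\<forall>n l. \<forall>j<d l. AE x in lborel.
        F (phi c n l (Mb l j)) x =
          ((- \<i>) ^ n * exp (- (\<i> * of_real (pi * real l / (2 * (1 + c)))))) *s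
            phi c n l (Mb l j) x)"

end

theory Submission
  imports Defs
begin

text \<open>
  Since \<open>x\<close> acts as a similitude of ratio \<open>r\<close>, the norms on the left are those of \<open>r f\<close> and \<open>r (F f)\<close>.
  Expand \<open>f\<close> in the normalised functions \<open>phi\<close>, with coefficients \<open>q (n, l, j)\<close>, and expand \<open>r f\<close> in a
  second system whose Laguerre parameters \<open>\<alpha>\<close> are shifted by one. The contiguity relations make
  multiplication by \<open>r\<close> two-diagonal: the coefficients of \<open>r f\<close> are \<open>P - Q\<close> with
  \<open>P = sqrt (t + \<alpha> + 1) q (n, l, j)\<close>, \<open>Q = sqrt (t + 1) q (n + 2, l, j)\<close>, \<open>t = n div 2\<close>. As \<open>F\<close> multiplies
  consecutive terms by opposite factors, those of \<open>r (F f)\<close> are \<open>P + Q\<close> up to unimodular factors. The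
  Bessel and Cauchy-Schwarz inequalities bound the product of the norms below by
  \<open>\<parallel>P\<parallel>\<^sup>2 - \<parallel>Q\<parallel>\<^sup>2 = (\<Sum>(\<alpha> + 1) \<bar>q\<bar>\<^sup>2)\<close>, and \<open>\<alpha> + 1 \<ge> \<delta> / 2\<close> with equality only for \<open>l = 0\<close> and even \<open>n\<close>. In the
  equality case the remaining coefficients form a geometric-type sequence, which is that of a Gaussian.

  Completeness of the functions \<open>phi\<close> reduces to radial and angular parts: the moments of \<open>f\<close> against
  \<open>r ^ (2 * k) * exp (- r\<^sup>2 / 2)\<close> determine its radial behaviour by the Weierstrass theorem, the Fischer
  decomposition turns spherical monogenics into all polynomials, and Stone-Weierstrass concludes.
\<close>

section \<open>Square integrable vector-valued functions\<close>

text \<open>Weighted norms may be infinite and multiplication by \<open>r\<close> is unbounded, so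
  instead of operators and commutators the argument compares coefficient sequences. The second
  system makes this possible: its radial power is \<open>r powr (beta + 1)\<close>, so a factor
  \<open>r\<close> turns it into \<open>r\<^sup>2 * r powr beta\<close>, and \<open>s
  L_t^(\<alpha>+1) = (t+\<alpha>+1) L_t^\<alpha> - (t+1) L_(t+1)^\<alpha>\<close> at
  \<open>s = r\<^sup>2\<close> leads back to two functions of the first system. It enters through
  Bessel's inequality alone, since lower bounds for the weighted norms are wanted. Completeness of
  the first system serves twice: Parseval turns the coefficient sum into the norm of
  \<open>f\<close>, and functions are identified by their coefficients. Two obstacles shape the
  preparations. The powers \<open>r powr beta\<close> have real exponents and must be divided out,
  which is possible only away from the origin; hence the radial cutoffs. And orthogonality on the
  sphere is derived from Gaussian integrals over the whole space, where integration by parts has no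
  boundary terms and polar coordinates recover the sphere.\<close>

definition hdot :: "complex ^ 'n \<Rightarrow> complex ^ 'n \<Rightarrow> complex" where
  "hdot a b = (\<Sum>i\<in>UNIV. cnj (a $ i) * b $ i)"

lemma hdot_add_left: "hdot (a + b) c = hdot a c + hdot b c"
  and hdot_add_right: "hdot a (b + c) = hdot a b + hdot a c"
  and hdot_diff_left: "hdot (a - b) c = hdot a c - hdot b c"
  and hdot_diff_right: "hdot a (b - c) = hdot a b - hdot a c"
  and hdot_minus_left: "hdot (- a) c = - hdot a c"
  and hdot_minus_right: "hdot a (- c) = - hdot a c"
  and hdot_zero_left [simp]: "hdot 0 a = 0"
  and hdot_zero_right [simp]: "hdot a 0 = 0"
  and hdot_scale_left: "hdot (z *s a) c = cnj z * hdot a c"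
  and hdot_scale_right: "hdot a (z *s c) = z * hdot a c"
  and hdot_scaleR_left: "hdot (r *\<^sub>R a) c = of_real r * hdot a c"
  and hdot_scaleR_right: "hdot a (r *\<^sub>R c) = of_real r * hdot a c"
  by (simp_all add: hdot_def algebra_simps sum.distrib sum_subtractf sum_negf sum_distrib_left
      flip: scaleR_conv_of_real scaleR_right.sum)

lemma hdot_sum_left: "hdot (\<Sum>i\<in>I. f i) a = (\<Sum>i\<in>I. hdot (f i) a)"
  by (induction I rule: infinite_finite_induct) (auto simp: hdot_add_left)

lemma hdot_sum_right: "hdot a (\<Sum>i\<in>I. f i) = (\<Sum>i\<in>I. hdot a (f i))"
  by (induction I rule: infinite_finite_induct) (auto simp: hdot_add_right)

lemma cnj_hdot: "cnj (hdot a b) = hdot b a"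
  by (simp add: hdot_def mult.commute)

lemma hdot_self: "hdot a a = of_real ((norm a)\<^sup>2)"
  by (simp add: hdot_def norm_vec_def L2_set_def sum_nonneg complex_norm_square mult.commute
      del: of_real_power)

lemma norm_hdot_le: "norm (hdot a b) \<le> norm a * norm b"
proof -
  have "norm (hdot a b) \<le> (\<Sum>i\<in>UNIV. norm (a $ i) * norm (b $ i))"
    unfolding hdot_def by (rule order.trans[OF norm_sum]) (simp add: norm_mult)
  also have "\<dots> \<le> norm a * norm b"
    unfolding norm_vec_def using L2_set_mult_ineq by (metis (no_types, lifting) abs_norm_cancel sum.cong)
  finally show ?thesis .
qed

lemma norm_hdot_le_sum_squares: "norm (hdot a b) \<le> (norm a)\<^sup>2 + (norm b)\<^sup>2"
proof -
  have "2 * (norm a * norm b) \<le> (norm a)\<^sup>2 + (norm b)\<^sup>2"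
    using zero_le_power2[of "norm a - norm b"] unfolding power2_diff by simp
  moreover have "0 \<le> norm a * norm b" by simp
  ultimately show ?thesis using norm_hdot_le[of a b] by linarith
qed

text \<open>The norm of \<open>complex ^ 'n\<close> is a real norm, so complex scaling is handled
  through \<open>hdot a a\<close>.\<close>

lemma norm_vec_scale: "norm (z *s a) = norm z * norm a" for z :: complex
proof -
  have "of_real ((norm (z *s a))\<^sup>2) = (of_real ((norm z * norm a)\<^sup>2) :: complex)"
    unfolding hdot_self[symmetric] hdot_scale_left hdot_scale_right power_mult_distrib of_real_mult
      complex_norm_square[of z] by (simp add: mult_ac)
  then have "(norm (z *s a))\<^sup>2 = (norm z * norm a)\<^sup>2" unfolding of_real_eq_iff .
  then show ?thesis by (simp add: power2_eq_iff_nonneg)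
qed

lemma borel_measurable_hdot [measurable (raw)]:
  assumes [measurable]: "f \<in> borel_measurable M" "g \<in> borel_measurable M"
  shows "(\<lambda>x. hdot (f x) (g x)) \<in> borel_measurable M"
proof -
  have "continuous_on UNIV (\<lambda>p :: (complex ^ 'n) \<times> (complex ^ 'n). hdot (fst p) (snd p))"
    unfolding hdot_def by (intro continuous_intros)
  from borel_measurable_continuous_on[OF this, of "\<lambda>x. (f x, g x)"] show ?thesis
    by (simp add: measurable_Pair[OF assms, simplified borel_prod])
qed

lemma borel_measurable_vec_scale [measurable (raw)]:
  fixes f :: "'a \<Rightarrow> complex ^ 'n"
  assumes [measurable]: "f \<in> borel_measurable M"
  shows "(\<lambda>x. z *s f x) \<in> borel_measurable M"
proof -
  have "continuous_on UNIV (\<lambda>a. z *s (a :: complex ^ 'n))"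
    unfolding vector_scalar_mult_def by (intro continuous_intros)
  from borel_measurable_continuous_on[OF this assms] show ?thesis .
qed

section \<open>Square integrable functions, inner product and squared norm\<close>

definition sq_int :: "'a measure \<Rightarrow> ('a \<Rightarrow> complex ^ 'n) set" where
  "sq_int M = {f \<in> borel_measurable M. integrable M (\<lambda>x. (norm (f x))\<^sup>2)}"

definition iprod :: "'a measure \<Rightarrow> ('a \<Rightarrow> complex ^ 'n) \<Rightarrow> ('a \<Rightarrow> complex ^ 'n) \<Rightarrow> complex" where
  "iprod M f g = (\<integral>x. hdot (f x) (g x) \<partial>M)"

definition nsq :: "'a measure \<Rightarrow> ('a \<Rightarrow> complex ^ 'n) \<Rightarrow> real" where
  "nsq M f = (\<integral>x. (norm (f x))\<^sup>2 \<partial>M)"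

lemma sq_int_measurable [measurable_dest]: "f \<in> sq_int M \<Longrightarrow> f \<in> borel_measurable M"
  and sq_int_integrable: "f \<in> sq_int M \<Longrightarrow> integrable M (\<lambda>x. (norm (f x))\<^sup>2)"
  by (auto simp: sq_int_def)

lemma sq_int_zero: "(\<lambda>x. 0) \<in> sq_int M"
  by (simp add: sq_int_def)

lemma sq_int_scale:
  assumes "f \<in> sq_int M"
  shows "(\<lambda>x. z *s f x) \<in> sq_int M"
  using assms by (simp add: sq_int_def norm_vec_scale power_mult_distrib borel_measurable_vec_scale)

lemma sq_int_scaleR:
  assumes "f \<in> sq_int M"
  shows "(\<lambda>x. r *\<^sub>R f x) \<in> sq_int M"
  using assms by (auto simp add: sq_int_def power_mult_distrib)

lemma sq_int_add:
  assumes [measurable]: "f \<in> sq_int M" "g \<in> sq_int M"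
  shows "(\<lambda>x. f x + g x) \<in> sq_int M"
proof -
  have "integrable M (\<lambda>x. (norm (f x + g x))\<^sup>2)"
  proof (rule Bochner_Integration.integrable_bound)
    show "integrable M (\<lambda>x. 2 * (norm (f x))\<^sup>2 + 2 * (norm (g x))\<^sup>2)"
      using assms[THEN sq_int_integrable] by simp
    have "(norm (f x + g x))\<^sup>2 \<le> 2 * (norm (f x))\<^sup>2 + 2 * (norm (g x))\<^sup>2" for x
    proof -
      have "(norm (f x + g x))\<^sup>2 \<le> (norm (f x) + norm (g x))\<^sup>2"
        by (intro power_mono norm_triangle_ineq) simp
      also have "\<dots> \<le> 2 * (norm (f x))\<^sup>2 + 2 * (norm (g x))\<^sup>2"
        using zero_le_power2[of "norm (f x) - norm (g x)"]
        unfolding power2_sum power2_diff by linarith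
      finally show ?thesis .
    qed
    then show "AE x in M. norm ((norm (f x + g x))\<^sup>2)
        \<le> norm (2 * (norm (f x))\<^sup>2 + 2 * (norm (g x))\<^sup>2)" by simp
  qed measurable
  then show ?thesis by (simp add: sq_int_def)
qed

lemma sq_int_diff:
  assumes "f \<in> sq_int M" "g \<in> sq_int M"
  shows "(\<lambda>x. f x - g x) \<in> sq_int M"
  using sq_int_add[OF assms(1) sq_int_scaleR[OF assms(2), of "-1"]] by simp

lemma sq_int_sum:
  assumes "\<And>i. i \<in> I \<Longrightarrow> f i \<in> sq_int M"
  shows "(\<lambda>x. \<Sum>i\<in>I. f i x) \<in> sq_int M"
  using assms
  by (induction I rule: infinite_finite_induct) (auto simp: sq_int_zero sq_int_add)

lemma sq_int_cong_AE:
  assumes "f \<in> sq_int M" "AE x in M. f x = g x" "g \<in> borel_measurable M"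
  shows "g \<in> sq_int M"
proof -
  have [measurable]: "f \<in> borel_measurable M" using assms(1) by simp
  note [measurable] = assms(3)
  have "integrable M (\<lambda>x. (norm (f x))\<^sup>2) \<longleftrightarrow> integrable M (\<lambda>x. (norm (g x))\<^sup>2)"
    using assms(2) by (intro integrable_cong_AE) auto
  then show ?thesis using assms by (simp add: sq_int_def)
qed

lemma integrable_hdot:
  assumes [measurable]: "f \<in> sq_int M" "g \<in> sq_int M"
  shows "integrable M (\<lambda>x. hdot (f x) (g x))"
proof (rule Bochner_Integration.integrable_bound)
  show "integrable M (\<lambda>x. (norm (f x))\<^sup>2 + (norm (g x))\<^sup>2)"
    using assms[THEN sq_int_integrable] by simp
  show "AE x in M. norm (hdot (f x) (g x)) \<le> norm ((norm (f x))\<^sup>2 + (norm (g x))\<^sup>2)"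
    using norm_hdot_le_sum_squares by auto
qed measurable

lemma iprod_add_right: "f \<in> sq_int M \<Longrightarrow> g \<in> sq_int M \<Longrightarrow> h \<in> sq_int M \<Longrightarrow>
    iprod M f (\<lambda>x. g x + h x) = iprod M f g + iprod M f h"
  by (simp add: iprod_def hdot_add_right integrable_hdot)

lemma iprod_diff_right: "f \<in> sq_int M \<Longrightarrow> g \<in> sq_int M \<Longrightarrow> h \<in> sq_int M \<Longrightarrow>
    iprod M f (\<lambda>x. g x - h x) = iprod M f g - iprod M f h"
  by (simp add: iprod_def hdot_diff_right integrable_hdot)

lemma iprod_diff_left: "f \<in> sq_int M \<Longrightarrow> g \<in> sq_int M \<Longrightarrow> h \<in> sq_int M \<Longrightarrow>
    iprod M (\<lambda>x. g x - h x) f = iprod M g f - iprod M h f"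
  by (simp add: iprod_def hdot_diff_left integrable_hdot)

lemma iprod_scale_right: "iprod M f (\<lambda>x. z *s g x) = z * iprod M f g"
  by (simp add: iprod_def hdot_scale_right)

lemma iprod_scale_left: "iprod M (\<lambda>x. z *s f x) g = cnj z * iprod M f g"
  by (simp add: iprod_def hdot_scale_left)

lemma iprod_scaleR_left: "iprod M (\<lambda>x. r *\<^sub>R f x) g = of_real r * iprod M f g"
  by (simp add: iprod_def hdot_scaleR_left)

lemma iprod_scaleR_right: "iprod M f (\<lambda>x. r *\<^sub>R g x) = of_real r * iprod M f g"
  by (simp add: iprod_def hdot_scaleR_right)

lemma iprod_sum_right:
  assumes "f \<in> sq_int M" "\<And>i. i \<in> I \<Longrightarrow> g i \<in> sq_int M"
  shows "iprod M f (\<lambda>x. \<Sum>i\<in>I. g i x) = (\<Sum>i\<in>I. iprod M f (g i))"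
  unfolding iprod_def hdot_sum_right
  by (intro Bochner_Integration.integral_sum integrable_hdot assms)

lemma cnj_iprod: "cnj (iprod M f g) = iprod M g f"
  using Bochner_Integration.integral_cnj[of M "\<lambda>x. hdot (f x) (g x)"] by (simp add: iprod_def cnj_hdot)

lemma iprod_self: "iprod M f f = of_real (nsq M f)"
  by (simp add: iprod_def nsq_def hdot_self del: of_real_power)

lemma iprod_cong_AE:
  assumes "AE x in M. f x = f' x" "AE x in M. g x = g' x"
    and [measurable]: "f \<in> borel_measurable M" "f' \<in> borel_measurable M"
      "g \<in> borel_measurable M" "g' \<in> borel_measurable M"
  shows "iprod M f g = iprod M f' g'"
  unfolding iprod_def
  by (rule integral_cong_AE) (use assms(1,2) in \<open>auto simp: borel_measurable_hdot\<close>)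

lemma nsq_nonneg [simp]: "0 \<le> nsq M f"
  by (simp add: nsq_def)

lemma nsq_cong_AE:
  assumes "AE x in M. f x = g x" and [measurable]: "f \<in> borel_measurable M" "g \<in> borel_measurable M"
  shows "nsq M f = nsq M g"
  unfolding nsq_def by (rule integral_cong_AE) (use assms(1) in auto)

lemma nsq_eq_zero:
  assumes [measurable]: "f \<in> sq_int M"
  shows "nsq M f = 0 \<longleftrightarrow> (AE x in M. f x = 0)"
  unfolding nsq_def
  by (subst integral_nonneg_eq_0_iff_AE) (auto simp: sq_int_integrable[OF assms])

section \<open>Orthonormal systems, Bessel and Parseval\<close>

definition orthonormal :: "'a measure \<Rightarrow> 'k set \<Rightarrow> ('k \<Rightarrow> 'a \<Rightarrow> complex ^ 'n) \<Rightarrow> bool" where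
  "orthonormal M I e \<longleftrightarrow> (\<forall>i\<in>I. e i \<in> sq_int M) \<and>
     (\<forall>i\<in>I. \<forall>j\<in>I. iprod M (e i) (e j) = (if i = j then 1 else 0))"

lemma orthonormalD:
  assumes "orthonormal M I e"
  shows "i \<in> I \<Longrightarrow> e i \<in> sq_int M"
    and "i \<in> I \<Longrightarrow> j \<in> I \<Longrightarrow> iprod M (e i) (e j) = (if i = j then 1 else 0)"
  using assms by (auto simp: orthonormal_def)

text \<open>Pythagoras for the finite orthogonal projection: the projection \<open>s\<close> has the
  same coefficients as \<open>f\<close>, hence \<open>iprod M s s = iprod M s f\<close>, and all
  cross terms reduce to the coefficient sum. Bessel's inequality is nonnegativity of the left side;
  Parseval uses the exact value.\<close>

lemma nsq_diff_orthonormal_sum: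
  assumes on: "orthonormal M I e" and J: "finite J" "J \<subseteq> I" and f: "f \<in> sq_int M"
  shows "nsq M (\<lambda>x. f x - (\<Sum>i\<in>J. iprod M (e i) f *s e i x))
     = nsq M f - (\<Sum>i\<in>J. (cmod (iprod M (e i) f))\<^sup>2)"
proof -
  define s where "s = (\<lambda>x. \<Sum>i\<in>J. iprod M (e i) f *s e i x)"
  have e: "e i \<in> sq_int M" if "i \<in> J" for i using orthonormalD(1)[OF on] J that by auto
  have s: "s \<in> sq_int M" unfolding s_def by (intro sq_int_sum sq_int_scale e)
  have fs: "iprod M f s = of_real (\<Sum>i\<in>J. (cmod (iprod M (e i) f))\<^sup>2)"
  proof -
    have "iprod M f s = (\<Sum>i\<in>J. iprod M (e i) f * iprod M f (e i))"
      unfolding s_def by (subst iprod_sum_right) (auto simp: f e sq_int_scale iprod_scale_right)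
    also have "\<dots> = (\<Sum>i\<in>J. of_real ((cmod (iprod M (e i) f))\<^sup>2))"
      by (intro sum.cong refl) (subst cnj_iprod[symmetric, of M f], simp only: complex_norm_square)
    finally show ?thesis by simp
  qed
  have es: "iprod M (e j) s = iprod M (e j) f" if "j \<in> J" for j
  proof -
    have "iprod M (e j) s = (\<Sum>i\<in>J. iprod M (e i) f * iprod M (e j) (e i))"
      unfolding s_def by (subst iprod_sum_right) (auto simp: that e sq_int_scale iprod_scale_right)
    also have "\<dots> = (\<Sum>i\<in>J. if i = j then iprod M (e j) f else 0)"
      by (intro sum.cong refl, subst orthonormalD(2)[OF on]) (use that J in auto)
    finally show ?thesis using J that by simp
  qed
  have ss: "iprod M s s = iprod M s f"
  proof -
    have "iprod M s s = (\<Sum>i\<in>J. iprod M (e i) f * iprod M s (e i))"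
      by (subst (2) s_def, subst iprod_sum_right) (auto simp: s e sq_int_scale iprod_scale_right)
    also have "\<dots> = (\<Sum>i\<in>J. iprod M (e i) f * cnj (iprod M (e i) f))"
      by (intro sum.cong refl) (metis cnj_iprod es)
    also have "\<dots> = of_real (\<Sum>i\<in>J. (cmod (iprod M (e i) f))\<^sup>2)"
      by (simp only: of_real_sum complex_norm_square)
    also have "\<dots> = cnj (iprod M f s)"
      by (simp only: fs complex_cnj_complex_of_real)
    finally show ?thesis by (simp add: cnj_iprod)
  qed
  have "of_real (nsq M (\<lambda>x. f x - s x)) = iprod M (\<lambda>x. f x - s x) (\<lambda>x. f x - s x)"
    by (simp add: iprod_self)
  also have "\<dots> = iprod M f f - iprod M s f - (iprod M f s - iprod M s s)"
    by (simp add: iprod_diff_right iprod_diff_left sq_int_diff f s)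
  also have "\<dots> = of_real (nsq M f - (\<Sum>i\<in>J. (cmod (iprod M (e i) f))\<^sup>2))"
    using ss fs by (simp add: iprod_self[of M f])
  finally show ?thesis unfolding s_def of_real_eq_iff .
qed

lemma bessel:
  assumes on: "orthonormal M I e" and f: "f \<in> sq_int M"
  shows "(\<lambda>i. (cmod (iprod M (e i) f))\<^sup>2) summable_on I"
    and "(\<Sum>\<^sub>\<infinity>i\<in>I. (cmod (iprod M (e i) f))\<^sup>2) \<le> nsq M f"
proof -
  have fin: "(\<Sum>i\<in>J. (cmod (iprod M (e i) f))\<^sup>2) \<le> nsq M f" if "finite J" "J \<subseteq> I" for J
    using nsq_diff_orthonormal_sum[OF on that f]
      nsq_nonneg[of M "\<lambda>x. f x - (\<Sum>i\<in>J. iprod M (e i) f *s e i x)"] by linarith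
  show "(\<lambda>i. (cmod (iprod M (e i) f))\<^sup>2) summable_on I"
    by (rule nonneg_bdd_above_summable_on) (auto intro!: bdd_aboveI2 fin)
  then show "(\<Sum>\<^sub>\<infinity>i\<in>I. (cmod (iprod M (e i) f))\<^sup>2) \<le> nsq M f"
    by (rule infsum_le_finite_sums) (rule fin)
qed

lemma bessel_single:
  assumes "orthonormal M I e" "f \<in> sq_int M" "i \<in> I"
  shows "(cmod (iprod M (e i) f))\<^sup>2 \<le> nsq M f"
  using nsq_diff_orthonormal_sum[OF assms(1) _ _ assms(2), of "{i}"] assms(3)
    nsq_nonneg[of M "\<lambda>x. f x - (\<Sum>j\<in>{i}. iprod M (e j) f *s e j x)"] by simp

lemma iprod_orthonormal_sum:
  assumes on: "orthonormal M I e" and J: "finite J" "J \<subseteq> I" and i: "i \<in> I"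
  shows "iprod M (e i) (\<lambda>x. \<Sum>j\<in>J. a j *s e j x) = (if i \<in> J then a i else 0)"
proof -
  have "iprod M (e i) (\<lambda>x. \<Sum>j\<in>J. a j *s e j x) = (\<Sum>j\<in>J. a j * iprod M (e i) (e j))"
    using orthonormalD(1)[OF on] J i
    by (subst iprod_sum_right) (auto simp: sq_int_scale iprod_scale_right subsetD)
  also have "\<dots> = (\<Sum>j\<in>J. if j = i then a j else 0)"
    by (intro sum.cong refl, subst orthonormalD(2)[OF on]) (use J i in auto)
  finally show ?thesis using J by simp
qed

lemma nsq_orthonormal_sum:
  assumes on: "orthonormal M I e" and J: "finite J" "J \<subseteq> I"
  shows "nsq M (\<lambda>x. \<Sum>i\<in>J. a i *s e i x) = (\<Sum>i\<in>J. (cmod (a i))\<^sup>2)"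
proof -
  let ?g = "\<lambda>x. \<Sum>i\<in>J. a i *s e i x"
  have g: "?g \<in> sq_int M"
    using orthonormalD(1)[OF on] J by (intro sq_int_sum sq_int_scale) auto
  have c: "iprod M (e i) ?g = a i" if "i \<in> J" for i
    using iprod_orthonormal_sum[OF on J, of i a] that J by auto
  have "nsq M (\<lambda>x. ?g x - (\<Sum>i\<in>J. iprod M (e i) ?g *s e i x))
      = nsq M ?g - (\<Sum>i\<in>J. (cmod (iprod M (e i) ?g))\<^sup>2)"
    by (rule nsq_diff_orthonormal_sum[OF on J g])
  then show ?thesis by (simp add: c nsq_def cong: sum.cong)
qed

text \<open>Completeness is assumed as triviality of the orthogonal complement, so the limit of the
  partial sums must first exist as a function. This is the Riesz-Fischer argument: partial sums over
  growing sets with fast decaying tails converge almost everywhere, Fatou's lemma shows that they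
  approach the limit in norm as well, and \<open>f\<close> minus the limit is orthogonal to every
  \<open>e i\<close>.\<close>

theorem parseval:
  fixes e :: "'k \<Rightarrow> 'a \<Rightarrow> complex ^ 'n"
  assumes on: "orthonormal M I e" and f: "f \<in> sq_int M"
    and complete: "\<And>g. g \<in> sq_int M \<Longrightarrow> (\<And>i. i \<in> I \<Longrightarrow> iprod M (e i) g = 0) \<Longrightarrow> AE x in M. g x = 0"
  shows "((\<lambda>i. (cmod (iprod M (e i) f))\<^sup>2) has_sum nsq M f) I"
proof -
  define c where "c i = iprod M (e i) f" for i
  define q where "q i = (cmod (c i))\<^sup>2" for i
  define s where "s = (\<Sum>\<^sub>\<infinity>i\<in>I. q i)"
  have q0: "0 \<le> q i" for i by (simp add: q_def)
  have summ: "q summable_on I" and s_le: "s \<le> nsq M f"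
    using bessel[OF on f] unfolding s_def q_def c_def by auto
  have q_le: "sum q F \<le> s" if "finite F" "F \<subseteq> I" for F
    unfolding s_def by (rule finite_sum_le_infsum[OF summ that]) (auto simp: q0)
  \<comment> \<open>The rate \<open>1/4\<close> leaves room for a weight \<open>2 ^ n\<close> on the
    squared increments: \<open>2 ^ n * (1/4) ^ n\<close> is still summable.\<close>
  have "\<exists>F. finite F \<and> F \<subseteq> I \<and> s - sum q F \<le> (1/4) ^ n" for n :: nat
  proof -
    have "(0::real) < (1/4) ^ n" by simp
    from infsum_finite_approximation[OF summ this]
    show ?thesis unfolding s_def dist_real_def by (force simp: abs_le_iff)
  qed
  then obtain K where K: "finite (K n)" "K n \<subseteq> I" "s - sum q (K n) \<le> (1/4) ^ n" for n by metis
  define J where "J n = (\<Union>k\<le>n. K k)" for n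
  have J: "finite (J n)" "J n \<subseteq> I" for n using K by (auto simp: J_def)
  have Jmono: "J n \<subseteq> J m" if "n \<le> m" for n m using that by (force simp: J_def)
  have Js: "s - sum q (J n) \<le> (1/4) ^ n" for n
  proof -
    have "sum q (K n) \<le> sum q (J n)"
      by (rule sum_mono2) (use J q0 in \<open>auto simp: J_def\<close>)
    with K(3)[of n] show ?thesis by simp
  qed
  define u where "u n x = (\<Sum>i\<in>J n. c i *s e i x)" for n x
  have u: "u n \<in> sq_int M" for n
    unfolding u_def using orthonormalD(1)[OF on] J by (intro sq_int_sum sq_int_scale) auto
  note [measurable] = sq_int_measurable[OF u]
  have diff: "nsq M (\<lambda>x. u m x - u n x) \<le> (1/4) ^ n" if "n \<le> m" for n m
  proof -
    have "u m x - u n x = (\<Sum>i\<in>J m - J n. c i *s e i x)" for x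
      unfolding u_def using J Jmono[OF that] by (simp add: sum_diff)
    moreover have "J m - J n \<subseteq> I" "finite (J m - J n)" using J by blast+
    ultimately have "nsq M (\<lambda>x. u m x - u n x) = sum q (J m - J n)"
      unfolding q_def using nsq_orthonormal_sum[OF on, of "J m - J n" c] by presburger
    also have "\<dots> = sum q (J m) - sum q (J n)"
      using J Jmono[OF that] by (simp add: sum_diff)
    also have "\<dots> \<le> (1/4) ^ n" using Js[of n] q_le[OF J, of m] by linarith
    finally show ?thesis .
  qed
  have nn: "(\<integral>\<^sup>+x. ennreal ((norm (g x))\<^sup>2) \<partial>M) = ennreal (nsq M g)"
    if "g \<in> sq_int M" for g :: "'a \<Rightarrow> complex ^ 'n"
    unfolding nsq_def by (rule nn_integral_eq_integral) (auto intro: sq_int_integrable that)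
  have conv: "AE x in M. convergent (\<lambda>n. u n x)"
  proof -
    let ?d = "\<lambda>n x. u (Suc n) x - u n x"
    have d: "?d n \<in> sq_int M" for n by (intro sq_int_diff u)
    have "(\<integral>\<^sup>+x. (\<Sum>n. ennreal (2 ^ n * (norm (?d n x))\<^sup>2)) \<partial>M)
        = (\<Sum>n. ennreal (2 ^ n) * (\<integral>\<^sup>+x. ennreal ((norm (?d n x))\<^sup>2) \<partial>M))"
      by (subst nn_integral_suminf) (auto simp: ennreal_mult nn_integral_cmult)
    also have "\<dots> \<le> (\<Sum>n. ennreal ((1/2) ^ n))"
    proof (intro suminf_le)
      fix n
      have "ennreal (2 ^ n) * (\<integral>\<^sup>+x. ennreal ((norm (?d n x))\<^sup>2) \<partial>M) = ennreal (2 ^ n * nsq M (?d n))"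
        by (simp add: nn[OF d] ennreal_mult)
      also have "2 ^ n * nsq M (?d n) \<le> 2 ^ n * (1/4) ^ n"
        by (intro mult_left_mono diff) auto
      also have "2 ^ n * (1/4) ^ n = ((1/2) ^ n :: real)"
        by (simp flip: power_mult_distrib)
      finally show "ennreal (2 ^ n) * (\<integral>\<^sup>+x. ennreal ((norm (?d n x))\<^sup>2) \<partial>M) \<le> ennreal ((1/2) ^ n)"
        by (simp add: ennreal_leI)
    qed auto
    also have "\<dots> < \<infinity>"
      by (subst suminf_ennreal2) (auto simp: summable_geometric)
    finally have "AE x in M. (\<Sum>n. ennreal (2 ^ n * (norm (?d n x))\<^sup>2)) \<noteq> \<infinity>"
      by (intro nn_integral_noteq_infinite) auto
    then show ?thesis
    proof (eventually_elim)
      case (elim x)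
      then have "summable (\<lambda>n. 2 ^ n * (norm (?d n x))\<^sup>2)"
        by (intro summable_suminf_not_top) auto
      then have *: "summable (\<lambda>n. (1/2) ^ n + 2 ^ n * (norm (?d n x))\<^sup>2)"
        by (intro summable_add) (auto simp: summable_geometric)
      \<comment> \<open>Weighted arithmetic-geometric estimate \<open>y \<le> 1/a + a y^2\<close>
        with \<open>a = 2 ^ n\<close>: both summands are summable, so the increments converge
        absolutely at this point.\<close>
      have "norm (?d n x) \<le> (1/2) ^ n + 2 ^ n * (norm (?d n x))\<^sup>2" for n
      proof -
        define a where "a = (2::real) ^ n"
        define y where "y = norm (?d n x)"
        have a: "a > 0" "(1/2) ^ n = 1 / a" by (auto simp: a_def power_divide)
        have "0 \<le> (1 - a * y)\<^sup>2 + a * y" using a by (simp add: y_def)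
        then have "a * y \<le> 1 + a * a * y\<^sup>2" by (simp add: power2_eq_square algebra_simps)
        then have "y \<le> 1 / a + a * y\<^sup>2" using a by (simp add: field_simps power2_eq_square)
        then show ?thesis by (simp add: a(2) flip: a_def y_def)
      qed
      then have "summable (\<lambda>n. ?d n x)"
        by (intro summable_comparison_test'[OF *, of 0]) auto
      then have "convergent (\<lambda>n. \<Sum>k<n. ?d k x)"
        by (simp add: summable_iff_convergent)
      then have "convergent (\<lambda>n. (\<Sum>k<n. ?d k x) + u 0 x)"
        by (intro convergent_add convergent_const)
      moreover have "(\<Sum>k<n. ?d k x) + u 0 x = u n x" for n
        using sum_lessThan_telescope[of "\<lambda>k. u k x" n] by simp
      ultimately show ?case by simp
    qed
  qed
  define v where "v x = lim (\<lambda>n. u n x)" for x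
  have [measurable]: "v \<in> borel_measurable M"
    unfolding v_def by (rule borel_measurable_lim_metric) measurable
  have lim: "AE x in M. (\<lambda>n. u n x) \<longlonglongrightarrow> v x"
    using conv by eventually_elim (auto simp: v_def convergent_LIMSEQ_iff)
  \<comment> \<open>The bound for \<open>u m - u n\<close> holds for all \<open>m \<ge> n\<close>;
    Fatou's lemma carries it to the limit in \<open>m\<close>.\<close>
  have fatou: "(\<integral>\<^sup>+x. ennreal ((norm (v x - u n x))\<^sup>2) \<partial>M) \<le> ennreal ((1/4) ^ n)" for n
  proof -
    have "(\<integral>\<^sup>+x. ennreal ((norm (v x - u n x))\<^sup>2) \<partial>M)
       = (\<integral>\<^sup>+x. liminf (\<lambda>m. ennreal ((norm (u m x - u n x))\<^sup>2)) \<partial>M)"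
    proof (rule nn_integral_cong_AE, use lim in eventually_elim)
      case (elim x)
      have "(\<lambda>m. ennreal ((norm (u m x - u n x))\<^sup>2)) \<longlonglongrightarrow> ennreal ((norm (v x - u n x))\<^sup>2)"
        by (intro tendsto_intros elim)
      from lim_imp_Liminf[OF sequentially_bot this] show ?case by simp
    qed
    also have "\<dots> \<le> liminf (\<lambda>m. (\<integral>\<^sup>+x. ennreal ((norm (u m x - u n x))\<^sup>2) \<partial>M))"
      by (rule nn_integral_liminf) measurable
    also have "\<dots> \<le> liminf (\<lambda>m. ennreal ((1/4) ^ n))"
    proof (intro Liminf_mono eventually_sequentiallyI[of n])
      fix m assume "n \<le> m"
      then show "(\<integral>\<^sup>+x. ennreal ((norm (u m x - u n x))\<^sup>2) \<partial>M) \<le> ennreal ((1/4) ^ n)"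
        unfolding nn[OF sq_int_diff[OF u u]] by (intro ennreal_leI diff)
    qed
    finally show ?thesis by (simp add: Liminf_const)
  qed
  have vu: "(\<lambda>x. v x - u n x) \<in> sq_int M" for n
  proof -
    have "(\<integral>\<^sup>+x. ennreal (norm ((norm (v x - u n x))\<^sup>2)) \<partial>M) < \<infinity>"
      using le_less_trans[OF fatou[of n] ennreal_less_top] by simp
    then have "integrable M (\<lambda>x. (norm (v x - u n x))\<^sup>2)"
      by (intro integrableI_bounded) measurable
    then show ?thesis by (simp add: sq_int_def)
  qed
  have vun: "nsq M (\<lambda>x. v x - u n x) \<le> (1/4) ^ n" for n
    using fatou[of n] by (simp add: nn[OF vu])
  have v: "v \<in> sq_int M" using sq_int_add[OF vu[of 0] u[of 0]] by simp
  have "AE x in M. f x - v x = 0"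
  proof (rule complete)
    show "(\<lambda>x. f x - v x) \<in> sq_int M" by (intro sq_int_diff f v)
    fix i assume i: "i \<in> I"
    have e: "e i \<in> sq_int M" using orthonormalD(1)[OF on i] .
    have iu: "iprod M (e i) (u n) = (if i \<in> J n then c i else 0)" for n
    proof -
      have "u n = (\<lambda>x. \<Sum>i\<in>J n. c i *s e i x)" by (simp add: u_def fun_eq_iff)
      then show ?thesis using iprod_orthonormal_sum[where a = c, OF on J(1)[of n] J(2)[of n] i] by simp
    qed
    \<comment> \<open>Two errors of size \<open>(1/2) ^ n\<close>: the distance from
      \<open>v\<close> to \<open>u n\<close>, seen by \<open>e i\<close> through Bessel, and, if
      \<open>i\<close> is not yet in \<open>J n\<close>, the coefficient \<open>c i\<close> itself,
      which is then part of the tail.\<close>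
    have "cmod (iprod M (e i) (\<lambda>x. f x - v x)) \<le> 2 * (1/2) ^ n" for n
    proof -
      have sq: "cmod z \<le> (1/2) ^ n" if "(cmod z)\<^sup>2 \<le> (1/4) ^ n" for z
      proof -
        have "((1/2) ^ n)\<^sup>2 = ((1/2)\<^sup>2 :: real) ^ n"
          by (simp only: power_mult[symmetric] mult.commute)
        also have "(1/2)\<^sup>2 = (1/4 :: real)" by (simp add: power_divide)
        finally have "(cmod z)\<^sup>2 \<le> ((1/2) ^ n)\<^sup>2" using that by (simp only:)
        then show ?thesis by (rule power2_le_imp_le) simp
      qed
      have "cmod (iprod M (e i) (\<lambda>x. v x - u n x)) \<le> (1/2) ^ n"
        using bessel_single[OF on vu[of n] i] vun[of n] by (intro sq) linarith
      moreover have "cmod (c i - iprod M (e i) (u n)) \<le> (1/2) ^ n"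
      proof (cases "i \<in> J n")
        case True
        then show ?thesis by (simp add: iu)
      next
        case False
        have "sum q (insert i (J n)) \<le> s" by (rule q_le) (use J i in auto)
        then have "(cmod (c i))\<^sup>2 \<le> (1/4) ^ n"
          using False J Js[of n] by (simp add: q_def)
        then show ?thesis using False by (simp add: iu sq)
      qed
      moreover have eq: "iprod M (e i) (\<lambda>x. f x - v x)
         = (c i - iprod M (e i) (u n)) - iprod M (e i) (\<lambda>x. v x - u n x)"
        using iprod_diff_right[OF e f v] iprod_diff_right[OF e v u] by (simp add: c_def)
      ultimately show ?thesis unfolding eq
        using norm_triangle_ineq4[of "c i - iprod M (e i) (u n)" "iprod M (e i) (\<lambda>x. v x - u n x)"]
        by linarith
    qed
    moreover have "(\<lambda>n. 2 * (1/2::real) ^ n) \<longlonglongrightarrow> 0"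
      by (rule tendsto_mult_right_zero[OF LIMSEQ_power_zero]) simp
    ultimately have "cmod (iprod M (e i) (\<lambda>x. f x - v x)) \<le> 0"
      by (rule LIMSEQ_le_const[rotated, OF exI, rule_format])
    then show "iprod M (e i) (\<lambda>x. f x - v x) = 0" by simp
  qed
  then have fv: "AE x in M. f x = v x" by eventually_elim simp
  have "nsq M f \<le> s + (1/4) ^ n" for n
  proof -
    have "nsq M f - sum q (J n) = nsq M (\<lambda>x. f x - u n x)"
      using nsq_diff_orthonormal_sum[OF on J f, of n] by (simp add: u_def c_def q_def)
    also have "\<dots> = nsq M (\<lambda>x. v x - u n x)"
      by (rule nsq_cong_AE) (use fv f in auto)
    finally show ?thesis using vun[of n] q_le[OF J, of n] by linarith
  qed
  moreover have "(\<lambda>n. s + (1/4::real) ^ n) \<longlonglongrightarrow> s + 0"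
    by (rule tendsto_add[OF tendsto_const LIMSEQ_power_zero]) simp
  ultimately have "nsq M f \<le> s + 0"
    by (rule LIMSEQ_le_const[rotated, OF exI, rule_format])
  then have "nsq M f \<le> s" by simp
  with s_le have "s = nsq M f" by simp
  then show ?thesis using has_sum_infsum[OF summ] unfolding s_def q_def c_def by simp
qed

section \<open>Polar coordinates\<close>

lemma scaled_vector_set_measure:
  fixes B :: "'a::euclidean_space set"
  assumes "B \<in> sets borel" "s > 0"
  shows "emeasure lborel ((\<lambda>x. s *\<^sub>R x) -` B) = ennreal (1 / s ^ DIM('a)) * emeasure lborel B"
proof -
  have l: "lborel = density (distr lborel borel (\<lambda>x::'a. 0 + s *\<^sub>R x)) (\<lambda>_. s ^ DIM('a))"
    using lborel_affine[of s "0::'a"] assms by simp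
  have "emeasure lborel B = s ^ DIM('a) * emeasure (distr lborel borel (\<lambda>x::'a. 0 + s *\<^sub>R x)) B"
    by (subst l, subst emeasure_density) (auto simp: assms nn_integral_cmult_indicator)
  also have "emeasure (distr lborel borel (\<lambda>x::'a. 0 + s *\<^sub>R x)) B
     = emeasure lborel ((\<lambda>x. s *\<^sub>R x) -` B)"
    using assms by (subst emeasure_distr) auto
  finally have "ennreal (1 / s ^ DIM('a)) * emeasure lborel B
      = ennreal (1 / s ^ DIM('a)) * ennreal (s ^ DIM('a)) * emeasure lborel ((\<lambda>x. s *\<^sub>R x) -` B)"
    by (simp add: mult.assoc)
  also have "ennreal (1 / s ^ DIM('a)) * ennreal (s ^ DIM('a)) = 1"
    using assms by (subst ennreal_mult[symmetric]) auto
  finally show ?thesis by simp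
qed

text \<open>Radial part of Lebesgue measure in the variable \<open>s = r^2\<close>:
  \<open>r^(n-1) dr = s^(n/2-1) ds / 2\<close>. The square is the natural variable since Gaussians
  and Laguerre polynomials depend on it.\<close>

definition radial_measure :: "nat \<Rightarrow> real measure" where
  "radial_measure n = density lborel (\<lambda>s. if s > 0 then s powr (real n / 2 - 1) / 2 else 0)"

lemma sets_sphere_measure [simp, measurable_cong]: "sets sphere_measure = sets borel"
  and space_sphere_measure [simp]: "space sphere_measure = UNIV"
  and sets_radial_measure [simp, measurable_cong]: "sets (radial_measure n) = sets borel"
  by (simp_all add: sphere_measure_def radial_measure_def space_scale_measure)

lemma emeasure_sphere_measure:
  fixes B :: "(real ^ 'm::finite) set"
  assumes [measurable]: "B \<in> sets borel"
  shows "emeasure sphere_measure B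
     = of_nat CARD('m) * emeasure lborel {x. norm x \<le> 1 \<and> x /\<^sub>R norm x \<in> B}"
proof -
  have m: "(\<lambda>x::real ^ 'm. x /\<^sub>R norm x) \<in> restrict_space lborel (cball 0 1) \<rightarrow>\<^sub>M borel"
    by (intro measurable_restrict_space1) measurable
  have "emeasure (distr (restrict_space lborel (cball 0 1)) borel (\<lambda>x::real ^ 'm. x /\<^sub>R norm x)) B
      = emeasure (restrict_space lborel (cball 0 1))
         ((\<lambda>x. x /\<^sub>R norm x) -` B \<inter> space (restrict_space lborel (cball 0 1)))"
    by (rule emeasure_distr[OF m]) simp
  also have "\<dots> = emeasure lborel ((\<lambda>x. x /\<^sub>R norm x) -` B \<inter> cball 0 1)"
    by (subst emeasure_restrict_space) (auto simp: space_restrict_space)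
  also have "(\<lambda>x. x /\<^sub>R norm x) -` B \<inter> cball 0 1 = {x. norm x \<le> 1 \<and> x /\<^sub>R norm x \<in> B}"
    by auto
  finally show ?thesis by (simp add: sphere_measure_def)
qed

lemma emeasure_sphere_measure_finite: "emeasure (sphere_measure :: (real ^ 'm::finite) measure) B < \<infinity>"
proof -
  have "emeasure (sphere_measure :: (real ^ 'm) measure) B \<le> emeasure sphere_measure (UNIV :: (real ^ 'm) set)"
    by (metis emeasure_space space_sphere_measure)
  also have "\<dots> = of_nat CARD('m) * emeasure lborel (cball 0 1 :: (real ^ 'm) set)"
    by (subst emeasure_sphere_measure) (auto simp: cball_def dist_norm)
  also have "\<dots> < \<infinity>"
    using emeasure_lborel_cball_finite[of "0::real ^ 'm" 1]
    by (simp add: ennreal_mult_less_top of_nat_less_top)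
  finally show ?thesis .
qed

lemma finite_measure_sphere: "finite_measure (sphere_measure :: (real ^ 'm::finite) measure)"
  by (rule finite_measureI) (use emeasure_sphere_measure_finite[of "UNIV :: (real ^ 'm) set"] in auto)

lemma AE_sphere_measure_norm: "AE x in (sphere_measure :: (real ^ 'm::finite) measure). norm x = 1"
proof -
  have "emeasure sphere_measure {x :: real ^ 'm. norm x \<noteq> 1} = 0"
  proof -
    have "{x :: real ^ 'm. norm x \<le> 1 \<and> x /\<^sub>R norm x \<in> {x. norm x \<noteq> 1}} \<subseteq> {0}"
      by (auto simp: field_simps)
    then have "emeasure lborel {x :: real ^ 'm. norm x \<le> 1 \<and> x /\<^sub>R norm x \<in> {x. norm x \<noteq> 1}} \<le> emeasure lborel {0 :: real ^ 'm}"
      by (intro emeasure_mono) auto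
    then show ?thesis by (subst emeasure_sphere_measure) auto
  qed
  then show ?thesis by (intro AE_I[where N = "{x. norm x \<noteq> 1}"]) auto
qed

lemma emeasure_radial_measure_atMost:
  assumes "n > 0" "R > 0"
  shows "emeasure (radial_measure n) {..R} = ennreal (R powr (real n / 2) / real n)"
proof -
  have "emeasure (radial_measure n) {..R} = (\<integral>\<^sup>+s. ennreal (s powr (real n / 2 - 1) / 2) * indicator {0<..R} s \<partial>lborel)"
    unfolding radial_measure_def
    by (subst emeasure_density) (auto intro!: nn_integral_cong simp: indicator_def)
  also have "\<dots> = (\<integral>\<^sup>+s. ennreal (s powr (real n / 2 - 1) / 2) * indicator {0..R} s \<partial>lborel)"
    by (intro nn_integral_cong) (auto simp: indicator_def)
  also have "\<dots> = ennreal (R powr (real n / 2) / real n)"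
  proof -
    have "((\<lambda>s. s powr (real n / 2 - 1)) has_integral R powr (real n / 2 - 1 + 1) / (real n / 2 - 1 + 1)) {0..R}"
      using assms by (intro has_integral_powr_from_0) auto
    from has_integral_mult_right[OF this, of "1/2"]
    have "((\<lambda>s. s powr (real n / 2 - 1) / 2) has_integral R powr (real n / 2) / real n) {0..R}"
      by simp
    then show ?thesis
      by (rule nn_integral_has_integral_lebesgue'[rotated]) simp
  qed
  finally show ?thesis .
qed

lemma emeasure_radial_measure_nonpos: "R \<le> 0 \<Longrightarrow> emeasure (radial_measure n) {..R} = 0"
  unfolding radial_measure_def
  by (subst emeasure_density) (auto simp: indicator_def nn_integral_0_iff_AE)

text \<open>For a fixed set of directions, scaling of Lebesgue measure determines the measure of
  every truncated cone \<open>(norm x)^2 \<le> R\<close> from the one with \<open>R = 1\<close>,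
  which defines \<open>sphere_measure\<close>. Both sides then agree on half-lines in the radial
  variable, an intersection-stable generator of the Borel sets.\<close>

lemma polar_measure:
  "distr lborel (borel \<Otimes>\<^sub>M borel) (\<lambda>x::real ^ 'm. ((norm x)\<^sup>2, x /\<^sub>R norm x))
     = radial_measure CARD('m) \<Otimes>\<^sub>M sphere_measure"
proof (rule pair_measure_eqI[symmetric])
  let ?n = "CARD('m)"
  let ?D = "distr lborel (borel \<Otimes>\<^sub>M borel) (\<lambda>x::real ^ 'm. ((norm x)\<^sup>2, x /\<^sub>R norm x))"
  show "sigma_finite_measure (sphere_measure :: (real ^ 'm) measure)"
    using finite_measure_sphere by (rule finite_measure.axioms(1))
  show "sigma_finite_measure (radial_measure ?n)"
    unfolding radial_measure_def
    by (subst sigma_finite_measure.sigma_finite_iff_density_finite) (auto intro: lborel.sigma_finite_measure_axioms)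
  show "sets (radial_measure ?n \<Otimes>\<^sub>M (sphere_measure :: (real ^ 'm) measure)) = sets ?D"
    by (simp cong: sets_pair_measure_cong)
  fix A :: "real set" and B :: "(real ^ 'm) set"
  assume "A \<in> sets (radial_measure ?n)" "B \<in> sets sphere_measure"
  then have A [measurable]: "A \<in> sets borel" and B [measurable]: "B \<in> sets borel" by auto
  define D where "D = distr (restrict_space lborel {x. x /\<^sub>R norm x \<in> B}) borel (\<lambda>x::real ^ 'm. (norm x)\<^sup>2)"
  have emD: "emeasure D A = emeasure lborel {x. (norm x)\<^sup>2 \<in> A \<and> x /\<^sub>R norm x \<in> B}"
    if [measurable]: "A \<in> sets borel" for A
  proof -
    have m: "(\<lambda>x::real ^ 'm. (norm x)\<^sup>2) \<in> restrict_space lborel {x. x /\<^sub>R norm x \<in> B} \<rightarrow>\<^sub>M borel"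
      by (intro measurable_restrict_space1) measurable
    have "emeasure D A = emeasure (restrict_space lborel {x. x /\<^sub>R norm x \<in> B})
         ((\<lambda>x. (norm x)\<^sup>2) -` A \<inter> space (restrict_space lborel {x. x /\<^sub>R norm x \<in> B}))"
      unfolding D_def by (rule emeasure_distr[OF m]) simp
    also have "\<dots> = emeasure lborel ((\<lambda>x. (norm x)\<^sup>2) -` A \<inter> {x. x /\<^sub>R norm x \<in> B})"
      by (subst emeasure_restrict_space) (auto simp: space_restrict_space)
    also have "(\<lambda>x. (norm x)\<^sup>2) -` A \<inter> {x. x /\<^sub>R norm x \<in> B} = {x. (norm x)\<^sup>2 \<in> A \<and> x /\<^sub>R norm x \<in> B}"
      by auto
    finally show ?thesis .
  qed
  define k where "k = emeasure sphere_measure B"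
  have kfin: "k < \<infinity>" unfolding k_def by (rule emeasure_sphere_measure_finite)
  have key: "emeasure D {..R} = k * emeasure (radial_measure ?n) {..R}" for R
  proof (cases "R > 0")
    case True
    \<comment> \<open>The dilation by \<open>1 / sqrt R\<close> carries the truncated cone to the
      one of radius 1 and keeps directions.\<close>
    define s where "s = 1 / sqrt R"
    have s: "s > 0" using True by (simp add: s_def)
    have set: "{x :: real ^ 'm. (norm x)\<^sup>2 \<in> {..R} \<and> x /\<^sub>R norm x \<in> B} = (\<lambda>x. s *\<^sub>R x) -` {x. norm x \<le> 1 \<and> x /\<^sub>R norm x \<in> B}"
    proof -
      have a: "(norm x)\<^sup>2 \<le> R \<longleftrightarrow> norm (s *\<^sub>R x) \<le> 1" for x :: "real ^ 'm"
        using True by (simp add: s_def field_simps real_le_rsqrt sqrt_ge_absD)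
          (metis abs_norm_cancel real_sqrt_abs real_sqrt_le_iff)
      have b: "(s *\<^sub>R x) /\<^sub>R norm (s *\<^sub>R x) = x /\<^sub>R norm x" for x :: "real ^ 'm"
        using s by simp
      show ?thesis
      proof (rule set_eqI)
        fix x
        show "x \<in> {x. (norm x)\<^sup>2 \<in> {..R} \<and> x /\<^sub>R norm x \<in> B}
          \<longleftrightarrow> x \<in> (\<lambda>x. s *\<^sub>R x) -` {x. norm x \<le> 1 \<and> x /\<^sub>R norm x \<in> B}"
          using a[of x] b[of x] by (metis (no_types, lifting) atMost_iff mem_Collect_eq vimage_eq)
      qed
    qed
    have "emeasure D {..R} = emeasure lborel ((\<lambda>x. s *\<^sub>R x) -` {x :: real ^ 'm. norm x \<le> 1 \<and> x /\<^sub>R norm x \<in> B})"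
      by (subst emD) (simp_all only: set, auto)
    also have "\<dots> = ennreal (1 / s ^ ?n) * emeasure lborel {x :: real ^ 'm. norm x \<le> 1 \<and> x /\<^sub>R norm x \<in> B}"
      by (subst scaled_vector_set_measure) (use s in auto)
    also have "1 / s ^ ?n = R powr (real ?n / 2)"
    proof -
      have "1 / s ^ ?n = (sqrt R) ^ ?n" by (simp add: s_def power_one_over)
      also have "\<dots> = (R powr (1/2)) powr (real ?n)"
        using True by (simp add: powr_realpow powr_half_sqrt)
      also have "\<dots> = R powr (real ?n / 2)" by (simp add: powr_powr)
      finally show ?thesis .
    qed
    also have "R powr (real ?n / 2) = R powr (real ?n / 2) / real ?n * real ?n" by simp
    also have "ennreal \<dots> = ennreal (R powr (real ?n / 2) / real ?n) * of_nat ?n"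
      by (subst ennreal_mult) (auto simp: ennreal_of_nat_eq_real_of_nat)
    finally show ?thesis
      using True by (simp add: emeasure_radial_measure_atMost k_def emeasure_sphere_measure mult_ac)
  next
    case False
    have "{x :: real ^ 'm. (norm x)\<^sup>2 \<le> R \<and> x /\<^sub>R norm x \<in> B} \<subseteq> {0}"
    proof (intro subsetI CollectI)
      fix x :: "real ^ 'm" assume "x \<in> {x. (norm x)\<^sup>2 \<le> R \<and> x /\<^sub>R norm x \<in> B}"
      then have "(norm x)\<^sup>2 \<le> R" by simp
      with False have "(norm x)\<^sup>2 \<le> 0" by linarith
      then have "norm x = 0" by (simp only: power2_less_eq_zero_iff)
      then show "x \<in> {0}" by simp
    qed
    then have "emeasure lborel {x :: real ^ 'm. (norm x)\<^sup>2 \<le> R \<and> x /\<^sub>R norm x \<in> B} \<le> emeasure lborel {0 :: real ^ 'm}"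
      by (intro emeasure_mono) auto
    then show ?thesis using False by (simp add: emD emeasure_radial_measure_nonpos)
  qed
  have "D = density (radial_measure ?n) (\<lambda>_. k)"
  proof (rule measure_eqI_generator_eq[where E = "range (\<lambda>R::real. {..R})" and \<Omega> = UNIV and A = "\<lambda>i. {.. real i}"])
    show "Int_stable (range (\<lambda>R::real. {..R}))"
      by (auto simp: Int_stable_def)
    show "sets D = sigma_sets UNIV (range (\<lambda>R::real. {..R}))"
      and "sets (density (radial_measure ?n) (\<lambda>_. k)) = sigma_sets UNIV (range (\<lambda>R::real. {..R}))"
      by (auto simp: D_def borel_eq_atMost)
    show "(\<Union>i. {..real i}) = UNIV" by (auto intro: real_arch_simple)
    fix X assume "X \<in> range (\<lambda>R::real. {..R})"
    then obtain R where X: "X = {..R}" by auto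
    show "emeasure D X = emeasure (density (radial_measure ?n) (\<lambda>_. k)) X"
      unfolding X key by (subst emeasure_density_const) auto
  next
    fix i :: nat
    have "emeasure (radial_measure ?n) {..real i} < \<infinity>"
      by (cases "i = 0") (auto simp: emeasure_radial_measure_nonpos emeasure_radial_measure_atMost)
    then show "emeasure D {..real i} \<noteq> \<infinity>"
      unfolding key using kfin by (auto simp: ennreal_mult_eq_top_iff)
  qed auto
  then have "emeasure D A = k * emeasure (radial_measure ?n) A"
    by (simp add: emeasure_density_const)
  moreover have "emeasure ?D (A \<times> B) = emeasure D A"
    by (subst emeasure_distr) (auto simp: emD intro!: arg_cong2[where f = emeasure])
  ultimately show "emeasure (radial_measure ?n) A * emeasure sphere_measure B = emeasure ?D (A \<times> B)"
    by (simp add: k_def mult.commute)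
qed

lemma polar_integral:
  fixes g :: "real \<Rightarrow> real" and Y :: "real ^ 'm \<Rightarrow> complex"
  assumes g: "integrable (radial_measure CARD('m)) g" and Y: "integrable sphere_measure Y"
  shows "integrable lborel (\<lambda>x. g ((norm x)\<^sup>2) *\<^sub>R Y (x /\<^sub>R norm x))" (is ?i)
    and "(\<integral>x. g ((norm x)\<^sup>2) *\<^sub>R Y (x /\<^sub>R norm x) \<partial>lborel)
      = (\<integral>s. g s \<partial>radial_measure CARD('m)) *\<^sub>R (\<integral>x. Y x \<partial>sphere_measure)" (is ?e)
proof -
  interpret S: sigma_finite_measure "sphere_measure :: (real ^ 'm) measure"
    using finite_measure_sphere by (rule finite_measure.axioms(1))
  interpret R: sigma_finite_measure "radial_measure CARD('m)"
    unfolding radial_measure_def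
    by (subst sigma_finite_measure.sigma_finite_iff_density_finite) (auto intro: lborel.sigma_finite_measure_axioms)
  interpret P: pair_sigma_finite "radial_measure CARD('m)" "sphere_measure :: (real ^ 'm) measure" ..
  have [measurable]: "g \<in> borel_measurable borel" "Y \<in> borel_measurable borel"
    using borel_measurable_integrable[OF g] borel_measurable_integrable[OF Y]
    by (auto cong: measurable_cong_sets)
  let ?P = "radial_measure CARD('m) \<Otimes>\<^sub>M (sphere_measure :: (real ^ 'm) measure)"
  have i: "integrable ?P (\<lambda>p. g (fst p) *\<^sub>R Y (snd p))"
    by (rule P.Fubini_integrable) (auto simp: g Y)
  show ?i using i unfolding polar_measure[symmetric] by (subst (asm) integrable_distr_eq) auto
  have "(\<integral>x. g ((norm x)\<^sup>2) *\<^sub>R Y (x /\<^sub>R norm x) \<partial>lborel) = (\<integral>p. g (fst p) *\<^sub>R Y (snd p) \<partial>?P)"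
    unfolding polar_measure[symmetric] by (subst integral_distr) auto
  also have "\<dots> = (\<integral>s. (\<integral>y. g s *\<^sub>R Y y \<partial>sphere_measure) \<partial>radial_measure CARD('m))"
    using P.integral_fst'[OF i] by simp
  also have "\<dots> = (\<integral>s. g s \<partial>radial_measure CARD('m)) *\<^sub>R (\<integral>x. Y x \<partial>sphere_measure)"
    by (simp add: g)
  finally show ?e .
qed

section \<open>The Clifford algebra as a Hermitian space\<close>

lemma scaleR_eq_scale: "r *\<^sub>R (a :: complex ^ 'n) = of_real r *s a"
  by (simp add: vec_eq_iff complex_eq_iff)

lemma cl_mult_scaleR_left: "(r *\<^sub>R a) \<odot> b = r *\<^sub>R (a \<odot> b)"
  by (simp add: scaleR_eq_scale cl_mult_scale_left)

lemma cl_mult_scaleR_right: "a \<odot> (r *\<^sub>R b) = r *\<^sub>R (a \<odot> b)"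
  by (simp add: scaleR_eq_scale cl_mult_scale_right)

lemma cl_mult_zero_left [simp]: "0 \<odot> a = 0"
  and cl_mult_zero_right [simp]: "a \<odot> 0 = 0"
  by (simp_all add: vec_eq_iff cl_mult_nth)

lemma cl_mult_minus_left: "(- a) \<odot> b = - (a \<odot> b)"
  and cl_mult_minus_right: "a \<odot> (- b) = - (a \<odot> b)"
  by (simp_all add: vec_eq_iff cl_mult_nth sum_negf)

lemma cl_mult_sum_left: "(\<Sum>i\<in>I. f i) \<odot> a = (\<Sum>i\<in>I. f i \<odot> a)"
  by (induction I rule: infinite_finite_induct) (auto simp: cl_mult_add_left)

lemma cl_mult_sum_right: "a \<odot> (\<Sum>i\<in>I. f i) = (\<Sum>i\<in>I. a \<odot> f i)"
  by (induction I rule: infinite_finite_induct) (auto simp: cl_mult_add_right)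

lemma bounded_bilinear_cl_mult:
  "bounded_bilinear ((\<odot>) :: 'm::{finite,linorder} clifford \<Rightarrow> 'm clifford \<Rightarrow> 'm clifford)"
proof -
  have "bilinear ((\<odot>) :: 'm clifford \<Rightarrow> 'm clifford \<Rightarrow> 'm clifford)"
    unfolding bilinear_def
    by (auto intro!: linearI simp: cl_mult_add_left cl_mult_add_right cl_mult_scaleR_left cl_mult_scaleR_right)
  then show ?thesis by (simp add: bilinear_conv_bounded_bilinear)
qed

lemma cl_cnj_mult: "cl_cnj (a \<odot> b) = cl_cnj a \<odot> cl_cnj b"
proof -
  have "cnj (blade_sign A B) = blade_sign A B" for A B :: "'a set"
    by (simp add: blade_sign_def)
  then show ?thesis by (simp add: vec_eq_iff cl_cnj_def cl_mult_nth)
qed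

lemma cl_cnj_gen: "cl_cnj (cl_gen i) = cl_gen i"
  by (simp add: vec_eq_iff cl_cnj_def cl_blade_def axis_def)

lemma cl_cnj_real: "cl_real a \<Longrightarrow> cl_cnj a = a"
  by (simp add: vec_eq_iff cl_cnj_def cl_real_def Reals_cnj_iff)

text \<open>The sign by which \<open>cl_bar\<close> acts on a blade is
  \<open>blade_sign A A\<close>, the sign of the square of the blade; the two cancel. Hence the
  Clifford inner product is the standard Hermitian form of the coefficients.\<close>

lemma cl_scalar_bar_cnj: "cl_scalar (cl_bar (cl_cnj a) \<odot> b) = hdot a b"
proof -
  have "cl_scalar (cl_bar (cl_cnj a) \<odot> b)
      = (\<Sum>A\<in>UNIV. blade_sign A A * (blade_sign A A * cnj (a $ A)) * b $ A)"
    by (simp add: cl_scalar_def cl_mult_nth cl_bar_def cl_cnj_def blade_sign_self)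
  also have "\<dots> = (\<Sum>A\<in>UNIV. (blade_sign A A * blade_sign A A) * (cnj (a $ A) * b $ A))"
    by (simp only: mult_ac)
  finally show ?thesis by (simp add: blade_sign_square hdot_def)
qed

lemma cl_scalar_minus: "cl_scalar (- a) = - cl_scalar a"
  by (simp add: cl_scalar_def)

text \<open>Since \<open>cl_bar\<close> negates a generator, left multiplication by it is
  skew-Hermitian. With \<open>x x = - r^2\<close> this makes multiplication by a vector a similitude
  of ratio \<open>r\<close>.\<close>

lemma hdot_gen: "hdot (cl_gen i \<odot> a) b = - hdot a (cl_gen i \<odot> b)"
  unfolding cl_scalar_bar_cnj[symmetric]
  by (simp add: cl_cnj_mult cl_cnj_gen cl_bar_mult cl_bar_gen cl_mult_minus_right cl_mult_minus_left
      cl_scalar_minus cl_mult_assoc)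

lemma cl_vec_mult: "cl_vec x \<odot> a = (\<Sum>i\<in>UNIV. (x $ i) *\<^sub>R (cl_gen i \<odot> a))"
  by (simp add: cl_vec_def cl_mult_sum_left cl_mult_scaleR_left)

lemma hdot_cl_vec: "hdot (cl_vec x \<odot> a) b = - hdot a (cl_vec x \<odot> b)"
  by (simp add: cl_vec_mult hdot_sum_left hdot_sum_right hdot_scaleR_left hdot_scaleR_right hdot_gen sum_negf)

lemma cl_gen_cl_gen:
  "cl_gen i \<odot> (cl_gen j \<odot> a) + cl_gen j \<odot> (cl_gen i \<odot> a) = (if i = j then - 2 else 0) *\<^sub>R a"
proof (cases "i = j")
  case True
  then show ?thesis
    by (simp add: cl_mult_assoc[symmetric] cl_gen_square cl_mult_minus_left cl_mult_one_left scaleR_2)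
next
  case False
  have "cl_gen i \<odot> (cl_gen j \<odot> a) + cl_gen j \<odot> (cl_gen i \<odot> a)
      = (cl_gen i \<odot> cl_gen j + cl_gen j \<odot> cl_gen i) \<odot> a"
    by (simp add: cl_mult_assoc cl_mult_add_left)
  with False show ?thesis by (simp add: cl_gen_anticommute)
qed

lemma cl_gen_cl_vec:
  "cl_gen i \<odot> (cl_vec x \<odot> a) + cl_vec x \<odot> (cl_gen i \<odot> a) = (- 2 * x $ i) *\<^sub>R a"
proof -
  have "cl_gen i \<odot> (cl_vec x \<odot> a) + cl_vec x \<odot> (cl_gen i \<odot> a)
     = (\<Sum>j\<in>UNIV. (x $ j) *\<^sub>R (cl_gen i \<odot> (cl_gen j \<odot> a) + cl_gen j \<odot> (cl_gen i \<odot> a)))"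
    by (simp add: cl_vec_mult cl_mult_sum_right cl_mult_scaleR_right scaleR_add_right sum.distrib)
  also have "\<dots> = (\<Sum>j\<in>UNIV. if j = i then (- 2 * x $ i) *\<^sub>R a else 0)"
    by (intro sum.cong refl) (simp add: cl_gen_cl_gen)
  finally show ?thesis by simp
qed

lemma cl_vec_cl_vec: "cl_vec x \<odot> (cl_vec x \<odot> a) = - ((norm x)\<^sup>2 *\<^sub>R a)"
proof -
  have e: "cl_vec x \<odot> (cl_vec x \<odot> a) = (\<Sum>i\<in>UNIV. (x $ i) *\<^sub>R (cl_vec x \<odot> (cl_gen i \<odot> a)))"
    by (subst (2) cl_vec_mult) (simp add: cl_mult_sum_right cl_mult_scaleR_right)
  have "cl_vec x \<odot> (cl_vec x \<odot> a) + cl_vec x \<odot> (cl_vec x \<odot> a)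
      = (\<Sum>i\<in>UNIV. (x $ i) *\<^sub>R (cl_gen i \<odot> (cl_vec x \<odot> a))) + (\<Sum>i\<in>UNIV. (x $ i) *\<^sub>R (cl_vec x \<odot> (cl_gen i \<odot> a)))"
    by (rule arg_cong2[where f = "(+)", OF cl_vec_mult e])
  also have "\<dots> = (\<Sum>i\<in>UNIV. (- 2 * (x $ i)\<^sup>2) *\<^sub>R a)"
    unfolding sum.distrib[symmetric] scaleR_add_right[symmetric] cl_gen_cl_vec
    by (simp add: power2_eq_square mult.left_commute)
  also have "\<dots> = (- 2 * (norm x)\<^sup>2) *\<^sub>R a"
    by (simp only: scaleR_sum_left[symmetric] sum_distrib_left[symmetric])
      (simp add: norm_vec_def L2_set_def sum_nonneg)
  finally have "2 *\<^sub>R (cl_vec x \<odot> (cl_vec x \<odot> a)) = 2 *\<^sub>R (- ((norm x)\<^sup>2 *\<^sub>R a))"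
    by (simp add: scaleR_2[of "cl_vec x \<odot> (cl_vec x \<odot> a)"])
  then show ?thesis by (simp only: scaleR_cancel_left) simp
qed

lemma hdot_cl_vec_cl_vec: "hdot (cl_vec x \<odot> a) (cl_vec x \<odot> b) = of_real ((norm x)\<^sup>2) * hdot a b"
  by (simp add: hdot_cl_vec cl_vec_cl_vec hdot_minus_right hdot_scaleR_right)

lemma norm_cl_vec_mult: "norm (cl_vec x \<odot> a) = norm x * norm a"
proof -
  have "of_real ((norm (cl_vec x \<odot> a))\<^sup>2) = (of_real ((norm x * norm a)\<^sup>2) :: complex)"
    by (simp only: hdot_self[symmetric] hdot_cl_vec_cl_vec power_mult_distrib of_real_mult)
  then have "(norm (cl_vec x \<odot> a))\<^sup>2 = (norm x * norm a)\<^sup>2" unfolding of_real_eq_iff .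
  then show ?thesis by (simp add: power2_eq_iff_nonneg)
qed

lemma sum_cl_gen_cl_gen: "(\<Sum>i\<in>UNIV. cl_gen i \<odot> (cl_gen i \<odot> a)) = - (real CARD('m) *\<^sub>R (a :: 'm::{finite,linorder} clifford))"
  by (simp add: cl_mult_assoc[symmetric] cl_gen_square cl_mult_minus_left cl_mult_one_left sum_negf
      sum_constant_scaleR del: sum_constant)

lemma cl_real_closed:
  "cl_real 0" "cl_real a \<Longrightarrow> cl_real b \<Longrightarrow> cl_real (a + b)" "cl_real a \<Longrightarrow> cl_real (r *\<^sub>R a)"
  by (auto simp: cl_real_def complex_is_Real_iff)

lemma cl_real_mult: "cl_real a \<Longrightarrow> cl_real b \<Longrightarrow> cl_real (a \<odot> b)"
  by (auto simp: cl_real_def cl_mult_nth blade_sign_def intro!: sum_in_Reals Reals_mult)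

lemma cl_real_blade: "cl_real (cl_blade A)"
  by (auto simp: cl_real_def cl_blade_def axis_def)

section \<open>Laguerre polynomials\<close>

lemma radial_gamma:
  fixes a y :: real
  assumes "a > -1" "y > 0"
  shows "has_bochner_integral lborel (\<lambda>s. if s > 0 then s powr a * exp (- y * s) else 0)
    (Gamma (a + 1) / y powr (a + 1))"
proof (rule has_bochner_integral_nn_integral)
  have "((\<lambda>t. t powr (a + 1 - 1) / exp t) has_integral Gamma (a + 1)) {0..}"
    using assms by (intro Gamma_integral_real) simp
  then have 1: "(\<integral>\<^sup>+t. ennreal (t powr a / exp t) * indicator {0..} t \<partial>lborel) = ennreal (Gamma (a + 1))"
    by (intro nn_integral_has_integral_lebesgue'[rotated]) simp_all
  let ?I = "\<integral>\<^sup>+s. ennreal (if s > 0 then s powr a * exp (- y * s) else 0) \<partial>lborel"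
  have "ennreal (Gamma (a + 1)) = y * (\<integral>\<^sup>+s. ennreal ((y * s) powr a / exp (y * s)) * indicator {0..} (y * s) \<partial>lborel)"
    unfolding 1[symmetric] using assms
    by (subst nn_integral_real_affine[where c = y and t = 0]) auto
  also have "(\<integral>\<^sup>+s. ennreal ((y * s) powr a / exp (y * s)) * indicator {0..} (y * s) \<partial>lborel)
    = (\<integral>\<^sup>+s. ennreal (y powr a) * ennreal (if s > 0 then s powr a * exp (- y * s) else 0) \<partial>lborel)"
  proof (intro nn_integral_cong)
    fix s :: real
    show "ennreal ((y * s) powr a / exp (y * s)) * indicator {0..} (y * s)
      = ennreal (y powr a) * ennreal (if s > 0 then s powr a * exp (- y * s) else 0)"
    proof (cases "s > 0")
      case True
      then have "(y * s) powr a / exp (y * s) = y powr a * (s powr a * exp (- y * s))"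
        using assms by (simp add: powr_mult exp_minus divide_inverse)
      with True assms show ?thesis by (simp add: ennreal_mult)
    next
      case False
      then show ?thesis using assms by (cases "s = 0") (auto simp: indicator_def mult_pos_neg zero_le_mult_iff)
    qed
  qed
  also have "\<dots> = ennreal (y powr a) * ?I"
    by (rule nn_integral_cmult) measurable
  finally have 2: "ennreal (Gamma (a + 1)) = ennreal (y powr (a + 1)) * ?I"
    using assms by (simp add: powr_add ennreal_mult mult_ac)
  have "?I = ennreal (1 / y powr (a + 1)) * ennreal (y powr (a + 1)) * ?I"
    using assms by (subst ennreal_mult[symmetric]) auto
  also have "\<dots> = ennreal (1 / y powr (a + 1)) * ennreal (Gamma (a + 1))"
    unfolding 2 by (simp only: mult.assoc)
  also have "\<dots> = ennreal (Gamma (a + 1) / y powr (a + 1))"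
    using assms less_imp_le[OF Gamma_real_pos[of "a + 1"]] by (subst ennreal_mult[symmetric]) auto
  finally show "?I = ennreal (Gamma (a + 1) / y powr (a + 1))" .
  show "0 \<le> Gamma (a + 1) / y powr (a + 1)"
    using assms by (intro divide_nonneg_nonneg less_imp_le[OF Gamma_real_pos]) auto
qed (auto intro!: AE_I2)

lemma radial_gamma_power:
  fixes a y :: real
  assumes "a > -1" "y > 0"
  shows "has_bochner_integral lborel (\<lambda>s. if s > 0 then s powr a * exp (- y * s) * s ^ k else 0)
    (Gamma (a + real k + 1) / y powr (a + real k + 1))"
proof -
  have "(\<lambda>s. if s > 0 then s powr a * exp (- y * s) * s ^ k else 0)
      = (\<lambda>s. if s > 0 then s powr (a + real k) * exp (- y * s) else (0::real))"
    by (auto simp: powr_add powr_realpow fun_eq_iff)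
  then show ?thesis using radial_gamma[of "a + real k" y] assms by simp
qed

text \<open>Integral against a Gamma weight with free rate \<open>y\<close>: \<open>y = 1\<close> is
  the orthogonality weight, and \<open>y = 1/2 + b\<close> arises when a Gaussian of rate
  \<open>b\<close> is paired with a basis function.\<close>

definition lag_mean :: "real \<Rightarrow> real \<Rightarrow> (real \<Rightarrow> real) \<Rightarrow> real" where
  "lag_mean a y q = (\<integral>s. (if s > 0 then s powr a * exp (- y * s) * q s else 0) \<partial>lborel)"

lemma laguerre_integrable:
  fixes a y :: real
  assumes "a > -1" "y > 0"
  shows "integrable lborel (\<lambda>s. if s > 0 then s powr a * exp (- y * s) * (s ^ k * laguerre t b s) else 0)"
proof -
  have eq: "(\<lambda>s. if s > 0 then s powr a * exp (- y * s) * (s ^ k * laguerre t b s) else 0)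
      = (\<lambda>s. \<Sum>j\<le>t. ((-1) ^ j * ((real t + b) gchoose (t - j)) / fact j) *
           (if s > 0 then s powr a * exp (- y * s) * s ^ (k + j) else 0))"
    by (auto simp: laguerre_def fun_eq_iff sum_distrib_left power_add mult_ac intro!: sum.cong)
  show ?thesis unfolding eq
    by (intro Bochner_Integration.integrable_sum integrable_mult_right
        integrable.intros[OF radial_gamma_power] assms)
qed

lemma laguerre_integrable2:
  fixes a y :: real
  assumes "a > -1" "y > 0"
  shows "integrable lborel (\<lambda>s. if s > 0 then s powr a * exp (- y * s) * (laguerre u d s * laguerre t b s) else 0)"
proof -
  have eq: "(\<lambda>s. if s > 0 then s powr a * exp (- y * s) * (laguerre u d s * laguerre t b s) else 0)
      = (\<lambda>s. \<Sum>j\<le>u. ((-1) ^ j * ((real u + d) gchoose (u - j)) / fact j) *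
           (if s > 0 then s powr a * exp (- y * s) * (s ^ j * laguerre t b s) else 0))"
    by (auto simp: laguerre_def[of u] fun_eq_iff sum_distrib_left sum_distrib_right mult_ac intro!: sum.cong)
  show ?thesis unfolding eq
    by (intro Bochner_Integration.integrable_sum integrable_mult_right laguerre_integrable assms)
qed

section \<open>Relations between Laguerre polynomials of neighbouring parameters\<close>

lemma laguerre_0 [simp]: "laguerre 0 a = (\<lambda>s. 1)"
  by (simp add: laguerre_def fun_eq_iff)

text \<open>Pascal's rule for the binomial coefficients. It raises the parameter to match a weight
  that has absorbed a factor \<open>s\<close>.\<close>

lemma laguerre_contiguous:
  "laguerre (Suc t) a s = laguerre (Suc t) (a + 1) s - laguerre t (a + 1) s"
proof -
  have "(real (Suc t) + (a + 1)) gchoose (Suc t - k)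
      = ((real (Suc t) + a) gchoose (Suc t - k)) + ((real t + (a + 1)) gchoose (t - k))" if "k \<le> t" for k
  proof -
    have "Suc t - k = Suc (t - k)" using that by simp
    then show ?thesis using gbinomial_Suc_Suc[of "real (Suc t) + a" "t - k"] by (simp add: algebra_simps)
  qed
  then have "laguerre (Suc t) (a + 1) s = laguerre (Suc t) a s + laguerre t (a + 1) s"
    unfolding laguerre_def by (simp add: sum.distrib ring_distribs add_divide_distrib)
  then show ?thesis by simp
qed

text \<open>By the absorption identity, \<open>t + a + 1\<close> times the \<open>k\<close>-th
  coefficient of degree \<open>t\<close> is \<open>t + 1 - k\<close> times that of degree
  \<open>Suc t\<close>. The difference leaves the factor \<open>- k\<close>, which cancels into the
  factorial, lowers the index and so splits off the factor \<open>s\<close>.\<close>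

lemma laguerre_mult:
  "s * laguerre t (a + 1) s = (real t + a + 1) * laguerre t a s - (real t + 1) * laguerre (Suc t) a s"
proof -
  have e: "real t + (a + 1) = real (Suc t) + a" by simp
  have k: "(real t + a + 1) * ((real t + a) gchoose (t - k)) = real (Suc t - k) * ((real (Suc t) + a) gchoose (Suc t - k))"
    if "k \<le> t" for k
  proof -
    have "Suc t - k = Suc (t - k)" using that by simp
    then show ?thesis using gbinomial_absorption[of "t - k" "real (Suc t) + a"] by (simp add: algebra_simps)
  qed
  have "(real t + a + 1) * laguerre t a s
      = (\<Sum>k\<le>t. (-1) ^ k * (real (Suc t - k) * ((real (Suc t) + a) gchoose (Suc t - k))) * s ^ k / fact k)"
    unfolding laguerre_def sum_distrib_left
    by (intro sum.cong refl, subst k[symmetric]) (simp_all add: mult_ac)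
  \<comment> \<open>The added term \<open>k = Suc t\<close> has the factor 0.\<close>
  also have "\<dots> = (\<Sum>k\<le>Suc t. (-1) ^ k * (real (Suc t - k) * ((real (Suc t) + a) gchoose (Suc t - k))) * s ^ k / fact k)"
    by simp
  finally have "(real t + a + 1) * laguerre t a s - (real t + 1) * laguerre (Suc t) a s
     = (\<Sum>k\<le>Suc t. (-1) ^ k * (real (Suc t - k) * ((real (Suc t) + a) gchoose (Suc t - k))) * s ^ k / fact k)
       - (real t + 1) * laguerre (Suc t) a s"
    by (simp only:)
  also have "\<dots> = (\<Sum>k\<le>Suc t. - real k * ((-1) ^ k * ((real (Suc t) + a) gchoose (Suc t - k)) * s ^ k / fact k))"
    unfolding laguerre_def[of "Suc t"] sum_distrib_left sum_subtractf[symmetric]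
  proof (intro sum.cong refl)
    fix k assume "k \<in> {..Suc t}"
    then have r: "real (Suc t - k) = real t + 1 - real k" by (simp add: of_nat_diff)
    have x: "(-1) ^ k * (r * g) * s ^ k / fact k = r * ((-1) ^ k * g * s ^ k / fact k)" for r g :: real
      by simp
    show "(-1) ^ k * (real (Suc t - k) * ((real (Suc t) + a) gchoose (Suc t - k))) * s ^ k / fact k
       - (real t + 1) * ((-1) ^ k * ((real (Suc t) + a) gchoose (Suc t - k)) * s ^ k / fact k)
       = - real k * ((-1) ^ k * ((real (Suc t) + a) gchoose (Suc t - k)) * s ^ k / fact k)"
      unfolding x r by (simp only: left_diff_distrib[symmetric]) simp
  qed
  also have "\<dots> = (\<Sum>k\<le>t. - real (Suc k) * ((-1) ^ Suc k * ((real (Suc t) + a) gchoose (t - k)) * s ^ Suc k / fact (Suc k)))"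
    by (subst sum.atMost_Suc_shift) simp
  also have "\<dots> = s * laguerre t (a + 1) s"
    unfolding laguerre_def sum_distrib_left e
    by (intro sum.cong refl)
      (simp only: fact_Suc power_Suc of_nat_mult, simp add: add_ac divide_simps del: of_nat_Suc)
  finally show ?thesis by simp
qed

lemma laguerre_gbinomial_Gamma:
  fixes a :: real
  assumes "a > -1" "j \<le> t"
  shows "((real t + a) gchoose (t - j)) = Gamma (real t + a + 1) / (fact (t - j) * Gamma (a + real j + 1))"
proof -
  have "0 < a + real j + 1" using assms by simp
  from Gamma_real_pos[OF this] have "Gamma (a + real j + 1) \<noteq> 0" by simp
  moreover have "a + real j + 1 \<notin> \<int>\<^sub>\<le>\<^sub>0" using assms by (auto elim!: nonpos_Ints_cases')
  ultimately show ?thesis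
    using assms
    by (simp add: gbinomial_pochhammer' pochhammer_Gamma of_nat_diff add_ac)
qed

text \<open>Termwise Gamma integrals cancel Gamma factors of the binomial coefficients, and the
  remaining sum is the binomial expansion of \<open>(y - 1) ^ t\<close>. It vanishes at
  \<open>y = 1\<close> for \<open>t > 0\<close> and yields the coefficients of Gaussians for other
  \<open>y\<close>.\<close>

lemma lag_mean_laguerre:
  fixes a y :: real
  assumes "a > -1" "y > 0"
  shows "lag_mean a y (laguerre t a) = Gamma (real t + a + 1) / fact t * ((y - 1) ^ t / y powr (real t + a + 1))"
proof -
  have eq: "(\<lambda>s. if s > 0 then s powr a * exp (- y * s) * laguerre t a s else 0)
      = (\<lambda>s. \<Sum>j\<le>t. ((-1) ^ j * ((real t + a) gchoose (t - j)) / fact j) *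
           (if s > 0 then s powr a * exp (- y * s) * s ^ j else 0))"
    by (auto simp: laguerre_def fun_eq_iff sum_distrib_left mult_ac intro!: sum.cong)
  have "lag_mean a y (laguerre t a) = (\<Sum>j\<le>t. ((-1) ^ j * ((real t + a) gchoose (t - j)) / fact j) *
      (Gamma (a + real j + 1) / y powr (a + real j + 1)))"
    unfolding lag_mean_def eq
    by (intro has_bochner_integral_integral_eq has_bochner_integral_sum has_bochner_integral_mult_right
        radial_gamma_power assms)
  also have "\<dots> = (\<Sum>j\<le>t. Gamma (real t + a + 1) / fact t / y powr (real t + a + 1) * (of_nat (t choose j) * (-1) ^ j * y ^ (t - j)))"
  proof (intro sum.cong refl)
    fix j assume "j \<in> {..t}"
    then have j: "j \<le> t" by simp
    have cancel: "(u * (g / (b * h)) / d) * (h / p) = g / e / (p * q) * (e / (d * b) * u * q)"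
      if "h \<noteq> 0" "p \<noteq> 0" "q \<noteq> 0" "b \<noteq> 0" "d \<noteq> 0" "e \<noteq> 0" for b d e g h p q u :: real
      using that by (simp add: field_simps)
    have "0 < a + real j + 1" using assms by simp
    from Gamma_real_pos[OF this] have G: "Gamma (a + real j + 1) \<noteq> 0" by simp
    have p: "y powr (real t + a + 1) = y powr (a + real j + 1) * y ^ (t - j)"
      using assms j by (simp add: powr_realpow[symmetric] of_nat_diff powr_add[symmetric] add_ac)
    have y: "y powr (a + real j + 1) \<noteq> 0" "y ^ (t - j) \<noteq> 0" using assms by auto
    show "((-1) ^ j * ((real t + a) gchoose (t - j)) / fact j) * (Gamma (a + real j + 1) / y powr (a + real j + 1))
       = Gamma (real t + a + 1) / fact t / y powr (real t + a + 1) * (of_nat (t choose j) * (-1) ^ j * y ^ (t - j))"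
      unfolding laguerre_gbinomial_Gamma[OF assms(1) j] p binomial_fact[OF j, where 'a = real]
      by (rule cancel) (use G y in simp_all)
  qed
  also have "\<dots> = Gamma (real t + a + 1) / fact t / y powr (real t + a + 1) * ((-1) + y) ^ t"
    by (simp only: binomial_ring sum_distrib_left)
  finally show ?thesis by simp
qed

text \<open>Induction on \<open>k\<close>: one factor \<open>s\<close> moves into the weight and
  raises \<open>a\<close>; the contiguity relation writes the polynomial as a difference of degrees
  \<open>t\<close> and \<open>t - 1\<close> with the raised parameter. Of these only degree
  \<open>t - 1\<close> can contribute, namely when \<open>Suc k = t\<close>.\<close>

lemma lag_mean_power_laguerre:
  fixes a :: real
  assumes "a > -1"
  shows "k \<le> t \<Longrightarrow> lag_mean a 1 (\<lambda>s. s ^ k * laguerre t a s)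
    = (if k = t then (-1) ^ t * Gamma (real t + a + 1) else 0)"
  using assms
proof (induction k arbitrary: t a)
  case 0
  then show ?case using lag_mean_laguerre[of a 1 t] by (cases "t = 0") auto
next
  case (Suc k)
  then obtain t' where t: "t = Suc t'" by (cases t) auto
  have a: "a + 1 > -1" using Suc.prems by simp
  have pt: "(if s > 0 then s powr a * exp (- 1 * s) * (s ^ Suc k * laguerre t a s) else 0)
      = (if s > 0 then s powr (a + 1) * exp (- 1 * s) * (s ^ k * laguerre t (a + 1) s) else 0)
      - (if s > 0 then s powr (a + 1) * exp (- 1 * s) * (s ^ k * laguerre t' (a + 1) s) else 0)" for s
    by (cases "s > 0") (simp_all add: t laguerre_contiguous[of t' a] powr_add right_diff_distrib)
  have "lag_mean a 1 (\<lambda>s. s ^ Suc k * laguerre t a s)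
      = lag_mean (a + 1) 1 (\<lambda>s. s ^ k * laguerre t (a + 1) s) - lag_mean (a + 1) 1 (\<lambda>s. s ^ k * laguerre t' (a + 1) s)"
    unfolding lag_mean_def pt
    by (rule Bochner_Integration.integral_diff) (intro laguerre_integrable a zero_less_one)+
  also have "\<dots> = (if k = t then (-1) ^ t * Gamma (real t + (a + 1) + 1) else 0)
      - (if k = t' then (-1) ^ t' * Gamma (real t' + (a + 1) + 1) else 0)"
    using Suc.IH[of t "a + 1"] Suc.IH[of t' "a + 1"] Suc.prems a by (simp add: t del: of_nat_Suc)
  also have "\<dots> = (if Suc k = t then (-1) ^ t * Gamma (real t + a + 1) else 0)"
  proof -
    have "real t' + (a + 1) + 1 = real t + a + 1" by (simp add: t)
    moreover have "k \<noteq> t" using Suc.prems by simp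
    ultimately show ?thesis by (simp add: t)
  qed
  finally show ?case .
qed

lemma laguerre_orthogonal:
  fixes a :: real
  assumes "a > -1"
  shows "lag_mean a 1 (\<lambda>s. laguerre u a s * laguerre t a s)
    = (if u = t then Gamma (real t + a + 1) / fact t else 0)"
proof -
  have le: "lag_mean a 1 (\<lambda>s. laguerre u a s * laguerre t a s)
    = (if u = t then Gamma (real t + a + 1) / fact t else 0)" if "u \<le> t" for u t
  proof -
    have eq: "(\<lambda>s. if s > 0 then s powr a * exp (- 1 * s) * (laguerre u a s * laguerre t a s) else 0)
      = (\<lambda>s. \<Sum>j\<le>u. ((-1) ^ j * ((real u + a) gchoose (u - j)) / fact j) *
           (if s > 0 then s powr a * exp (- 1 * s) * (s ^ j * laguerre t a s) else 0))"
      by (auto simp: laguerre_def[of u] fun_eq_iff sum_distrib_left sum_distrib_right mult_ac intro!: sum.cong)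
    have "lag_mean a 1 (\<lambda>s. laguerre u a s * laguerre t a s)
      = (\<Sum>j\<le>u. ((-1) ^ j * ((real u + a) gchoose (u - j)) / fact j) * lag_mean a 1 (\<lambda>s. s ^ j * laguerre t a s))"
      unfolding lag_mean_def eq
      by (subst Bochner_Integration.integral_sum) (auto intro!: integrable_mult_right laguerre_integrable assms simp del: mult_minus1)
    also have "\<dots> = (\<Sum>j\<le>u. if j = t then ((-1) ^ t * ((real u + a) gchoose (u - t)) / fact t) * ((-1) ^ t * Gamma (real t + a + 1)) else 0)"
      using that by (intro sum.cong refl) (auto simp: lag_mean_power_laguerre assms)
    also have "\<dots> = (if u = t then Gamma (real t + a + 1) / fact t else 0)"
      using that by (auto simp: sum.delta simp flip: power_mult_distrib)
    finally show ?thesis .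
  qed
  show ?thesis
  proof (cases "u \<le> t")
    case False
    then show ?thesis using le[of t u] by (simp add: mult.commute)
  qed (rule le)
qed

section \<open>The Fischer decomposition\<close>

text \<open>Homogeneous polynomials of degree \<open>k\<close> with real Clifford coefficients,
  generated from constants by coordinates and sums so that bounds, derivatives and Euler's identity
  follow by induction. That spherical monogenics have this form is shown in
  \<open>monogenics_hpoly\<close>.\<close>

inductive hpoly :: "nat \<Rightarrow> 'm::{finite,linorder} cl_fun \<Rightarrow> bool" where
  hpoly_const: "cl_real a \<Longrightarrow> hpoly 0 (\<lambda>x. a)"
| hpoly_coord: "hpoly k P \<Longrightarrow> hpoly (Suc k) (\<lambda>x. (x $ i) *\<^sub>R P x)"
| hpoly_add: "hpoly k P \<Longrightarrow> hpoly k Q \<Longrightarrow> hpoly k (\<lambda>x. P x + Q x)"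

lemma hpoly_zero: "hpoly k (\<lambda>x. 0)"
proof (induction k)
  case 0
  show ?case by (rule hpoly_const) (rule cl_real_closed)
next
  case (Suc k)
  from hpoly_coord[OF this] show ?case by simp
qed

lemma hpoly_sum: "(\<And>i. i \<in> I \<Longrightarrow> hpoly k (P i)) \<Longrightarrow> hpoly k (\<lambda>x. \<Sum>i\<in>I. P i x)"
  by (induction I rule: infinite_finite_induct) (auto intro: hpoly_zero hpoly_add)

lemma hpoly_scaleR:
  assumes "hpoly k P"
  shows "hpoly k (\<lambda>x. r *\<^sub>R P x)"
  using assms
proof induction
  case (hpoly_const a)
  then show ?case by (intro hpoly.hpoly_const cl_real_closed)
next
  case (hpoly_coord k P i)
  from hpoly.hpoly_coord[OF hpoly_coord.IH, of i] show ?case by (simp add: mult.commute)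
next
  case (hpoly_add k P Q)
  from hpoly.hpoly_add[OF hpoly_add.IH] show ?case by (simp add: scaleR_add_right)
qed

lemma hpoly_cl_mult:
  assumes "hpoly k P" "cl_real a"
  shows "hpoly k (\<lambda>x. a \<odot> P x)"
  using assms(1)
proof induction
  case (hpoly_const b)
  then show ?case by (intro hpoly.hpoly_const cl_real_mult assms(2))
next
  case (hpoly_coord k P i)
  from hpoly.hpoly_coord[OF hpoly_coord.IH, of i] show ?case by (simp add: cl_mult_scaleR_right)
next
  case (hpoly_add k P Q)
  from hpoly.hpoly_add[OF hpoly_add.IH] show ?case by (simp add: cl_mult_add_right)
qed

lemma hpoly_cl_vec:
  assumes "hpoly k P"
  shows "hpoly (Suc k) (\<lambda>x. cl_vec x \<odot> P x)"
  unfolding cl_vec_mult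
  by (intro hpoly_sum hpoly_coord hpoly_cl_mult assms cl_real_blade)

lemma hpoly_real: "hpoly k P \<Longrightarrow> cl_real (P x)"
  by (induction rule: hpoly.induct) (auto intro: cl_real_closed)

lemma hpoly_polynomial_function:
  fixes P :: "'m::{finite,linorder} cl_fun"
  shows "hpoly k P \<Longrightarrow> polynomial_function P"
proof (induction rule: hpoly.induct)
  case (hpoly_coord k P i)
  have "bounded_linear (\<lambda>x :: (real, 'm) vec. x $ i)" by (rule bounded_linear_vec_nth)
  then have "polynomial_function (\<lambda>x :: (real, 'm) vec. x $ i)" by (rule polynomial_function_bounded_linear)
  then show ?case by (intro polynomial_function_mult hpoly_coord.IH)
qed auto

lemma hpoly_homogeneous: "hpoly k P \<Longrightarrow> P (t *\<^sub>R x) = t ^ k *\<^sub>R P x"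
  by (induction rule: hpoly.induct) (auto simp: scaleR_add_right mult_ac)

lemma hpoly_continuous: "hpoly k P \<Longrightarrow> continuous_on S P"
  by (intro continuous_on_polymonial_function hpoly_polynomial_function)

lemma hpoly_measurable: "hpoly k P \<Longrightarrow> P \<in> borel_measurable borel"
  by (intro borel_measurable_continuous_onI hpoly_continuous)

lemma hpoly_bound: "hpoly k P \<Longrightarrow> \<exists>C\<ge>0. \<forall>x. norm (P x) \<le> C * norm x ^ k"
proof (induction rule: hpoly.induct)
  case (hpoly_const a)
  then show ?case by (intro exI[of _ "norm a"]) auto
next
  case (hpoly_coord k P i)
  then obtain C where C: "C \<ge> 0" "\<And>x. norm (P x) \<le> C * norm x ^ k" by auto
  have "norm ((x $ i) *\<^sub>R P x) \<le> C * norm x ^ Suc k" for x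
  proof -
    have "norm ((x $ i) *\<^sub>R P x) \<le> norm x * (C * norm x ^ k)"
      unfolding norm_scaleR using C component_le_norm_cart[of x i] by (intro mult_mono) auto
    then show ?thesis by (simp add: mult_ac)
  qed
  with C show ?case by auto
next
  case (hpoly_add k P Q)
  then obtain C D where "C \<ge> 0" "\<And>x. norm (P x) \<le> C * norm x ^ k"
    and "D \<ge> 0" "\<And>x. norm (Q x) \<le> D * norm x ^ k" by auto
  then show ?case
    by (intro exI[of _ "C + D"]) (auto simp: distrib_right intro!: norm_triangle_le add_mono)
qed

text \<open>Partial derivatives, their degree and Euler's identity refer to the same family
  \<open>D\<close>, so the existence proof carries all three through one induction.\<close>

definition is_gradient ::
    "nat \<Rightarrow> 'm::{finite,linorder} cl_fun \<Rightarrow> ('m \<Rightarrow> 'm cl_fun) \<Rightarrow> bool" where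
  "is_gradient k P D \<longleftrightarrow>
    (\<forall>i. if k = 0 then D i = (\<lambda>x. 0) else hpoly (k - 1) (D i)) \<and>
    (\<forall>x. (P has_derivative (\<lambda>h. \<Sum>i\<in>UNIV. (h $ i) *\<^sub>R D i x)) (at x)) \<and>
    (\<forall>x. (\<Sum>i\<in>UNIV. (x $ i) *\<^sub>R D i x) = real k *\<^sub>R P x)"

lemma is_gradientD:
  assumes "is_gradient k P D"
  shows "if k = 0 then D i = (\<lambda>x. 0) else hpoly (k - 1) (D i)"
    and "(P has_derivative (\<lambda>h. \<Sum>i\<in>UNIV. (h $ i) *\<^sub>R D i x)) (at x)"
    and "(\<Sum>i\<in>UNIV. (x $ i) *\<^sub>R D i x) = real k *\<^sub>R P x"
  using assms unfolding is_gradient_def by blast+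

lemma hpoly_derivative:
  fixes P :: "'m::{finite,linorder} cl_fun"
  shows "hpoly k P \<Longrightarrow> \<exists>D. is_gradient k P D"
proof (induction rule: hpoly.induct)
  case (hpoly_const a)
  have "is_gradient 0 (\<lambda>x. a) (\<lambda>i x. 0)" unfolding is_gradient_def by simp
  then show ?case by blast
next
  case (hpoly_coord k P j)
  then obtain D where "is_gradient k P D" by blast
  note D = is_gradientD[OF this]
  define E where "E i x = (if i = j then P x else 0) + (x $ j) *\<^sub>R D i x" for i and x
  have E: "hpoly k (E i)" for i
  proof -
    have "hpoly k (\<lambda>x. (x $ j) *\<^sub>R D i x)"
    proof (cases k)
      case 0
      then show ?thesis using D(1)[of i] hpoly_zero[of 0] by simp
    next
      case (Suc k')
      then show ?thesis using D(1)[of i] hpoly.hpoly_coord[of k' "D i" j] by simp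
    qed
    moreover have "hpoly k (\<lambda>x. if i = j then P x else 0)"
      using hpoly_coord.hyps hpoly_zero by (cases "i = j") auto
    ultimately have "hpoly k (\<lambda>x. (if i = j then P x else 0) + (x $ j) *\<^sub>R D i x)"
      by (intro hpoly.hpoly_add)
    then show ?thesis by (simp add: E_def[abs_def])
  qed
  have sE: "(\<Sum>i\<in>UNIV. (h $ i) *\<^sub>R E i x) = (h $ j) *\<^sub>R P x + (x $ j) *\<^sub>R (\<Sum>i\<in>UNIV. (h $ i) *\<^sub>R D i x)" for h x
  proof -
    have "(\<Sum>i\<in>UNIV. (h $ i) *\<^sub>R E i x)
        = (\<Sum>i\<in>UNIV. (if i = j then (h $ i) *\<^sub>R P x else 0) + (x $ j) *\<^sub>R ((h $ i) *\<^sub>R D i x))"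
      by (intro sum.cong refl) (simp add: E_def scaleR_add_right mult.commute)
    then show ?thesis by (simp add: sum.distrib scaleR_sum_right)
  qed
  have "((\<lambda>x. (x $ j) *\<^sub>R P x) has_derivative (\<lambda>h. \<Sum>i\<in>UNIV. (h $ i) *\<^sub>R E i x)) (at x)" for x
  proof -
    have "((\<lambda>x::(real, 'm) vec. x $ j) has_derivative (\<lambda>h. h $ j)) (at x)"
      by (rule bounded_linear_imp_has_derivative[OF bounded_linear_vec_nth])
    from has_derivative_scaleR[OF this D(2)] show ?thesis by (simp only: sE add.commute)
  qed
  moreover have "(\<Sum>i\<in>UNIV. (x $ i) *\<^sub>R E i x) = real (Suc k) *\<^sub>R (x $ j) *\<^sub>R P x" for x
    unfolding sE D(3) by (simp add: algebra_simps)
  ultimately have "is_gradient (Suc k) (\<lambda>x. (x $ j) *\<^sub>R P x) E"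
    unfolding is_gradient_def using E by simp
  then show ?case by blast
next
  case (hpoly_add k P Q)
  then obtain D E where "is_gradient k P D" "is_gradient k Q E" by blast
  note D = is_gradientD[OF this(1)] and E = is_gradientD[OF this(2)]
  have "if k = 0 then (\<lambda>x. D i x + E i x) = (\<lambda>x. 0) else hpoly (k - 1) (\<lambda>x. D i x + E i x)" for i
    using D(1)[of i] E(1)[of i] by (cases "k = 0") (simp_all add: hpoly.hpoly_add)
  moreover have "((\<lambda>x. P x + Q x) has_derivative (\<lambda>h. \<Sum>i\<in>UNIV. (h $ i) *\<^sub>R (D i x + E i x))) (at x)" for x
    using has_derivative_add[OF D(2) E(2), of x] by (simp add: scaleR_add_right sum.distrib)
  moreover have "(\<Sum>i\<in>UNIV. (x $ i) *\<^sub>R (D i x + E i x)) = real k *\<^sub>R (P x + Q x)" for x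
    using D(3)[of x] E(3)[of x] by (simp add: scaleR_add_right sum.distrib)
  ultimately have "is_gradient k (\<lambda>x. P x + Q x) (\<lambda>i x. D i x + E i x)"
    unfolding is_gradient_def by blast
  then show ?case by blast
qed

lemma dirac_has_derivative:
  assumes "(P has_derivative (\<lambda>h. \<Sum>i\<in>UNIV. (h $ i) *\<^sub>R D i)) (at x)"
  shows "dirac P x = (\<Sum>i\<in>UNIV. cl_gen i \<odot> D i)"
proof -
  have "frechet_derivative P (at x) = (\<lambda>h. \<Sum>i\<in>UNIV. (h $ i) *\<^sub>R D i)"
    using assms by (rule frechet_derivative_at[symmetric])
  moreover have "(\<Sum>j\<in>UNIV. (axis i 1 $ j) *\<^sub>R D j) = D i" for i
  proof -
    have "(\<Sum>j\<in>UNIV. (axis i 1 $ j) *\<^sub>R D j) = (\<Sum>j\<in>UNIV. if j = i then D i else 0)"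
      by (intro sum.cong refl) (auto simp: axis_def)
    then show ?thesis by simp
  qed
  ultimately show ?thesis by (simp add: dirac_def)
qed

lemma hpoly_dirac: "hpoly (Suc k) P \<Longrightarrow> hpoly k (dirac P)"
proof -
  assume "hpoly (Suc k) P"
  from hpoly_derivative[OF this] obtain D where "is_gradient (Suc k) P D" by blast
  note G = is_gradientD[OF this]
  have D: "hpoly k (D i)" "(P has_derivative (\<lambda>h. \<Sum>i\<in>UNIV. (h $ i) *\<^sub>R D i x)) (at x)" for i x
    using G(1)[of i] G(2)[of x] by simp_all
  have "dirac P = (\<lambda>x. \<Sum>i\<in>UNIV. cl_gen i \<odot> D i x)"
    by (intro ext dirac_has_derivative D)
  then show ?thesis by (simp add: hpoly_sum hpoly_cl_mult D cl_real_blade)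
qed

lemma hpoly_0_const: "hpoly 0 P \<Longrightarrow> P x = P 0"
  using hpoly_homogeneous[of 0 P 0 x] by simp

lemma hpoly_0_dirac: "hpoly 0 P \<Longrightarrow> dirac P x = 0"
proof -
  assume "hpoly 0 P"
  from hpoly_derivative[OF this] obtain D where "is_gradient 0 P D" by blast
  note G = is_gradientD[OF this]
  from dirac_has_derivative[OF G(2)[of x]] G(1) show ?thesis by simp
qed

lemma dirac_add:
  assumes "hpoly k P" "hpoly l Q"
  shows "dirac (\<lambda>x. P x + Q x) x = dirac P x + dirac Q x"
proof -
  from hpoly_derivative[OF assms(1)] obtain D where D:
    "(P has_derivative (\<lambda>h. \<Sum>i\<in>UNIV. (h $ i) *\<^sub>R D i x)) (at x)" using is_gradientD(2) by blast
  from hpoly_derivative[OF assms(2)] obtain E where E: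
    "(Q has_derivative (\<lambda>h. \<Sum>i\<in>UNIV. (h $ i) *\<^sub>R E i x)) (at x)" using is_gradientD(2) by blast
  have "((\<lambda>x. P x + Q x) has_derivative (\<lambda>h. \<Sum>i\<in>UNIV. (h $ i) *\<^sub>R (D i x + E i x))) (at x)"
    using has_derivative_add[OF D E] by (simp add: scaleR_add_right sum.distrib)
  from dirac_has_derivative[OF this] dirac_has_derivative[OF D] dirac_has_derivative[OF E]
  show ?thesis by (simp add: cl_mult_add_right sum.distrib)
qed

lemma dirac_scaleR:
  assumes "hpoly k P"
  shows "dirac (\<lambda>x. r *\<^sub>R P x) x = r *\<^sub>R dirac P x"
proof -
  from hpoly_derivative[OF assms(1)] obtain D where D:
    "(P has_derivative (\<lambda>h. \<Sum>i\<in>UNIV. (h $ i) *\<^sub>R D i x)) (at x)" using is_gradientD(2) by blast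
  have "((\<lambda>x. r *\<^sub>R P x) has_derivative (\<lambda>h. \<Sum>i\<in>UNIV. (h $ i) *\<^sub>R (r *\<^sub>R D i x))) (at x)"
    using has_derivative_scaleR_right[OF D, of r] by (simp add: scaleR_sum_right mult.commute)
  from dirac_has_derivative[OF this] dirac_has_derivative[OF D]
  show ?thesis by (simp add: cl_mult_scaleR_right scaleR_sum_right)
qed

text \<open>Product rule: the derivative of the factor \<open>x\<close> contributes the sum of the
  \<open>e_i e_i\<close>, which is \<open>- m\<close>; moving \<open>e_i\<close> past
  \<open>x\<close> leaves \<open>- 2\<close> times the sum of the \<open>x_i D_i\<close>, which is
  \<open>- 2 k P\<close> by Euler's identity.\<close>

lemma dirac_cl_vec_mult:
  fixes P :: "'m::{finite,linorder} cl_fun"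
  assumes P: "hpoly k P"
  shows "dirac (\<lambda>x. cl_vec x \<odot> P x) x
    = - ((real CARD('m) + 2 * real k) *\<^sub>R P x) - cl_vec x \<odot> dirac P x"
proof -
  from hpoly_derivative[OF P] obtain D where "is_gradient k P D" by blast
  note D = is_gradientD(2,3)[OF this, of x]
  have "linear (cl_vec :: (real, 'm) vec \<Rightarrow> _)"
    unfolding cl_vec_def by (auto intro!: linearI simp: scaleR_add_left sum.distrib scaleR_sum_right)
  then have "(cl_vec has_derivative cl_vec) (at x)"
    by (intro bounded_linear_imp_has_derivative linear_conv_bounded_linear[THEN iffD1])
  from bounded_bilinear.FDERIV[OF bounded_bilinear_cl_mult this D(1)]
  have "((\<lambda>x. cl_vec x \<odot> P x) has_derivative
      (\<lambda>h. cl_vec x \<odot> (\<Sum>i\<in>UNIV. (h $ i) *\<^sub>R D i x) + cl_vec h \<odot> P x)) (at x)" .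
  also have "(\<lambda>h. cl_vec x \<odot> (\<Sum>i\<in>UNIV. (h $ i) *\<^sub>R D i x) + cl_vec h \<odot> P x)
      = (\<lambda>h. \<Sum>i\<in>UNIV. (h $ i) *\<^sub>R (cl_vec x \<odot> D i x + cl_gen i \<odot> P x))"
    by (simp add: fun_eq_iff cl_vec_mult[of _ "P x"] cl_mult_sum_right cl_mult_scaleR_right scaleR_add_right sum.distrib)
  finally have "dirac (\<lambda>x. cl_vec x \<odot> P x) x = (\<Sum>i\<in>UNIV. cl_gen i \<odot> (cl_vec x \<odot> D i x + cl_gen i \<odot> P x))"
    by (rule dirac_has_derivative)
  also have "\<dots> = (\<Sum>i\<in>UNIV. cl_gen i \<odot> (cl_vec x \<odot> D i x)) + (\<Sum>i\<in>UNIV. cl_gen i \<odot> (cl_gen i \<odot> P x))"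
    by (simp add: cl_mult_add_right sum.distrib)
  also have "(\<Sum>i\<in>UNIV. cl_gen i \<odot> (cl_vec x \<odot> D i x))
     = (\<Sum>i\<in>UNIV. (- 2 * x $ i) *\<^sub>R D i x - cl_vec x \<odot> (cl_gen i \<odot> D i x))"
    by (intro sum.cong refl) (simp only: cl_gen_cl_vec[symmetric] add_diff_cancel_right')
  also have "\<dots> = (- 2) *\<^sub>R (\<Sum>i\<in>UNIV. (x $ i) *\<^sub>R D i x) - cl_vec x \<odot> dirac P x"
    by (simp only: dirac_has_derivative[OF D(1)] sum_subtractf cl_mult_sum_right scaleR_sum_right scaleR_scaleR)
  finally show ?thesis
    unfolding D(2) sum_cl_gen_cl_gen by (simp add: algebra_simps)
qed

fun xpow :: "nat \<Rightarrow> real ^ 'm::{finite,linorder} \<Rightarrow> 'm clifford \<Rightarrow> 'm clifford" where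
  "xpow 0 x a = a"
| "xpow (Suc s) x a = cl_vec x \<odot> xpow s x a"

lemma hpoly_xpow: "hpoly k P \<Longrightarrow> hpoly (s + k) (\<lambda>x. xpow s x (P x))"
  by (induction s) (auto intro: hpoly_cl_vec)

lemma xpow_double: "xpow (2 * s) x a = ((- 1) ^ s * norm x ^ (2 * s)) *\<^sub>R a"
  by (induction s) (simp_all add: cl_vec_cl_vec cl_mult_scaleR_right power2_eq_square mult_ac)

text \<open>The factor, up to sign, by which the Dirac operator sends
  \<open>xpow (Suc s) x (M x)\<close> to \<open>xpow s x (M x)\<close> for monogenic
  \<open>M\<close> of degree \<open>j\<close>. The two parities arise because each further
  \<open>x\<close> replaces the constant by its difference from
  \<open>m + 2 (s + 1 + j)\<close>.\<close>

definition fischer_const :: "nat \<Rightarrow> nat \<Rightarrow> nat \<Rightarrow> real" where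
  "fischer_const m j s = (if even s then real m + 2 * real j + real s else real s + 1)"

lemma dirac_xpow:
  fixes M :: "'m::{finite,linorder} cl_fun"
  assumes M: "hpoly j M" and mono: "\<And>x. dirac M x = 0"
  shows "dirac (\<lambda>x. xpow (Suc s) x (M x)) x = - (fischer_const CARD('m) j s *\<^sub>R xpow s x (M x))"
proof (induction s)
  case 0
  then show ?case using dirac_cl_vec_mult[OF M, of x] mono by (simp add: fischer_const_def)
next
  case (Suc s)
  have "dirac (\<lambda>x. xpow (Suc (Suc s)) x (M x)) x
    = - ((real CARD('m) + 2 * real (Suc s + j)) *\<^sub>R xpow (Suc s) x (M x)) - cl_vec x \<odot> dirac (\<lambda>x. xpow (Suc s) x (M x)) x"
    using dirac_cl_vec_mult[OF hpoly_xpow[OF M, of "Suc s"], of x] by simp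
  also have "\<dots> = - ((real CARD('m) + 2 * real (Suc s + j) - fischer_const CARD('m) j s) *\<^sub>R xpow (Suc s) x (M x))"
    unfolding Suc by (simp add: cl_mult_minus_right cl_mult_scaleR_right algebra_simps)
  also have "real CARD('m) + 2 * real (Suc s + j) - fischer_const CARD('m) j s = fischer_const CARD('m) j (Suc s)"
    by (auto simp: fischer_const_def)
  finally show ?case .
qed

inductive fischer_sum :: "nat \<Rightarrow> 'm::{finite,linorder} cl_fun \<Rightarrow> bool" where
  fischer_term: "hpoly j M \<Longrightarrow> (\<And>x. dirac M x = 0) \<Longrightarrow> fischer_sum (s + j) (\<lambda>x. xpow s x (M x))"
| fischer_add: "fischer_sum k P \<Longrightarrow> fischer_sum k Q \<Longrightarrow> fischer_sum k (\<lambda>x. P x + Q x)"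

lemma fischer_sum_hpoly: "fischer_sum k P \<Longrightarrow> hpoly k P"
  by (induction rule: fischer_sum.induct) (auto intro: hpoly_xpow hpoly_add)

lemma fischer_sum_cl_vec: "fischer_sum k P \<Longrightarrow> fischer_sum (Suc k) (\<lambda>x. cl_vec x \<odot> P x)"
proof (induction rule: fischer_sum.induct)
  case (fischer_term j M s)
  from fischer_sum.fischer_term[OF this, of "Suc s"] show ?case by simp
next
  case (fischer_add k P Q)
  from fischer_sum.fischer_add[OF fischer_add.IH] show ?case by (simp add: cl_mult_add_right)
qed

text \<open>On each term \<open>x^s M\<close> the map taking \<open>Q\<close> to
  \<open>dirac (x Q)\<close> is multiplication by \<open>- fischer_const\<close>, which is nonzero,
  so rescaling \<open>M\<close> inverts it.\<close>

lemma fischer_sum_dirac_solve: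
  fixes P :: "'m::{finite,linorder} cl_fun"
  shows "fischer_sum k P \<Longrightarrow> \<exists>Q. fischer_sum k Q \<and> (\<forall>x. dirac (\<lambda>x. cl_vec x \<odot> Q x) x = P x)"
proof (induction rule: fischer_sum.induct)
  case (fischer_term j M s)
  define c where "c = - (1 / fischer_const CARD('m) j s)"
  have nz: "fischer_const CARD('m) j s \<noteq> 0"
  proof -
    have "0 < real CARD('m)" by simp
    then have "fischer_const CARD('m) j s > 0"
      unfolding fischer_const_def by (simp add: add_pos_nonneg del: zero_less_card_finite)
    then show ?thesis by simp
  qed
  have x: "xpow s x (c *\<^sub>R M x) = c *\<^sub>R xpow s x (M x)" for x
    by (induction s) (auto simp: cl_mult_scaleR_right)
  have "fischer_sum (s + j) (\<lambda>x. xpow s x (c *\<^sub>R M x))"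
    using fischer_term by (intro fischer_sum.fischer_term hpoly_scaleR) (auto simp: dirac_scaleR)
  moreover have "dirac (\<lambda>x. cl_vec x \<odot> xpow s x (c *\<^sub>R M x)) y = xpow s y (M y)" for y
  proof -
    have "dirac (\<lambda>x. c *\<^sub>R xpow (Suc s) x (M x)) y = c *\<^sub>R dirac (\<lambda>x. xpow (Suc s) x (M x)) y"
      by (rule dirac_scaleR[OF hpoly_xpow[OF fischer_term(1)]])
    also have "\<dots> = xpow s y (M y)"
      unfolding dirac_xpow[OF fischer_term] using nz by (simp add: c_def)
    finally show ?thesis by (simp add: x cl_mult_scaleR_right)
  qed
  ultimately show ?case by blast
next
  case (fischer_add k P Q)
  then obtain P' Q' where P': "fischer_sum k P'" "\<And>x. dirac (\<lambda>x. cl_vec x \<odot> P' x) x = P x"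
    and Q': "fischer_sum k Q'" "\<And>x. dirac (\<lambda>x. cl_vec x \<odot> Q' x) x = Q x" by auto
  have "dirac (\<lambda>x. cl_vec x \<odot> (P' x + Q' x)) x = P x + Q x" for x
    unfolding cl_mult_add_right
    by (subst dirac_add[OF hpoly_cl_vec[OF fischer_sum_hpoly[OF P'(1)]] hpoly_cl_vec[OF fischer_sum_hpoly[OF Q'(1)]]])
      (simp add: P'(2) Q'(2))
  with fischer_sum.fischer_add[OF P'(1) Q'(1)] show ?case by blast
qed

text \<open>Induction on the degree: \<open>dirac (x Q) = dirac P\<close> is solved for \<open>Q\<close> term by term on the
  decomposition of \<open>dirac P\<close>, and then \<open>P - x Q\<close> is monogenic.\<close>

theorem fischer_decomposition: "hpoly k P \<Longrightarrow> fischer_sum k P"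
proof (induction k arbitrary: P)
  case 0
  then show ?case using fischer_term[of 0 P 0] by (simp add: hpoly_0_dirac)
next
  case (Suc k)
  from fischer_sum_dirac_solve[OF Suc.IH[OF hpoly_dirac[OF Suc.prems]]]
  obtain Q where Q: "fischer_sum k Q" "\<And>x. dirac (\<lambda>x. cl_vec x \<odot> Q x) x = dirac P x" by auto
  let ?N = "\<lambda>x. P x + (- 1) *\<^sub>R (cl_vec x \<odot> Q x)"
  have xQ: "hpoly (Suc k) (\<lambda>x. cl_vec x \<odot> Q x)"
    by (intro hpoly_cl_vec fischer_sum_hpoly Q)
  have "hpoly (Suc k) ?N" by (intro hpoly_add hpoly_scaleR xQ Suc.prems)
  moreover have "dirac ?N x = 0" for x
    by (subst dirac_add[OF Suc.prems hpoly_scaleR[OF xQ]], subst dirac_scaleR[OF xQ]) (simp add: Q)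
  ultimately have "fischer_sum (Suc k) ?N" using fischer_term[of "Suc k" ?N 0] by simp
  from fischer_add[OF this fischer_sum_cl_vec[OF Q(1)]] show ?case by simp
qed

lemma monogenics_hpolyI:
  assumes "hpoly k M" "\<And>x. dirac M x = 0"
  shows "M \<in> monogenics k"
  using assms hpoly_polynomial_function hpoly_homogeneous hpoly_real by (auto simp: monogenics_def)

section \<open>Orthogonality of spherical monogenics\<close>

lemma power_le_exp_square:
  fixes e :: real
  assumes "e > 0"
  shows "\<exists>C\<ge>0. \<forall>r\<ge>0. r ^ k \<le> C * exp (e * r\<^sup>2)"
proof (cases "k = 0")
  case True
  have "1 \<le> 1 * exp (e * r\<^sup>2)" for r using assms by simp
  with True show ?thesis by (intro exI[of _ 1]) auto
next
  case False
  \<comment> \<open>From \<open>z \<le> exp z\<close> with \<open>z = e r^2 / k\<close>, raised to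
    the power \<open>k\<close>, the square of \<open>r^k\<close> is bounded; the summand 1 pays for
    passing from \<open>r^k\<close> to its square.\<close>
  define C where "C = 1 + (real k / e) ^ k"
  have C: "C \<ge> 0" using assms by (simp add: C_def)
  have "r ^ k \<le> C * exp (e * r\<^sup>2)" if r: "r \<ge> 0" for r
  proof -
    have e1: "1 \<le> exp (e * r\<^sup>2)" using assms by simp
    have "e * r\<^sup>2 / real k \<le> exp (e * r\<^sup>2 / real k)"
      using exp_ge_add_one_self[of "e * r\<^sup>2 / real k"] by linarith
    then have "(e * r\<^sup>2 / real k) ^ k \<le> exp (e * r\<^sup>2 / real k) ^ k"
      using assms by (intro power_mono) auto
    also have "\<dots> = exp (e * r\<^sup>2)"
      using False by (simp flip: exp_of_nat_mult)
    finally have "(real k / e) ^ k * (e * r\<^sup>2 / real k) ^ k \<le> (real k / e) ^ k * exp (e * r\<^sup>2)"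
      using assms by (intro mult_left_mono) auto
    also have "(real k / e) ^ k * (e * r\<^sup>2 / real k) ^ k = (r ^ k)\<^sup>2"
    proof -
      have "(real k / e) * (e * r\<^sup>2 / real k) = r\<^sup>2" using False assms by simp
      then have "(real k / e) ^ k * (e * r\<^sup>2 / real k) ^ k = (r\<^sup>2) ^ k"
        by (simp only: power_mult_distrib[symmetric])
      then show ?thesis by (simp only: power_mult[symmetric] mult.commute)
    qed
    finally have 2: "(r ^ k)\<^sup>2 \<le> (real k / e) ^ k * exp (e * r\<^sup>2)" .
    have "r ^ k \<le> 1 + (r ^ k)\<^sup>2"
      using zero_le_power2[of "r ^ k - 1/2"] unfolding power2_diff by (simp add: power2_eq_square)
    also have "\<dots> \<le> C * exp (e * r\<^sup>2)"
      using 2 e1 unfolding C_def distrib_right by linarith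
    finally show ?thesis .
  qed
  with C show ?thesis by blast
qed

section \<open>Radial integrals and homogeneous functions in polar coordinates\<close>

lemma integrable_radial_measure:
  fixes g :: "real \<Rightarrow> real"
  assumes [measurable]: "g \<in> borel_measurable borel"
  shows "integrable (radial_measure n) g \<longleftrightarrow>
      integrable lborel (\<lambda>s. if s > 0 then s powr (real n / 2 - 1) * g s else 0)" (is ?i)
    and "(\<integral>s. g s \<partial>radial_measure n) = (\<integral>s. (if s > 0 then s powr (real n / 2 - 1) * g s else 0) \<partial>lborel) / 2" (is ?e)
proof -
  have eq: "(if s > 0 then s powr (real n / 2 - 1) / 2 else 0) * g s
     = 1/2 * (if s > 0 then s powr (real n / 2 - 1) * g s else 0)" for s
    by simp
  show ?i unfolding radial_measure_def
    by (subst integrable_density) (auto simp: eq simp del: times_divide_eq_left mult_zero_right)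
  show ?e unfolding radial_measure_def
    by (subst integral_density) (auto simp: eq simp del: times_divide_eq_left mult_zero_right)
qed

lemma radial_measure_lag_mean:
  fixes q :: "real \<Rightarrow> real"
  assumes [measurable]: "q \<in> borel_measurable borel"
  shows "integrable (radial_measure n) (\<lambda>s. s powr b * exp (- y * s) * q s) \<longleftrightarrow>
      integrable lborel (\<lambda>s. if s > 0 then s powr (real n / 2 - 1 + b) * exp (- y * s) * q s else 0)" (is ?i)
    and "(\<integral>s. s powr b * exp (- y * s) * q s \<partial>radial_measure n) = lag_mean (real n / 2 - 1 + b) y q / 2" (is ?e)
proof -
  have eq: "(if s > 0 then s powr (real n / 2 - 1) * (s powr b * exp (- y * s) * q s) else 0)
     = (if s > 0 then s powr (real n / 2 - 1 + b) * exp (- y * s) * q s else 0)" for s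
    by (simp add: powr_add)
  show ?i by (subst integrable_radial_measure) (auto simp: eq)
  show ?e by (subst integrable_radial_measure) (auto simp: eq lag_mean_def)
qed

lemma integrable_sphere:
  fixes Y :: "real ^ 'm \<Rightarrow> 'b :: {banach, second_countable_topology}"
  assumes Y: "continuous_on UNIV Y"
  shows "integrable sphere_measure Y"
proof -
  have "compact (Y ` sphere 0 1)"
    using Y by (intro compact_continuous_image) (auto intro: continuous_on_subset)
  then obtain B where B: "\<And>x. norm x = 1 \<Longrightarrow> norm (Y x) \<le> B"
    using compact_imp_bounded[of "Y ` sphere 0 1"] unfolding bounded_iff by (auto simp: sphere_def dist_norm)
  have "AE x in sphere_measure. norm (Y x) \<le> B"
    using AE_sphere_measure_norm by eventually_elim (rule B)
  moreover have "Y \<in> borel_measurable sphere_measure"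
    using borel_measurable_continuous_onI[OF Y] by (simp cong: measurable_cong_sets)
  ultimately show ?thesis
    by (intro finite_measure.integrable_const_bound[OF finite_measure_sphere])
qed

lemma AE_lborel_nonzero: "AE x in lborel. (x :: real ^ 'm) \<noteq> 0"
  by (rule AE_I[of _ _ "{0}"]) auto

lemma polar_homogeneous:
  fixes Y :: "real ^ 'm \<Rightarrow> complex" and g :: "real \<Rightarrow> real"
  assumes Y: "continuous_on UNIV Y" and hom: "\<And>t x. t > 0 \<Longrightarrow> Y (t *\<^sub>R x) = t ^ k *\<^sub>R Y x"
    and [measurable]: "g \<in> borel_measurable borel"
    and g: "integrable (radial_measure CARD('m)) (\<lambda>s. s powr (real k / 2) * g s)"
  shows "integrable lborel (\<lambda>x. g ((norm x)\<^sup>2) *\<^sub>R Y x)" (is ?i)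
    and "(\<integral>x. g ((norm x)\<^sup>2) *\<^sub>R Y x \<partial>lborel)
      = (\<integral>s. s powr (real k / 2) * g s \<partial>radial_measure CARD('m)) *\<^sub>R (\<integral>x. Y x \<partial>sphere_measure)" (is ?e)
proof -
  have [measurable]: "Y \<in> borel_measurable borel" by (rule borel_measurable_continuous_onI[OF Y])
  have eq: "AE x in lborel. (((norm x)\<^sup>2) powr (real k / 2) * g ((norm x)\<^sup>2)) *\<^sub>R Y (x /\<^sub>R norm x) = g ((norm x)\<^sup>2) *\<^sub>R Y x"
    using AE_lborel_nonzero
  proof eventually_elim
    case (elim x)
    have "Y x = Y (norm x *\<^sub>R (x /\<^sub>R norm x))" using elim by simp
    also have "\<dots> = norm x ^ k *\<^sub>R Y (x /\<^sub>R norm x)" using elim by (intro hom) simp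
    also have "norm x ^ k = ((norm x)\<^sup>2) powr (real k / 2)"
      using elim by (simp add: powr_powr powr_realpow flip: powr_numeral)
    finally show ?case by (simp add: mult.commute)
  qed
  note P = polar_integral[OF g integrable_sphere[OF Y]]
  show ?i using P(1) by (subst integrable_cong_AE[OF _ _ eq, symmetric]) measurable
  have "(\<integral>x. g ((norm x)\<^sup>2) *\<^sub>R Y x \<partial>lborel)
     = (\<integral>x. (((norm x)\<^sup>2) powr (real k / 2) * g ((norm x)\<^sup>2)) *\<^sub>R Y (x /\<^sub>R norm x) \<partial>lborel)"
    by (rule integral_cong_AE[OF _ _ eq[THEN AE_symmetric]]) measurable
  then show ?e using P(2) by simp
qed

lemma integrable_gauss:
  assumes "e > 0"
  shows "integrable lborel (\<lambda>x :: real ^ 'm. exp (- e * (norm x)\<^sup>2))"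
proof -
  have "integrable (radial_measure CARD('m)) (\<lambda>s. s powr (real 0 / 2) * exp (- e * s))"
  proof -
    have "integrable lborel (\<lambda>s. if s > 0 then s powr (real CARD('m) / 2 - 1 + 0) * exp (- e * s) * 1 else 0)"
      using integrable.intros[OF radial_gamma[of "real CARD('m) / 2 - 1" e]] assms by (simp cong: if_cong)
    then have "integrable (radial_measure CARD('m)) (\<lambda>s. s powr 0 * exp (- e * s) * 1)"
      by (rule radial_measure_lag_mean(1)[THEN iffD2, rotated]) simp
    then show ?thesis by simp
  qed
  then have "integrable lborel (\<lambda>x :: real ^ 'm. exp (- e * (norm x)\<^sup>2) *\<^sub>R (1 :: complex))"
    by (intro polar_homogeneous(1)[where k = 0]) auto
  then have "integrable lborel (\<lambda>x :: real ^ 'm. Re (exp (- e * (norm x)\<^sup>2) *\<^sub>R (1 :: complex)))"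
    by (rule integrable_Re)
  then show ?thesis by simp
qed

text \<open>Lebesgue measure is translation invariant, so every difference quotient of
  \<open>F\<close> has integral zero, and dominated convergence passes this to the
  derivative.\<close>

lemma integral_derivative_gauss_zero:
  fixes F :: "real ^ 'm \<Rightarrow> complex"
  assumes der: "\<And>x. (F has_derivative F' x) (at x)"
    and bF: "\<And>x. norm (F x) \<le> C * exp (- (norm x)\<^sup>2 / 4)"
    and bF': "\<And>x. norm (F' x v) \<le> C * exp (- (norm x)\<^sup>2 / 4)"
    and v: "norm v \<le> 1"
  shows "(\<integral>x. F' x v \<partial>lborel) = 0"
proof -
  have cont: "continuous_on UNIV F"
    using der by (meson has_derivative_continuous_on has_derivative_at_withinI)
  have [measurable]: "F \<in> borel_measurable borel" by (rule borel_measurable_continuous_onI[OF cont])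
  have g4: "integrable lborel (\<lambda>x :: real ^ 'm. C * exp (- (norm x)\<^sup>2 / 4))"
    using integrable_gauss[where 'm = 'm, of "1/4"] by simp
  have iF: "integrable lborel F"
    by (rule Bochner_Integration.integrable_bound[OF g4])
      (use bF in \<open>auto intro!: AE_I2 order.trans[OF _ abs_ge_self]\<close>)
  define t where "t n = 1 / real (Suc n)" for n
  have t: "0 < t n" "t n \<le> 1" for n by (auto simp: t_def)
  define q where "q n x = (F (x + t n *\<^sub>R v) - F x) /\<^sub>R t n" for n x
  have q0: "(\<integral>x. q n x \<partial>lborel) = 0" for n
  proof -
    have i: "integrable lborel (\<lambda>x. F (t n *\<^sub>R v + x))" and e: "(\<integral>x. F (t n *\<^sub>R v + x) \<partial>lborel) = (\<integral>x. F x \<partial>lborel)"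
    proof -
      have "integrable (distr lborel borel ((+) (t n *\<^sub>R v))) F" using iF by (simp add: lborel_distr_plus)
      then show "integrable lborel (\<lambda>x. F (t n *\<^sub>R v + x))" by (subst (asm) integrable_distr_eq) auto
      have "(\<integral>x. F x \<partial>lborel) = (\<integral>x. F x \<partial>distr lborel borel ((+) (t n *\<^sub>R v)))" by (simp add: lborel_distr_plus)
      then show "(\<integral>x. F (t n *\<^sub>R v + x) \<partial>lborel) = (\<integral>x. F x \<partial>lborel)" by (subst (asm) integral_distr) auto
    qed
    have "(\<integral>x. F (t n *\<^sub>R v + x) - F x \<partial>lborel) = 0"
      using i e iF by simp
    then show ?thesis by (simp add: q_def add.commute)
  qed
  have lim: "(\<lambda>n. q n x) \<longlonglongrightarrow> F' x v" for x
  proof (cases "v = 0")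
    case True
    have "F' x 0 = 0" using has_derivative_bounded_linear[OF der] by (rule linear_simps(3))
    then show ?thesis by (simp add: q_def True)
  next
    case False
    have "(\<lambda>n. t n) \<longlonglongrightarrow> 0" unfolding t_def by (rule LIMSEQ_Suc[OF lim_1_over_n])
    moreover have "((\<lambda>s. (F (x + s *\<^sub>R v) - F x) /\<^sub>R s) \<longlongrightarrow> F' x v) (at 0)"
    proof -
      have "((\<lambda>s. F (x + s *\<^sub>R v)) has_derivative (\<lambda>s. F' x (s *\<^sub>R v))) (at (0::real))"
        by (rule has_derivative_compose[of "\<lambda>s. x + s *\<^sub>R v" "\<lambda>s. s *\<^sub>R v" 0 UNIV F "F' x"])
          (auto intro!: derivative_eq_intros der)
      moreover have "(\<lambda>s. F' x (s *\<^sub>R v)) = (\<lambda>s. s *\<^sub>R F' x v)"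
        using has_derivative_bounded_linear[OF der] by (auto simp: linear_simps)
      ultimately have "((\<lambda>s. F (x + s *\<^sub>R v)) has_derivative (\<lambda>s. s *\<^sub>R F' x v)) (at 0)"
        by simp
      then have "((\<lambda>s. norm (F (x + s *\<^sub>R v) - F x - s *\<^sub>R F' x v) / norm s) \<longlongrightarrow> 0) (at 0)"
        unfolding has_derivative_at by simp
      then have "((\<lambda>s. norm ((F (x + s *\<^sub>R v) - F x) /\<^sub>R s - F' x v)) \<longlongrightarrow> 0) (at 0)"
      proof (rule Lim_transform_eventually)
        show "\<forall>\<^sub>F s in at 0. norm (F (x + s *\<^sub>R v) - F x - s *\<^sub>R F' x v) / norm s
          = norm ((F (x + s *\<^sub>R v) - F x) /\<^sub>R s - F' x v)"
        proof (rule eventually_at_filter[THEN iffD2], intro always_eventually allI impI)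
          fix s :: real assume "s \<noteq> 0"
          then have "(F (x + s *\<^sub>R v) - F x) /\<^sub>R s - F' x v = (F (x + s *\<^sub>R v) - F x - s *\<^sub>R F' x v) /\<^sub>R s"
            by (simp add: scaleR_diff_right)
          then show "norm (F (x + s *\<^sub>R v) - F x - s *\<^sub>R F' x v) / norm s
            = norm ((F (x + s *\<^sub>R v) - F x) /\<^sub>R s - F' x v)"
            by (simp only: norm_scaleR) (simp add: divide_inverse mult.commute)
        qed
      qed
      then show ?thesis by (rule LIM_zero_cancel[OF tendsto_norm_zero_cancel])
    qed
    moreover have "t n \<noteq> 0" for n using t(1)[of n] by linarith
    ultimately show ?thesis
      unfolding q_def
      by (intro filterlim_compose[of "\<lambda>s. (F (x + s *\<^sub>R v) - F x) /\<^sub>R s" _ "at 0" t])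
        (auto simp: filterlim_at)
  qed
  \<comment> \<open>By the mean value theorem the quotient is bounded by a derivative at a point
    \<open>x + s v\<close> at distance at most 1 from \<open>x\<close>. Then
    \<open>(norm x)^2 \<le> 2 (norm (x + s v))^2 + 2\<close>, which weakens the rate from
    \<open>1/4\<close> to \<open>1/8\<close> and costs the factor \<open>exp (1/4)\<close>.\<close>
  have bound: "norm (q n x) \<le> C * exp (1/4) * exp (- (1/8) * (norm x)\<^sup>2)" for n x
  proof -
    have "\<exists>s\<in>{0<..<t n}. norm (F (x + t n *\<^sub>R v) - F (x + 0 *\<^sub>R v)) \<le> norm (F' (x + s *\<^sub>R v) ((t n - 0) *\<^sub>R v))"
    proof (rule mvt_general[where f = "\<lambda>s. F (x + s *\<^sub>R v)" and f' = "\<lambda>s h. F' (x + s *\<^sub>R v) (h *\<^sub>R v)"])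
      show "0 < t n" by (rule t)
      show "continuous_on {0..t n} (\<lambda>s. F (x + s *\<^sub>R v))"
        by (intro continuous_on_compose2[OF cont] continuous_intros) auto
      show "((\<lambda>s. F (x + s *\<^sub>R v)) has_derivative (\<lambda>h. F' (x + s *\<^sub>R v) (h *\<^sub>R v))) (at s)" for s
        by (rule has_derivative_compose[of "\<lambda>s. x + s *\<^sub>R v" "\<lambda>s. s *\<^sub>R v" s UNIV F "F' (x + s *\<^sub>R v)"])
          (auto intro!: derivative_eq_intros der)
    qed
    then obtain s where s: "0 < s" "s < t n"
      and le: "norm (F (x + t n *\<^sub>R v) - F x) \<le> norm (F' (x + s *\<^sub>R v) (t n *\<^sub>R v))" by auto
    have "F' (x + s *\<^sub>R v) (t n *\<^sub>R v) = t n *\<^sub>R F' (x + s *\<^sub>R v) v"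
      using has_derivative_bounded_linear[OF der] by (auto simp: linear_simps)
    with le have "norm (F (x + t n *\<^sub>R v) - F x) \<le> norm (F' (x + s *\<^sub>R v) v) * t n"
      using t(1)[of n] by (simp add: abs_of_pos mult.commute)
    moreover have "norm (q n x) = norm (F (x + t n *\<^sub>R v) - F x) / t n"
      using t(1)[of n] by (simp add: q_def divide_inverse mult.commute abs_of_pos)
    ultimately have "norm (q n x) \<le> norm (F' (x + s *\<^sub>R v) v)"
      using t(1)[of n] by (simp only: pos_divide_le_eq)
    also have "\<dots> \<le> C * exp (- (norm (x + s *\<^sub>R v))\<^sup>2 / 4)" by (rule bF')
    also have "\<dots> \<le> C * (exp (1/4) * exp (- (1/8) * (norm x)\<^sup>2))"
    proof (rule mult_left_mono)
      have "norm x \<le> norm (x + s *\<^sub>R v) + norm (s *\<^sub>R v)"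
        using norm_triangle_ineq4[of "x + s *\<^sub>R v" "s *\<^sub>R v"] by simp
      moreover have "norm (s *\<^sub>R v) \<le> 1"
        using s t[of n] v mult_mono[of s 1 "norm v" 1] by simp
      ultimately have "norm x \<le> norm (x + s *\<^sub>R v) + 1" by linarith
      then have "(norm x)\<^sup>2 \<le> (norm (x + s *\<^sub>R v) + 1)\<^sup>2" by (intro power_mono) auto
      also have "\<dots> \<le> 2 * (norm (x + s *\<^sub>R v))\<^sup>2 + 2"
        using zero_le_power2[of "norm (x + s *\<^sub>R v) - 1"] unfolding power2_sum power2_diff by simp
      finally show "exp (- (norm (x + s *\<^sub>R v))\<^sup>2 / 4) \<le> exp (1/4) * exp (- (1/8) * (norm x)\<^sup>2)"
        by (simp flip: exp_add)
      show "0 \<le> C" using order.trans[OF norm_ge_zero bF[of 0]] by simp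
    qed
    finally show ?thesis by (simp add: mult.assoc)
  qed
  have "(\<lambda>n. \<integral>x. q n x \<partial>lborel) \<longlonglongrightarrow> (\<integral>x. F' x v \<partial>lborel)"
  proof (rule integral_dominated_convergence)
    show q: "q n \<in> borel_measurable lborel" for n
      unfolding q_def by measurable
    show "(\<lambda>x. F' x v) \<in> borel_measurable lborel"
      by (rule borel_measurable_LIMSEQ_metric[OF q lim])
    show "integrable lborel (\<lambda>x :: real ^ 'm. C * exp (1/4) * exp (- (1/8) * (norm x)\<^sup>2))"
      using integrable_gauss[where 'm = 'm, of "1/8"] by (intro integrable_mult_right) simp
  qed (use lim bound in auto)
  then show ?thesis unfolding q0 using LIMSEQ_unique tendsto_const by blast
qed

lemmas scaleR_complex_conv = scaleR_conv_of_real[where 'a = complex]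

text \<open>For homogeneous \<open>P\<close> and \<open>Q\<close> the integral of this function is a
  positive multiple of their inner product on the sphere, while integration by parts over the whole
  space has no boundary terms. The rate \<open>1/2\<close> makes the \<open>i\<close>-th derivative
  of the weight equal to \<open>- x_i\<close> times the weight.\<close>

definition gauss_dot :: "'m::{finite,linorder} cl_fun \<Rightarrow> 'm cl_fun \<Rightarrow> (real, 'm) vec \<Rightarrow> complex" where
  "gauss_dot P Q x = exp (- (norm x)\<^sup>2 / 2) *\<^sub>R hdot (P x) (Q x)"

lemma continuous_hdot:
  assumes "continuous_on S f" "continuous_on S g"
  shows "continuous_on S (\<lambda>x. hdot (f x) (g x))"
  unfolding hdot_def by (intro continuous_intros assms)

lemma hpoly_hdot_homogeneous:
  assumes "hpoly k P" "hpoly l Q"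
  shows "hdot (P (t *\<^sub>R x)) (Q (t *\<^sub>R x)) = t ^ (k + l) *\<^sub>R hdot (P x) (Q x)"
  using hpoly_homogeneous[OF assms(1), of t x] hpoly_homogeneous[OF assms(2), of t x]
  by (simp add: hdot_scaleR_left hdot_scaleR_right power_add scaleR_complex_conv)

lemma gauss_dot_bound:
  assumes "hpoly k P" "hpoly l Q"
  shows "\<exists>C\<ge>0. \<forall>x. norm (gauss_dot P Q x) \<le> C * exp (- (norm x)\<^sup>2 / 4)"
proof -
  obtain A where A: "A \<ge> 0" "\<And>x. norm (P x) \<le> A * norm x ^ k" using hpoly_bound[OF assms(1)] by auto
  obtain B where B: "B \<ge> 0" "\<And>x. norm (Q x) \<le> B * norm x ^ l" using hpoly_bound[OF assms(2)] by auto
  obtain C where C: "C \<ge> 0" "\<And>r::real. r \<ge> 0 \<Longrightarrow> r ^ (k + l) \<le> C * exp (1/4 * r\<^sup>2)"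
    using power_le_exp_square[of "1/4" "k + l"] by auto
  have "norm (gauss_dot P Q x) \<le> A * B * C * exp (- (norm x)\<^sup>2 / 4)" for x
  proof -
    have "norm (hdot (P x) (Q x)) \<le> (A * norm x ^ k) * (B * norm x ^ l)"
      by (rule order.trans[OF norm_hdot_le]) (intro mult_mono A B, use A in auto)
    also have "\<dots> = A * B * norm x ^ (k + l)" by (simp add: power_add)
    also have "\<dots> \<le> A * B * (C * exp (1/4 * (norm x)\<^sup>2))"
      using A B C by (intro mult_left_mono) auto
    finally have "norm (gauss_dot P Q x) \<le> exp (- (norm x)\<^sup>2 / 2) * (A * B * (C * exp (1/4 * (norm x)\<^sup>2)))"
      unfolding gauss_dot_def norm_scaleR by (simp add: mult_left_mono)
    also have "\<dots> = A * B * C * (exp (- (norm x)\<^sup>2 / 2) * exp (1/4 * (norm x)\<^sup>2))" by simp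
    also have "exp (- (norm x)\<^sup>2 / 2) * exp (1/4 * (norm x)\<^sup>2) = exp (- (norm x)\<^sup>2 / 4)"
      by (simp flip: exp_add)
    finally show ?thesis .
  qed
  with A B C show ?thesis by (intro exI[of _ "A * B * C"]) auto
qed

lemma gauss_dot_integrable:
  assumes "hpoly k P" "hpoly l Q"
  shows "integrable lborel (gauss_dot P Q)"
proof -
  obtain C where C: "C \<ge> 0" "\<And>x. norm (gauss_dot P Q x) \<le> C * exp (- (norm x)\<^sup>2 / 4)"
    using gauss_dot_bound[OF assms] by auto
  have [measurable]: "P \<in> borel_measurable borel" "Q \<in> borel_measurable borel"
    using assms hpoly_measurable by blast+
  have m: "gauss_dot P Q \<in> borel_measurable lborel"
    unfolding gauss_dot_def[abs_def] by measurable
  have i: "integrable lborel (\<lambda>x :: (real, 'a) vec. C * exp (- (norm x)\<^sup>2 / 4))"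
    using integrable_gauss[where 'm = 'a, of "1/4"] by simp
  show ?thesis
    by (rule Bochner_Integration.integrable_bound[OF i m]) (use C in \<open>auto intro!: AE_I2 order.trans[OF _ abs_ge_self]\<close>)
qed

lemma bounded_bilinear_hdot:
  "bounded_bilinear (hdot :: complex ^ 'n \<Rightarrow> complex ^ 'n \<Rightarrow> complex)"
proof -
  have "bilinear (hdot :: complex ^ 'n \<Rightarrow> complex ^ 'n \<Rightarrow> complex)"
    unfolding bilinear_def
    by (auto intro!: linearI simp: hdot_add_left hdot_add_right hdot_scaleR_left hdot_scaleR_right scaleR_complex_conv)
  then show ?thesis by (simp add: bilinear_conv_bounded_bilinear)
qed

lemma gauss_dot_derivative:
  fixes P Q :: "'m::{finite,linorder} cl_fun"
  assumes "(P has_derivative P') (at x)" "(Q has_derivative Q') (at x)"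
  shows "(gauss_dot P Q has_derivative
     (\<lambda>h. exp (- (norm x)\<^sup>2 / 2) *\<^sub>R (hdot (P' h) (Q x) + hdot (P x) (Q' h) - (x \<bullet> h) *\<^sub>R hdot (P x) (Q x)))) (at x)"
proof -
  have "((\<lambda>x :: (real, 'm) vec. exp (- (x \<bullet> x) / 2)) has_derivative (\<lambda>h. exp (- (x \<bullet> x) / 2) * (- (x \<bullet> h)))) (at x)"
    by (auto intro!: derivative_eq_intros simp: inner_commute fun_eq_iff)
  then have e: "((\<lambda>x :: (real, 'm) vec. exp (- (norm x)\<^sup>2 / 2)) has_derivative (\<lambda>h. exp (- (norm x)\<^sup>2 / 2) * (- (x \<bullet> h)))) (at x)"
    by (simp only: power2_norm_eq_inner)
  from has_derivative_scaleR[OF e bounded_bilinear.FDERIV[OF bounded_bilinear_hdot assms]]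
  show ?thesis unfolding gauss_dot_def[abs_def]
    by (simp add: scaleR_add_right scaleR_diff_right algebra_simps)
qed

lemma is_gradient_hpoly: "is_gradient k P D \<Longrightarrow> \<exists>j. hpoly j (D i)"
  using is_gradientD(1)[of k P D i] hpoly_zero by (auto split: if_splits)

lemma gauss_dot_partial:
  fixes P Q :: "'m::{finite,linorder} cl_fun"
  assumes P: "hpoly k P" "is_gradient k P D" and Q: "hpoly l Q" "is_gradient l Q E"
  shows "(\<integral>x. gauss_dot (D i) Q x \<partial>lborel) + (\<integral>x. gauss_dot P (E i) x \<partial>lborel)
     = (\<integral>x. gauss_dot P (\<lambda>x. (x $ i) *\<^sub>R Q x) x \<partial>lborel)"
proof -
  obtain j where Di: "hpoly j (D i)" using is_gradient_hpoly[OF P(2)] by blast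
  obtain j' where Ei: "hpoly j' (E i)" using is_gradient_hpoly[OF Q(2)] by blast
  note xQ = hpoly_coord[OF Q(1), of i]
  obtain A where A: "A \<ge> 0" "\<And>x. norm (gauss_dot P Q x) \<le> A * exp (- (norm x)\<^sup>2 / 4)"
    using gauss_dot_bound[OF P(1) Q(1)] by auto
  obtain B1 where B1: "B1 \<ge> 0" "\<And>x. norm (gauss_dot (D i) Q x) \<le> B1 * exp (- (norm x)\<^sup>2 / 4)"
    using gauss_dot_bound[OF Di Q(1)] by auto
  obtain B2 where B2: "B2 \<ge> 0" "\<And>x. norm (gauss_dot P (E i) x) \<le> B2 * exp (- (norm x)\<^sup>2 / 4)"
    using gauss_dot_bound[OF P(1) Ei] by auto
  obtain B3 where B3: "B3 \<ge> 0" "\<And>x. norm (gauss_dot P (\<lambda>x. (x $ i) *\<^sub>R Q x) x) \<le> B3 * exp (- (norm x)\<^sup>2 / 4)"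
    using gauss_dot_bound[OF P(1) xQ] by auto
  define F' where "F' x h = exp (- (norm x)\<^sup>2 / 2) *\<^sub>R
     (hdot (\<Sum>i\<in>UNIV. (h $ i) *\<^sub>R D i x) (Q x) + hdot (P x) (\<Sum>i\<in>UNIV. (h $ i) *\<^sub>R E i x) - (x \<bullet> h) *\<^sub>R hdot (P x) (Q x))"
    for x h :: "(real, 'm) vec"
  have der: "(gauss_dot P Q has_derivative F' x) (at x)" for x
    unfolding F'_def by (rule gauss_dot_derivative[OF is_gradientD(2)[OF P(2)] is_gradientD(2)[OF Q(2)]])
  have ax: "(\<Sum>j\<in>UNIV. (axis i 1 $ j) *\<^sub>R G j) = G i" for G :: "'m \<Rightarrow> 'm clifford"
  proof -
    have "(\<Sum>j\<in>UNIV. (axis i 1 $ j) *\<^sub>R G j) = (\<Sum>j\<in>UNIV. if j = i then G i else 0)"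
      by (intro sum.cong refl) (auto simp: axis_def)
    then show ?thesis by simp
  qed
  have F': "F' x (axis i 1) = gauss_dot (D i) Q x + gauss_dot P (E i) x - gauss_dot P (\<lambda>x. (x $ i) *\<^sub>R Q x) x" for x
    by (simp add: F'_def ax gauss_dot_def inner_axis hdot_scaleR_right scaleR_complex_conv distrib_left right_diff_distrib)
  have "(\<integral>x. F' x (axis i 1) \<partial>lborel) = 0"
  proof (rule integral_derivative_gauss_zero[OF der])
    show "norm (gauss_dot P Q x) \<le> (A + B1 + B2 + B3) * exp (- (norm x)\<^sup>2 / 4)" for x
      by (rule order.trans[OF A(2)]) (use A B1 B2 B3 in \<open>intro mult_right_mono, auto\<close>)
    show "norm (F' x (axis i 1)) \<le> (A + B1 + B2 + B3) * exp (- (norm x)\<^sup>2 / 4)" for x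
    proof -
      have "norm (F' x (axis i 1)) \<le> norm (gauss_dot (D i) Q x) + norm (gauss_dot P (E i) x)
          + norm (gauss_dot P (\<lambda>x. (x $ i) *\<^sub>R Q x) x)"
        unfolding F' by (rule order.trans[OF norm_triangle_ineq4 add_right_mono[OF norm_triangle_ineq]])
      also have "\<dots> \<le> B1 * exp (- (norm x)\<^sup>2 / 4) + B2 * exp (- (norm x)\<^sup>2 / 4) + B3 * exp (- (norm x)\<^sup>2 / 4)"
        by (intro add_mono B1 B2 B3)
      also have "\<dots> \<le> (A + B1 + B2 + B3) * exp (- (norm x)\<^sup>2 / 4)"
        using A(1) by (simp add: distrib_right)
      finally show ?thesis .
    qed
  qed simp
  then show ?thesis unfolding F'
    using gauss_dot_integrable[OF Di Q(1)] gauss_dot_integrable[OF P(1) Ei] gauss_dot_integrable[OF P(1) xQ]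
    by simp
qed

lemma is_gradient_cl_mult:
  assumes "is_gradient k P D" "cl_real a"
  shows "is_gradient k (\<lambda>x. a \<odot> P x) (\<lambda>i x. a \<odot> D i x)"
proof -
  note D = is_gradientD[OF assms(1)]
  have "if k = 0 then (\<lambda>x. a \<odot> D i x) = (\<lambda>x. 0) else hpoly (k - 1) (\<lambda>x. a \<odot> D i x)" for i
    using D(1)[of i] by (cases "k = 0") (simp_all add: hpoly_cl_mult assms(2))
  moreover have "((\<lambda>x. a \<odot> P x) has_derivative (\<lambda>h. \<Sum>i\<in>UNIV. (h $ i) *\<^sub>R (a \<odot> D i x))) (at x)" for x
  proof -
    have "((\<lambda>x. a \<odot> P x) has_derivative (\<lambda>h. a \<odot> (\<Sum>i\<in>UNIV. (h $ i) *\<^sub>R D i x))) (at x)"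
      by (rule bounded_linear.has_derivative[OF bounded_bilinear.bounded_linear_right[OF bounded_bilinear_cl_mult] D(2)])
    then show ?thesis by (simp add: cl_mult_sum_right cl_mult_scaleR_right)
  qed
  moreover have "(\<Sum>i\<in>UNIV. (x $ i) *\<^sub>R (a \<odot> D i x)) = real k *\<^sub>R (a \<odot> P x)" for x
    using arg_cong[OF D(3), of "\<lambda>b. a \<odot> b" x] by (simp only: cl_mult_sum_right cl_mult_scaleR_right)
  ultimately show ?thesis unfolding is_gradient_def by blast
qed

text \<open>Integration by parts in each coordinate, applied to \<open>e_i Q\<close>; since
  \<open>e_i\<close> is skew-Hermitian, the Dirac operator is symmetric for the Gaussian inner
  product up to multiplication by \<open>x\<close>.\<close>

lemma gauss_dot_dirac:
  fixes P Q :: "'m::{finite,linorder} cl_fun"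
  assumes P: "hpoly k P" and Q: "hpoly l Q"
  shows "(\<integral>x. gauss_dot P (dirac Q) x \<partial>lborel) - (\<integral>x. gauss_dot (dirac P) Q x \<partial>lborel)
     = (\<integral>x. gauss_dot P (\<lambda>x. cl_vec x \<odot> Q x) x \<partial>lborel)"
proof -
  obtain D where D: "is_gradient k P D" using hpoly_derivative[OF P] by blast
  obtain E where E: "is_gradient l Q E" using hpoly_derivative[OF Q] by blast
  have Di: "\<exists>j. hpoly j (D i)" and Ei: "\<exists>j. hpoly j (E i)" for i
    using is_gradient_hpoly[OF D] is_gradient_hpoly[OF E] by auto
  have g: "hpoly j R \<Longrightarrow> hpoly j (\<lambda>x. cl_gen i \<odot> R x)" for i j and R :: "'m cl_fun"
    by (rule hpoly_cl_mult[OF _ cl_real_blade])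
  have i1: "integrable lborel (gauss_dot (D i) (\<lambda>x. cl_gen i \<odot> Q x))" for i
    using Di[of i] g[OF Q] gauss_dot_integrable by blast
  have i2: "integrable lborel (gauss_dot P (\<lambda>x. cl_gen i \<odot> E i x))" for i
    using Ei[of i] g P gauss_dot_integrable by blast
  have i3: "integrable lborel (gauss_dot P (\<lambda>x. (x $ i) *\<^sub>R (cl_gen i \<odot> Q x)))" for i
    using hpoly_coord[OF g[OF Q]] P gauss_dot_integrable by blast
  have "(\<integral>x. gauss_dot (D i) (\<lambda>x. cl_gen i \<odot> Q x) x \<partial>lborel) + (\<integral>x. gauss_dot P (\<lambda>x. cl_gen i \<odot> E i x) x \<partial>lborel)
     = (\<integral>x. gauss_dot P (\<lambda>x. (x $ i) *\<^sub>R (cl_gen i \<odot> Q x)) x \<partial>lborel)" for i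
    by (rule gauss_dot_partial[OF P D g[OF Q] is_gradient_cl_mult[OF E cl_real_blade]])
  then have "(\<Sum>i\<in>UNIV. (\<integral>x. gauss_dot (D i) (\<lambda>x. cl_gen i \<odot> Q x) x \<partial>lborel))
      + (\<Sum>i\<in>UNIV. (\<integral>x. gauss_dot P (\<lambda>x. cl_gen i \<odot> E i x) x \<partial>lborel))
     = (\<Sum>i\<in>UNIV. (\<integral>x. gauss_dot P (\<lambda>x. (x $ i) *\<^sub>R (cl_gen i \<odot> Q x)) x \<partial>lborel))"
    by (simp only: sum.distrib[symmetric])
  moreover have "(\<Sum>i\<in>UNIV. (\<integral>x. gauss_dot (D i) (\<lambda>x. cl_gen i \<odot> Q x) x \<partial>lborel)) = - (\<integral>x. gauss_dot (dirac P) Q x \<partial>lborel)"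
  proof -
    have "(\<Sum>i\<in>UNIV. gauss_dot (D i) (\<lambda>x. cl_gen i \<odot> Q x) x) = - gauss_dot (dirac P) Q x" for x
      unfolding gauss_dot_def dirac_has_derivative[OF is_gradientD(2)[OF D]] hdot_sum_left hdot_gen
      by (simp add: sum_negf scaleR_sum_right)
    then show ?thesis by (subst Bochner_Integration.integral_sum[symmetric]) (simp_all add: i1)
  qed
  moreover have "(\<Sum>i\<in>UNIV. (\<integral>x. gauss_dot P (\<lambda>x. cl_gen i \<odot> E i x) x \<partial>lborel)) = (\<integral>x. gauss_dot P (dirac Q) x \<partial>lborel)"
  proof -
    have "(\<Sum>i\<in>UNIV. gauss_dot P (\<lambda>x. cl_gen i \<odot> E i x) x) = gauss_dot P (dirac Q) x" for x
      unfolding gauss_dot_def dirac_has_derivative[OF is_gradientD(2)[OF E]] hdot_sum_right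
      by (simp add: scaleR_sum_right)
    then show ?thesis by (subst Bochner_Integration.integral_sum[symmetric]) (simp_all add: i2)
  qed
  moreover have "(\<Sum>i\<in>UNIV. (\<integral>x. gauss_dot P (\<lambda>x. (x $ i) *\<^sub>R (cl_gen i \<odot> Q x)) x \<partial>lborel))
     = (\<integral>x. gauss_dot P (\<lambda>x. cl_vec x \<odot> Q x) x \<partial>lborel)"
  proof -
    have "(\<Sum>i\<in>UNIV. gauss_dot P (\<lambda>x. (x $ i) *\<^sub>R (cl_gen i \<odot> Q x)) x) = gauss_dot P (\<lambda>x. cl_vec x \<odot> Q x) x" for x
      unfolding gauss_dot_def cl_vec_mult hdot_sum_right
      by (simp add: scaleR_sum_right)
    then show ?thesis by (subst Bochner_Integration.integral_sum[symmetric]) (simp_all add: i3)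
  qed
  ultimately show ?thesis by simp
qed

lemma gauss_dot_monogenic_cl_vec:
  assumes M: "hpoly k M" "\<And>x. dirac M x = 0" and N: "hpoly l N" "\<And>x. dirac N x = 0"
  shows "(\<integral>x. gauss_dot M (\<lambda>x. cl_vec x \<odot> N x) x \<partial>lborel) = 0"
proof -
  have "dirac M = (\<lambda>x. 0)" "dirac N = (\<lambda>x. 0)" using M N by auto
  then have "gauss_dot M (dirac N) = (\<lambda>x. 0)" "gauss_dot (dirac M) N = (\<lambda>x. 0)"
    by (auto simp: gauss_dot_def)
  with gauss_dot_dirac[OF M(1) N(1)] show ?thesis by simp
qed

text \<open>The integral \<open>J\<close> of \<open>r^2\<close> times the pairing is computed twice,
  through \<open>dirac (x N) = - (m + 2 l) N\<close> and through
  \<open>dirac (x M) = - (m + 2 k) M\<close>. This gives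
  \<open>J = (m + 2 l) I = (m + 2 k) I\<close>, so \<open>I\<close> vanishes for different
  degrees.\<close>

lemma gauss_dot_monogenic_degrees:
  fixes M N :: "'m::{finite,linorder} cl_fun"
  assumes M: "hpoly k M" "\<And>x. dirac M x = 0" and N: "hpoly l N" "\<And>x. dirac N x = 0" and "k \<noteq> l"
  shows "(\<integral>x. gauss_dot M N x \<partial>lborel) = 0"
proof -
  let ?m = "real CARD('m)"
  let ?I = "\<integral>x. gauss_dot M N x \<partial>lborel"
  define J where "J = (\<integral>x. (norm x)\<^sup>2 *\<^sub>R gauss_dot M N x \<partial>lborel)"
  have dM: "dirac M = (\<lambda>x. 0)" and dN: "dirac N = (\<lambda>x. 0)" using M N by auto
  have dxM: "dirac (\<lambda>x. cl_vec x \<odot> M x) = (\<lambda>x. - ((?m + 2 * real k) *\<^sub>R M x))"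
    and dxN: "dirac (\<lambda>x. cl_vec x \<odot> N x) = (\<lambda>x. - ((?m + 2 * real l) *\<^sub>R N x))"
    by (simp_all add: fun_eq_iff dirac_cl_vec_mult[OF M(1)] dirac_cl_vec_mult[OF N(1)] M(2) N(2))
  have "of_real (- (?m + 2 * real l)) * ?I = - J"
  proof -
    have "gauss_dot M (dirac (\<lambda>x. cl_vec x \<odot> N x)) = (\<lambda>x. of_real (- (?m + 2 * real l)) * gauss_dot M N x)"
      "gauss_dot (dirac M) (\<lambda>x. cl_vec x \<odot> N x) = (\<lambda>x. 0)"
      "gauss_dot M (\<lambda>x. cl_vec x \<odot> (cl_vec x \<odot> N x)) = (\<lambda>x. - ((norm x)\<^sup>2 *\<^sub>R gauss_dot M N x))"
      by (simp_all add: fun_eq_iff gauss_dot_def dM dxN cl_vec_cl_vec hdot_minus_right hdot_scaleR_right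
          scaleR_complex_conv)
        (simp_all add: algebra_simps)
    with gauss_dot_dirac[OF M(1) hpoly_cl_vec[OF N(1)]] show ?thesis by (simp add: J_def)
  qed
  moreover have "of_real (?m + 2 * real k) * ?I = J"
  proof -
    have "gauss_dot (dirac (\<lambda>x. cl_vec x \<odot> M x)) N = (\<lambda>x. of_real (- (?m + 2 * real k)) * gauss_dot M N x)"
      "gauss_dot (\<lambda>x. cl_vec x \<odot> M x) (dirac N) = (\<lambda>x. 0)"
      "gauss_dot (\<lambda>x. cl_vec x \<odot> M x) (\<lambda>x. cl_vec x \<odot> N x) = (\<lambda>x. (norm x)\<^sup>2 *\<^sub>R gauss_dot M N x)"
      by (simp_all add: fun_eq_iff gauss_dot_def dN dxM hdot_cl_vec_cl_vec hdot_minus_left hdot_scaleR_left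
          scaleR_complex_conv)
        (simp_all add: algebra_simps)
    with gauss_dot_dirac[OF hpoly_cl_vec[OF M(1)] N(1)]
    have "- ((- of_nat CARD('m) - 2 * of_nat k) * ?I) = J" by (simp add: J_def)
    then show ?thesis by (simp add: algebra_simps)
  qed
  ultimately have "of_real (2 * (real k - real l)) * ?I = 0"
    by (simp add: algebra_simps)
  then show ?thesis using \<open>k \<noteq> l\<close> by simp
qed

text \<open>In polar coordinates the Gaussian integral is the spherical one times a radial Gamma
  integral, which is positive.\<close>

lemma sphere_integral_zero_iff:
  fixes P Q :: "'m::{finite,linorder} cl_fun"
  assumes P: "hpoly k P" and Q: "hpoly l Q"
  shows "(\<integral>x. gauss_dot P Q x \<partial>lborel) = 0 \<longleftrightarrow> (\<integral>x. hdot (P x) (Q x) \<partial>sphere_measure) = 0"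
proof -
  let ?a = "real CARD('m) / 2 - 1 + real (k + l) / 2"
  have "0 < real CARD('m)" by simp
  then have a: "?a > - 1" by (simp add: add_pos_nonneg field_simps del: zero_less_card_finite)
  note G = radial_gamma[OF a, of "1/2"]
  have i: "integrable (radial_measure CARD('m)) (\<lambda>s. s powr (real (k + l) / 2) * exp (- (1/2) * s) * 1)"
    by (rule radial_measure_lag_mean(1)[THEN iffD2]) (use integrable.intros[OF G] in \<open>simp_all cong: if_cong\<close>)
  have v: "(\<integral>s. s powr (real (k + l) / 2) * exp (- (1/2) * s) * 1 \<partial>radial_measure CARD('m)) = Gamma (?a + 1) / (1/2) powr (?a + 1) / 2"
    using has_bochner_integral_integral_eq[OF G]
    by (subst radial_measure_lag_mean(2)) (simp_all add: lag_mean_def cong: if_cong)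
  have "Gamma (?a + 1) > 0" using a by (intro Gamma_real_pos) simp
  then have v0: "(\<integral>s. s powr (real (k + l) / 2) * exp (- (1/2) * s) * 1 \<partial>radial_measure CARD('m)) \<noteq> 0"
    unfolding v by simp
  have "(\<integral>x. gauss_dot P Q x \<partial>lborel) = (\<integral>x. exp (- (1/2) * (norm x)\<^sup>2) *\<^sub>R hdot (P x) (Q x) \<partial>lborel)"
    by (simp add: gauss_dot_def)
  also have "\<dots> = (\<integral>s. s powr (real (k + l) / 2) * exp (- (1/2) * s) \<partial>radial_measure CARD('m)) *\<^sub>R (\<integral>x. hdot (P x) (Q x) \<partial>sphere_measure)"
    by (rule polar_homogeneous(2))
      (use i in \<open>auto intro!: continuous_hdot hpoly_continuous[OF P] hpoly_continuous[OF Q] hpoly_hdot_homogeneous[OF P Q]\<close>)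
  finally show ?thesis using v0 by simp
qed

theorem sphere_orthogonal:
  assumes M: "hpoly k M" "\<And>x. dirac M x = 0" and N: "hpoly l N" "\<And>x. dirac N x = 0"
  shows "k \<noteq> l \<Longrightarrow> (\<integral>x. hdot (M x) (N x) \<partial>sphere_measure) = 0"
    and "(\<integral>x. hdot (M x) (cl_vec x \<odot> N x) \<partial>sphere_measure) = 0"
    and "(\<integral>x. hdot (cl_vec x \<odot> M x) (cl_vec x \<odot> N x) \<partial>sphere_measure) = (\<integral>x. hdot (M x) (N x) \<partial>sphere_measure)"
proof -
  show "k \<noteq> l \<Longrightarrow> (\<integral>x. hdot (M x) (N x) \<partial>sphere_measure) = 0"
    using gauss_dot_monogenic_degrees[OF M N] sphere_integral_zero_iff[OF M(1) N(1)] by simp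
  show "(\<integral>x. hdot (M x) (cl_vec x \<odot> N x) \<partial>sphere_measure) = 0"
    using gauss_dot_monogenic_cl_vec[OF M N] sphere_integral_zero_iff[OF M(1) hpoly_cl_vec[OF N(1)]] by simp
  have [measurable]: "M \<in> borel_measurable borel" "N \<in> borel_measurable borel"
    "(\<lambda>x. cl_vec x \<odot> M x) \<in> borel_measurable borel" "(\<lambda>x. cl_vec x \<odot> N x) \<in> borel_measurable borel"
    using M N hpoly_measurable hpoly_cl_vec by blast+
  show "(\<integral>x. hdot (cl_vec x \<odot> M x) (cl_vec x \<odot> N x) \<partial>sphere_measure) = (\<integral>x. hdot (M x) (N x) \<partial>sphere_measure)"
  proof (rule integral_cong_AE)
    show "AE x in sphere_measure. hdot (cl_vec x \<odot> M x) (cl_vec x \<odot> N x) = hdot (M x) (N x)"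
      using AE_sphere_measure_norm by eventually_elim (simp add: hdot_cl_vec_cl_vec)
  qed measurable
qed

section \<open>The orthonormal systems\<close>

definition wmeas :: "real \<Rightarrow> (real, 'm::{finite,linorder}) vec measure" where
  "wmeas c = density lborel (\<lambda>x. ennreal (weight c x))"

definition wexp :: "'m::finite itself \<Rightarrow> real \<Rightarrow> real" where
  "wexp _ c = 1 - (1 + real CARD('m) * c) / (1 + c)"

lemma weight_eq: "weight c (x :: real ^ 'm) = norm x powr wexp TYPE('m) c"
  by (simp add: weight_def wexp_def)

lemma weight_nonneg [simp]: "0 \<le> weight c x"
  by (simp add: weight_def)

lemma weight_measurable [measurable]: "weight c \<in> borel_measurable borel"
  unfolding weight_def[abs_def] by measurable

lemma sets_wmeas [simp, measurable_cong]: "sets (wmeas c) = sets borel"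
  by (simp add: wmeas_def)

lemma borel_measurable_wmeas [simp]: "borel_measurable (wmeas c) = borel_measurable borel"
  by (rule measurable_cong_sets) simp_all

lemma AE_wmeas:
  fixes P :: "(real, 'm::{finite,linorder}) vec \<Rightarrow> bool"
  shows "(AE x in wmeas c. P x) \<longleftrightarrow> (AE x in lborel. P x)"
proof -
  have "(AE x in wmeas c. P x) \<longleftrightarrow> (AE x in lborel. 0 < weight c x \<longrightarrow> P x)"
    unfolding wmeas_def by (subst AE_density) auto
  also have "\<dots> \<longleftrightarrow> (AE x in lborel. P x)"
  proof
    assume "AE x in lborel. 0 < weight c x \<longrightarrow> P x"
    then show "AE x in lborel. P x"
      using AE_lborel_nonzero by eventually_elim (auto simp: weight_def)
  qed auto
  finally show ?thesis .
qed

lemma integral_wmeas: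
  fixes f :: "(real, 'm::{finite,linorder}) vec \<Rightarrow> 'b::{banach, second_countable_topology}"
  assumes [measurable]: "f \<in> borel_measurable borel"
  shows "integrable (wmeas c) f \<longleftrightarrow> integrable lborel (\<lambda>x. weight c x *\<^sub>R f x)"
    and "(\<integral>x. f x \<partial>wmeas c) = (\<integral>x. weight c x *\<^sub>R f x \<partial>lborel)"
  unfolding wmeas_def by (subst integrable_density integral_density; simp)+

lemma norm_vec_squared: "(norm (a :: complex ^ 'n))\<^sup>2 = (\<Sum>i\<in>UNIV. (cmod (a $ i))\<^sup>2)"
  by (simp add: norm_vec_def L2_set_def sum_nonneg)

lemma L2_eq_sq_int: "L2 c = sq_int (wmeas c)"
proof -
  have "(\<forall>A. integrable lborel (\<lambda>x. (cmod (f x $ A))\<^sup>2 * weight c x)) \<longleftrightarrow> integrable (wmeas c) (\<lambda>x. (norm (f x))\<^sup>2)"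
    if [measurable]: "f \<in> borel_measurable borel" for f :: "'a cl_fun"
  proof -
    have [measurable]: "(\<lambda>x. f x $ A) \<in> borel_measurable borel" for A
      using borel_measurable_continuous_on[OF continuous_on_component[OF continuous_on_id] that] by simp
    have eq: "weight c x *\<^sub>R (norm (f x))\<^sup>2 = (\<Sum>A\<in>UNIV. (cmod (f x $ A))\<^sup>2 * weight c x)" for x
      by (simp add: norm_vec_squared sum_distrib_left mult.commute)
    have "integrable (wmeas c) (\<lambda>x. (norm (f x))\<^sup>2) \<longleftrightarrow> integrable lborel (\<lambda>x. \<Sum>A\<in>UNIV. (cmod (f x $ A))\<^sup>2 * weight c x)"
      by (subst integral_wmeas(1)) (simp_all only: eq, measurable)
    also have "\<dots> \<longleftrightarrow> (\<forall>A. integrable lborel (\<lambda>x. (cmod (f x $ A))\<^sup>2 * weight c x))"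
    proof
      assume i: "integrable lborel (\<lambda>x. \<Sum>A\<in>UNIV. (cmod (f x $ A))\<^sup>2 * weight c x)"
      show "\<forall>A. integrable lborel (\<lambda>x. (cmod (f x $ A))\<^sup>2 * weight c x)"
      proof
        fix A
        show "integrable lborel (\<lambda>x. (cmod (f x $ A))\<^sup>2 * weight c x)"
        proof (rule Bochner_Integration.integrable_bound[OF i])
          have "(cmod (f x $ A))\<^sup>2 * weight c x \<le> (\<Sum>A\<in>UNIV. (cmod (f x $ A))\<^sup>2 * weight c x)" for x
            by (rule member_le_sum) auto
          then show "AE x in lborel. norm ((cmod (f x $ A))\<^sup>2 * weight c x) \<le> norm (\<Sum>A\<in>UNIV. (cmod (f x $ A))\<^sup>2 * weight c x)"
            by (auto simp: sum_nonneg intro!: AE_I2)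
        qed measurable
      qed
    qed (auto intro: Bochner_Integration.integrable_sum)
    finally show ?thesis ..
  qed
  then show ?thesis by (auto simp: L2_def sq_int_def)
qed

lemma L2_inner_eq_iprod:
  fixes f g :: "'m::{finite,linorder} cl_fun"
  assumes "f \<in> L2 c" "g \<in> L2 c"
  shows "L2_inner c f g = iprod (wmeas c) f g"
proof -
  have [measurable]: "f \<in> borel_measurable borel" "g \<in> borel_measurable borel"
    using assms by (auto simp: L2_def)
  note fg = assms[unfolded L2_eq_sq_int]
  let ?h = "\<lambda>x. cl_bar (cl_cnj (f x)) \<odot> g x"
  have cc: "continuous_on UNIV (\<lambda>p :: 'm clifford \<times> 'm clifford. cl_bar (cl_cnj (fst p)) \<odot> snd p)"
  proof (intro bounded_bilinear.continuous_on[OF bounded_bilinear_cl_mult])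
    show "continuous_on UNIV (\<lambda>p :: 'm clifford \<times> 'm clifford. cl_bar (cl_cnj (fst p)))"
      unfolding cl_bar_def cl_cnj_def vec_lambda_beta by (intro continuous_intros)
  qed (intro continuous_intros)
  have [measurable]: "?h \<in> borel_measurable borel"
    using borel_measurable_continuous_on[OF cc, of "\<lambda>x. (f x, g x)" borel]
    by (simp add: borel_prod[symmetric])
  obtain K where K: "K > 0" "\<And>a b. norm (a \<odot> b :: 'm clifford) \<le> norm a * norm b * K"
    using bounded_bilinear.pos_bounded[OF bounded_bilinear_cl_mult] by blast
  have bar: "norm (cl_bar (cl_cnj a)) = norm a" for a :: "'m clifford"
    by (simp add: norm_vec_def cl_bar_def cl_cnj_def norm_mult norm_power)
  \<comment> \<open>Taking the scalar part commutes with the integral because the Clifford-valued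
    integrand is itself integrable.\<close>
  have i: "integrable (wmeas c) ?h"
  proof (rule Bochner_Integration.integrable_bound)
    show "integrable (wmeas c) (\<lambda>x. K * ((norm (f x))\<^sup>2 + (norm (g x))\<^sup>2))"
      using fg[THEN sq_int_integrable] by simp
    have "norm (?h x) \<le> norm (K * ((norm (f x))\<^sup>2 + (norm (g x))\<^sup>2))" for x
    proof -
      have "norm (?h x) \<le> norm (f x) * norm (g x) * K"
        using K(2)[of "cl_bar (cl_cnj (f x))" "g x"] by (simp add: bar)
      also have "\<dots> \<le> ((norm (f x))\<^sup>2 + (norm (g x))\<^sup>2) * K"
      proof (rule mult_right_mono)
        have "2 * (norm (f x) * norm (g x)) \<le> (norm (f x))\<^sup>2 + (norm (g x))\<^sup>2"
          using zero_le_power2[of "norm (f x) - norm (g x)"] unfolding power2_diff by simp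
        moreover have "0 \<le> norm (f x) * norm (g x)" by simp
        ultimately show "norm (f x) * norm (g x) \<le> (norm (f x))\<^sup>2 + (norm (g x))\<^sup>2" by linarith
      qed (use K in simp)
      finally show ?thesis using K by (simp add: mult.commute)
    qed
    then show "AE x in wmeas c. norm (?h x) \<le> norm (K * ((norm (f x))\<^sup>2 + (norm (g x))\<^sup>2))" by simp
  qed simp
  have "L2_inner c f g = cl_scalar (\<integral>x. ?h x \<partial>wmeas c)"
    unfolding L2_inner_def by (subst integral_wmeas(2)) simp_all
  also have "\<dots> = (\<integral>x. cl_scalar (?h x) \<partial>wmeas c)"
    unfolding cl_scalar_def
    by (rule integral_bounded_linear[OF bounded_linear_vec_nth i, symmetric])
  finally show ?thesis by (simp add: cl_scalar_bar_cnj iprod_def)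
qed

lemma L2_norm_eq:
  assumes "f \<in> L2 c"
  shows "L2_norm c f = ennreal (sqrt (nsq (wmeas c) f))"
  using assms by (simp add: L2_norm_def L2_inner_eq_iprod iprod_self)

text \<open>Common shape of both orthonormal systems, of the monomials in \<open>r^2\<close> used
  for completeness and of Gaussians, so that a single computation in polar coordinates gives all
  inner products.\<close>

definition gfun ::
    "real \<Rightarrow> real \<Rightarrow> (real \<Rightarrow> real) \<Rightarrow> 'm::{finite,linorder} cl_fun \<Rightarrow> 'm cl_fun" where
  "gfun b y p S x = (norm x powr b * exp (- y * (norm x)\<^sup>2) * p ((norm x)\<^sup>2)) *\<^sub>R S x"

lemma gfun_measurable:
  assumes "hpoly k S" and [measurable]: "p \<in> borel_measurable borel"
  shows "gfun b y p S \<in> borel_measurable borel"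
proof -
  have [measurable]: "S \<in> borel_measurable borel" by (rule hpoly_measurable[OF assms(1)])
  show ?thesis unfolding gfun_def[abs_def] by measurable
qed

text \<open>Identifies \<open>delta\<close> as the effective dimension: the dimension of the space
  plus the exponent of the weight. Radial integrals in \<open>s = r^2\<close> therefore carry the
  exponent \<open>\<delta> / 2 - 1\<close>.\<close>

lemma delta_wexp:
  assumes "c > -1"
  shows "real CARD('m) / 2 + wexp TYPE('m) c / 2 = delta TYPE('m::finite) c / 2"
  using assms by (simp add: wexp_def delta_def field_simps)

lemma delta_pos:
  assumes "c > -1"
  shows "delta TYPE('m::finite) c > 0"
proof -
  have "real CARD('m) \<ge> 1" by (simp add: Suc_leI)
  then show ?thesis using assms by (simp add: delta_def add_pos_nonneg)
qed

text \<open>Polar coordinates separate the variables. In \<open>a\<close> the term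
  \<open>\<delta> / 2 - 1\<close> comes from volume and weight; homogeneity degrees and radial
  powers count half because the variable is \<open>r^2\<close>.\<close>

lemma gfun_iprod:
  fixes S S' :: "'m::{finite,linorder} cl_fun"
  assumes c: "c > -1" and S: "hpoly k S" and S': "hpoly k' S'"
    and [measurable]: "p \<in> borel_measurable borel" "p' \<in> borel_measurable borel"
    and a: "a = delta TYPE('m) c / 2 - 1 + (real k + real k' + b + b') / 2"
    and i: "integrable lborel (\<lambda>s. if s > 0 then s powr a * exp (- (y + y') * s) * (p s * p' s) else 0)"
  shows "integrable lborel (\<lambda>x. weight c x *\<^sub>R hdot (gfun b y p S x) (gfun b' y' p' S' x))" (is ?i)
    and "iprod (wmeas c) (gfun b y p S) (gfun b' y' p' S')
      = of_real (lag_mean a (y + y') (\<lambda>s. p s * p' s) / 2) * (\<integral>x. hdot (S x) (S' x) \<partial>sphere_measure)" (is ?e)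
proof -
  define w where "w = wexp TYPE('m) c + b + b'"
  define g where "g s = s powr (w / 2) * exp (- (y + y') * s) * (p s * p' s)" for s
  have g [measurable]: "g \<in> borel_measurable borel" unfolding g_def by measurable
  have a': "real CARD('m) / 2 - 1 + (real (k + k') / 2 + w / 2) = a"
    using delta_wexp[OF c, where 'm = 'm] by (simp add: a w_def add_divide_distrib)
  have sg: "s powr (real (k + k') / 2) * g s = s powr (real (k + k') / 2 + w / 2) * exp (- (y + y') * s) * (p s * p' s)" for s
    by (simp add: g_def powr_add)
  have ig: "integrable (radial_measure CARD('m)) (\<lambda>s. s powr (real (k + k') / 2) * g s)"
    unfolding sg by (rule radial_measure_lag_mean(1)[THEN iffD2]) (simp, simp only: a' i)
  have eg: "(\<integral>s. s powr (real (k + k') / 2) * g s \<partial>radial_measure CARD('m)) = lag_mean a (y + y') (\<lambda>s. p s * p' s) / 2"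
    unfolding sg by (subst radial_measure_lag_mean(2)) (simp, simp only: a')
  have pt: "weight c x *\<^sub>R hdot (gfun b y p S x) (gfun b' y' p' S' x) = g ((norm x)\<^sup>2) *\<^sub>R hdot (S x) (S' x)" for x :: "(real, 'm) vec"
  proof -
    have "((norm x)\<^sup>2) powr (w / 2) = norm x powr w"
      by (cases "x = 0") (simp_all add: powr_powr flip: powr_numeral)
    moreover have "exp (- (y + y') * (norm x)\<^sup>2) = exp (- y * (norm x)\<^sup>2) * exp (- y' * (norm x)\<^sup>2)"
      by (simp add: exp_add[symmetric] algebra_simps)
    ultimately show ?thesis
      by (simp add: weight_eq gfun_def hdot_scaleR_left hdot_scaleR_right scaleR_complex_conv g_def w_def
          powr_add mult_ac del: mult_minus_left)
  qed
  note P = polar_homogeneous[of "\<lambda>x. hdot (S x) (S' x)" "k + k'" g, OF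
      continuous_hdot[OF hpoly_continuous[OF S] hpoly_continuous[OF S']] hpoly_hdot_homogeneous[OF S S'] g ig]
  show ?i unfolding pt by (rule P(1))
  have [measurable]: "gfun b y p S \<in> borel_measurable borel" "gfun b' y' p' S' \<in> borel_measurable borel"
    by (rule gfun_measurable[OF S] gfun_measurable[OF S'], measurable)+
  have "iprod (wmeas c) (gfun b y p S) (gfun b' y' p' S') = (\<integral>x. g ((norm x)\<^sup>2) *\<^sub>R hdot (S x) (S' x) \<partial>lborel)"
    unfolding iprod_def pt[symmetric] by (subst integral_wmeas(2)) simp_all
  then show ?e using P(2) unfolding eg by (simp only: scaleR_complex_conv)
qed

lemma gfun_L2:
  fixes S :: "'m::{finite,linorder} cl_fun"
  assumes c: "c > -1" and S: "hpoly k S" and [measurable]: "p \<in> borel_measurable borel"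
    and a: "a = delta TYPE('m) c / 2 - 1 + (real k + b)"
    and i: "integrable lborel (\<lambda>s. if s > 0 then s powr a * exp (- (y + y) * s) * (p s * p s) else 0)"
  shows "gfun b y p S \<in> L2 c"
proof -
  have m [measurable]: "gfun b y p S \<in> borel_measurable borel" by (rule gfun_measurable[OF S]) measurable
  have "integrable lborel (\<lambda>x. weight c x *\<^sub>R hdot (gfun b y p S x) (gfun b y p S x))"
    by (rule gfun_iprod(1)[OF c S S _ _ _ i]) (use a in simp_all)
  then have "integrable lborel (\<lambda>x. Re (weight c x *\<^sub>R hdot (gfun b y p S x) (gfun b y p S x)))"
    by (rule integrable_Re)
  then have "integrable lborel (\<lambda>x. weight c x *\<^sub>R (norm (gfun b y p S x))\<^sup>2)"
    by (simp add: hdot_self flip: of_real_power)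
  then show ?thesis
    unfolding L2_eq_sq_int sq_int_def by (subst (asm) integral_wmeas(1)[symmetric]) simp_all
qed

text \<open>Polynomials of mixed degree, the link between \<open>polynomial_function\<close> and
  \<open>hpoly\<close>.\<close>

inductive hsum :: "'m::{finite,linorder} cl_fun \<Rightarrow> bool" where
  hsum_hpoly: "hpoly k P \<Longrightarrow> hsum P"
| hsum_add: "hsum P \<Longrightarrow> hsum Q \<Longrightarrow> hsum (\<lambda>x. P x + Q x)"

lemma hsum_coord: "hsum P \<Longrightarrow> hsum (\<lambda>x. (x $ i) *\<^sub>R P x)"
proof (induction rule: hsum.induct)
  case (hsum_add P Q)
  from hsum.hsum_add[OF hsum_add.IH] show ?case by (simp add: scaleR_add_right)
qed (auto intro: hsum_hpoly hpoly_coord)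

lemma hsum_scaleR: "hsum P \<Longrightarrow> hsum (\<lambda>x. r *\<^sub>R P x)"
proof (induction rule: hsum.induct)
  case (hsum_add P Q)
  from hsum.hsum_add[OF hsum_add.IH] show ?case by (simp add: scaleR_add_right)
qed (auto intro: hsum_hpoly hpoly_scaleR)

lemma hsum_sum: "(\<And>i. i \<in> I \<Longrightarrow> hsum (P i)) \<Longrightarrow> hsum (\<lambda>x. \<Sum>i\<in>I. P i x)"
  by (induction I rule: infinite_finite_induct) (auto intro: hsum_add hsum_hpoly hpoly_zero)

lemma hsum_real_polynomial_mult:
  fixes p :: "(real, 'm::{finite,linorder}) vec \<Rightarrow> real"
  shows "real_polynomial_function p \<Longrightarrow> hsum P \<Longrightarrow> hsum (\<lambda>x. p x *\<^sub>R P x)"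
proof (induction arbitrary: P rule: real_polynomial_function.induct)
  case (linear p)
  have pe: "p x = (\<Sum>i\<in>UNIV. (x $ i) * p (axis i 1))" for x
  proof -
    have "(\<Sum>i\<in>UNIV. (x $ i) *\<^sub>R axis i 1) = x"
      by (simp only: basis_expansion scalar_mult_eq_scaleR[symmetric])
    then have "p x = p (\<Sum>i\<in>UNIV. (x $ i) *\<^sub>R axis i 1)" by (rule arg_cong[OF sym])
    also have "\<dots> = (\<Sum>i\<in>UNIV. (x $ i) * p (axis i 1))"
      using bounded_linear.linear[OF linear.hyps] by (simp add: linear_sum linear_scale)
    finally show ?thesis .
  qed
  have "(\<lambda>x. p x *\<^sub>R P x) = (\<lambda>x. \<Sum>i\<in>UNIV. (x $ i) *\<^sub>R (p (axis i 1) *\<^sub>R P x))"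
  proof
    show "p x *\<^sub>R P x = (\<Sum>i\<in>UNIV. (x $ i) *\<^sub>R (p (axis i 1) *\<^sub>R P x))" for x
      by (subst pe[of x]) (simp only: scaleR_sum_left scaleR_scaleR)
  qed
  moreover have "hsum (\<lambda>x. \<Sum>i\<in>UNIV. (x $ i) *\<^sub>R (p (axis i 1) *\<^sub>R P x))"
    by (intro hsum_sum hsum_coord hsum_scaleR linear.prems)
  ultimately show ?case by (simp only:)
next
  case (add f g)
  from hsum_add[OF add.IH(1)[OF add.prems] add.IH(2)[OF add.prems]] show ?case
    by (simp add: scaleR_add_left)
next
  case (mult f g)
  from mult.IH(1)[OF mult.IH(2)[OF mult.prems]] show ?case by simp
qed (rule hsum_scaleR)

lemma hsum_decomposition:
  "hsum P \<Longrightarrow> \<exists>K Q. (\<forall>k. hpoly k (Q k)) \<and> (\<forall>k>K. Q k = (\<lambda>x. 0)) \<and> P = (\<lambda>x. \<Sum>k\<le>K. Q k x)"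
proof (induction rule: hsum.induct)
  case (hsum_hpoly k P)
  have "hpoly j (if j = k then P else (\<lambda>x. 0))" for j
    using hsum_hpoly hpoly_zero by (cases "j = k") simp_all
  moreover have "P = (\<lambda>x. \<Sum>j\<le>k. (if j = k then P else (\<lambda>x. 0)) x)"
    by (simp add: fun_eq_iff if_distribR)
  moreover have "j > k \<longrightarrow> (if j = k then P else (\<lambda>x. 0)) = (\<lambda>x. 0)" for j by simp
  ultimately show ?case
    by (intro exI[of _ k] exI[of _ "\<lambda>j. if j = k then P else (\<lambda>x. 0)"] conjI allI)
next
  case (hsum_add P P')
  then obtain K Q K' Q' where Q: "\<And>k. hpoly k (Q k)" "\<And>k. k > K \<Longrightarrow> Q k = (\<lambda>x. 0)" "P = (\<lambda>x. \<Sum>k\<le>K. Q k x)"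
    and Q': "\<And>k. hpoly k (Q' k)" "\<And>k. k > K' \<Longrightarrow> Q' k = (\<lambda>x. 0)" "P' = (\<lambda>x. \<Sum>k\<le>K'. Q' k x)" by auto
  have "(\<Sum>k\<le>K. Q k x) = (\<Sum>k\<le>max K K'. Q k x)" "(\<Sum>k\<le>K'. Q' k x) = (\<Sum>k\<le>max K K'. Q' k x)" for x
    by (rule sum.mono_neutral_left, use Q(2) Q'(2) in auto)+
  then have "(\<lambda>x. P x + P' x) = (\<lambda>x. \<Sum>k\<le>max K K'. (Q k x + Q' k x))"
    unfolding Q(3) Q'(3) by (simp add: sum.distrib)
  moreover have "\<forall>k. hpoly k (\<lambda>x. Q k x + Q' k x)" using Q(1) Q'(1) by (intro allI hpoly_add)
  moreover have "\<forall>k>max K K'. (\<lambda>x. Q k x + Q' k x) = (\<lambda>x. 0)" using Q(2) Q'(2) by simp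
  ultimately show ?case by (intro exI[of _ "max K K'"] exI[of _ "\<lambda>k x. Q k x + Q' k x"]) blast
qed

lemma hsum_polynomial_function:
  fixes M :: "'m::{finite,linorder} cl_fun"
  assumes M: "polynomial_function M" and real: "\<And>x. cl_real (M x)"
  shows "hsum M"
proof -
  have p: "real_polynomial_function (\<lambda>x. Re (M x $ A))" for A
  proof -
    have "bounded_linear (\<lambda>a :: 'm clifford. Re (a $ A))"
      by (rule bounded_linear_compose[OF bounded_linear_Re bounded_linear_vec_nth])
    with M have "real_polynomial_function ((\<lambda>a. Re (a $ A)) \<circ> M)" unfolding polynomial_function_def by blast
    then show ?thesis by (simp add: o_def)
  qed
  have "M = (\<lambda>x. \<Sum>A\<in>UNIV. Re (M x $ A) *\<^sub>R cl_blade A)"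
  proof
    fix x
    have "M x = (\<Sum>A\<in>UNIV. (M x $ A) *s cl_blade A)" by (rule cl_expansion)
    also have "\<dots> = (\<Sum>A\<in>UNIV. Re (M x $ A) *\<^sub>R cl_blade A)"
      using real[of x] by (intro sum.cong refl) (simp add: scaleR_eq_scale cl_real_def)
    finally show "M x = (\<Sum>A\<in>UNIV. Re (M x $ A) *\<^sub>R cl_blade A)" .
  qed
  moreover have "hsum (\<lambda>x. \<Sum>A\<in>UNIV. Re (M x $ A) *\<^sub>R cl_blade A)"
    by (intro hsum_sum hsum_real_polynomial_mult p hsum_hpoly[of 0] hpoly_const cl_real_blade)
  ultimately show ?thesis by simp
qed

text \<open>A polynomial function is a finite sum of homogeneous components. Evaluating at
  \<open>t x\<close> gives, for fixed \<open>x\<close>, two polynomials in \<open>t\<close> that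
  agree on the real line; comparing coefficients of \<open>t^l\<close> shows that \<open>M\<close>
  is its component of degree \<open>l\<close>.\<close>

lemma monogenics_hpoly:
  fixes M :: "'m::{finite,linorder} cl_fun"
  assumes "M \<in> monogenics l"
  shows "hpoly l M" and "dirac M x = 0"
proof -
  have M: "polynomial_function M" "\<And>t x. M (t *\<^sub>R x) = t ^ l *\<^sub>R M x" "\<And>x. cl_real (M x)"
    "\<And>x. dirac M x = 0" using assms by (auto simp: monogenics_def)
  show "dirac M x = 0" by (rule M)
  obtain K0 Q where Q: "\<And>k. hpoly k (Q k)" "\<And>k. k > K0 \<Longrightarrow> Q k = (\<lambda>x. 0)" "M = (\<lambda>x. \<Sum>k\<le>K0. Q k x)"
    using hsum_decomposition[OF hsum_polynomial_function[OF M(1,3)]] by auto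
  \<comment> \<open>Raised to at least \<open>l\<close> so that the coefficient of degree
    \<open>l\<close> is among those compared.\<close>
  define K where "K = max K0 l"
  have MK: "M x = (\<Sum>k\<le>K. Q k x)" for x
    unfolding Q(3) by (rule sum.mono_neutral_left) (use Q(2) in \<open>auto simp: K_def\<close>)
  have "M x = Q l x" for x
  proof (rule vec_eq_iff[THEN iffD2], rule allI)
    fix A
    have "(\<Sum>k\<le>K. (Q k x $ A) * z ^ k) = (\<Sum>k\<le>K. (if k = l then M x $ A else 0) * z ^ k)" if "z \<in> range of_real" for z :: complex
    proof -
      from that obtain t where z: "z = of_real t" by auto
      have "M (t *\<^sub>R x) = (\<Sum>k\<le>K. t ^ k *\<^sub>R Q k x)"
        unfolding MK by (intro sum.cong refl hpoly_homogeneous Q)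
      then have "(t ^ l *\<^sub>R M x) $ A = (\<Sum>k\<le>K. t ^ k *\<^sub>R Q k x) $ A" by (simp add: M(2))
      then have "of_real (t ^ l) * M x $ A = (\<Sum>k\<le>K. of_real (t ^ k) * Q k x $ A)"
        by (simp add: scaleR_complex_conv del: of_real_power)
      then have 1: "(\<Sum>k\<le>K. (Q k x $ A) * z ^ k) = M x $ A * z ^ l"
        unfolding z of_real_power by (simp only: mult.commute)
      have "(\<Sum>k\<le>K. (if k = l then M x $ A else 0) * z ^ k) = (\<Sum>k\<le>K. if k = l then M x $ A * z ^ l else 0)"
        by (intro sum.cong refl) simp
      also have "\<dots> = M x $ A * z ^ l" by (simp add: K_def)
      finally show ?thesis unfolding 1 ..
    qed
    then have e: "(\<Sum>k\<le>K. (Q k x $ A - (if k = l then M x $ A else 0)) * z ^ k) = 0" if "z \<in> range of_real" for z :: complex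
      using that by (simp add: left_diff_distrib sum_subtractf)
    have "Q l x $ A - (if l = l then M x $ A else 0) = 0"
    proof (rule ccontr)
      assume nz: "\<not> ?thesis"
      have "finite {z. (\<Sum>k\<le>K. (Q k x $ A - (if k = l then M x $ A else 0)) * z ^ k) = 0}"
        by (rule polyfun_finite_roots[THEN iffD2], rule exI[of _ l]) (use nz in \<open>simp add: K_def\<close>)
      moreover have "range (of_real :: real \<Rightarrow> complex) \<subseteq> {z. (\<Sum>k\<le>K. (Q k x $ A - (if k = l then M x $ A else 0)) * z ^ k) = 0}"
        using e by blast
      ultimately have "finite (range (of_real :: real \<Rightarrow> complex))" by (rule finite_subset[rotated])
      moreover have "inj (of_real :: real \<Rightarrow> complex)" by (simp add: inj_on_def)
      ultimately have "finite (UNIV :: real set)" by (rule finite_imageD)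
      then show False using infinite_UNIV_char_0 by blast
    qed
    then show "M x $ A = Q l x $ A" by simp
  qed
  then have "M = Q l" by auto
  then show "hpoly l M" using Q(1)[of l] by simp
qed

section \<open>The normalised basis functions and their products with \<open>r\<close>\<close>

definition ang :: "(nat \<Rightarrow> nat \<Rightarrow> 'm::{finite,linorder} cl_fun) \<Rightarrow> nat \<Rightarrow> nat \<Rightarrow> nat \<Rightarrow> 'm cl_fun" where
  "ang Mb n l j = (if even n then Mb l j else (\<lambda>x. cl_vec x \<odot> Mb l j x))"

definition alph :: "'m::finite itself \<Rightarrow> real \<Rightarrow> nat \<Rightarrow> nat \<Rightarrow> real" where
  "alph m c n l = gam m c l / 2 - 1 + real (n mod 2)"

text \<open>Inverse norm of the radial factor: the squared norm is
  \<open>Gamma (t + a + 1) / t!\<close> times the factor \<open>1/2\<close> that the substitution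
  \<open>s = r^2\<close> leaves in the radial measure.\<close>

definition lag_norm :: "nat \<Rightarrow> real \<Rightarrow> real" where
  "lag_norm t a = sqrt (2 * fact t / Gamma (real t + a + 1))"

text \<open>For \<open>s = 0\<close> these are the normalised functions \<open>phi\<close>, with the Laguerre parameter \<open>alph\<close>. For
  \<open>s = 1\<close> the exponent of \<open>r\<close> and the parameter are both raised by one; this orthonormal system
  has two-term inner products with \<open>r f\<close>.\<close>

definition bas ::
    "real \<Rightarrow> (nat \<Rightarrow> nat \<Rightarrow> 'm::{finite,linorder} cl_fun) \<Rightarrow> real \<Rightarrow> nat \<times> nat \<times> nat \<Rightarrow> 'm cl_fun" where
  "bas c Mb s = (\<lambda>(n, l, j) x. lag_norm (n div 2) (alph TYPE('m) c n l + s) *\<^sub>R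
     gfun (beta c l + s) (1/2) (laguerre (n div 2) (alph TYPE('m) c n l + s)) (ang Mb n l j) x)"

definition idx :: "(nat \<Rightarrow> nat) \<Rightarrow> (nat \<times> nat \<times> nat) set" where
  "idx d = {(n, l, j). j < d l}"

text \<open>Splits the parameter into the extremal value \<open>\<delta> / 2 - 1\<close> and two
  nonnegative excesses, one from the degree and one from the parity; these measure the loss in the
  inequality.\<close>

lemma alph_eq:
  assumes "c > -1"
  shows "alph TYPE('m::finite) c n l = delta TYPE('m) c / 2 - 1 + real l / (1 + c) + real (n mod 2)"
proof -
  define u where "u = 1 / (1 + c)"
  have u: "(c + 2) / (1 + c) = 1 + u" "x / (1 + c) = x * u" for x
    using assms by (simp_all add: u_def field_simps)
  show ?thesis
    unfolding alph_def gam_def delta_def u(1) u(2)[of 2] u(2)[of "real CARD('m) - 1"] u(2)[of "real l"]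
    by (simp add: field_simps)
qed

text \<open>The radial power turns the growth \<open>r^l\<close> of a monogenic into
  \<open>r^(l / (1 + c))\<close>, whose exponent is never negative.\<close>

lemma beta_add: "c > -1 \<Longrightarrow> real l + beta c l = real l / (1 + c)"
  by (simp add: beta_def field_simps)

lemma alph_gt:
  assumes "c > -1"
  shows "alph TYPE('m::finite) c n l > - 1"
proof -
  have "0 \<le> real l / (1 + c)" using assms by simp
  then show ?thesis using delta_pos[OF assms, where 'm = 'm] unfolding alph_eq[OF assms] by linarith
qed

lemma monogenic_basisD:
  assumes "monogenic_basis d Mb" "j < d l"
  shows "hpoly l (Mb l j)" and "dirac (Mb l j) x = 0"
    and "k < d l \<Longrightarrow> sphere_inner (Mb l j) (Mb l k) = (if j = k then 1 else 0)"
  using assms monogenics_hpoly[of "Mb l j" l] unfolding monogenic_basis_def by blast+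

lemma hpoly_ang:
  assumes "monogenic_basis d Mb" "j < d l"
  shows "hpoly (l + n mod 2) (ang Mb n l j)"
  using monogenic_basisD(1)[OF assms] hpoly_cl_vec[OF monogenic_basisD(1)[OF assms]]
  by (cases "even n") (auto simp: ang_def odd_iff_mod_2_eq_one)

lemma sphere_inner_hdot:
  fixes M N :: "'m::{finite,linorder} cl_fun"
  assumes M: "hpoly k M" and N: "hpoly l N"
  shows "sphere_inner M N = (\<integral>x. hdot (M x) (N x) \<partial>sphere_measure)"
proof -
  have i: "integrable sphere_measure (\<lambda>x. cl_bar (M x) \<odot> N x)"
  proof (rule integrable_sphere, rule bounded_bilinear.continuous_on[OF bounded_bilinear_cl_mult])
    show "continuous_on UNIV (\<lambda>x. cl_bar (M x))"
      unfolding cl_bar_def by (intro continuous_intros hpoly_continuous[OF M])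
  qed (rule hpoly_continuous[OF N])
  have "sphere_inner M N = (\<integral>x. cl_scalar (cl_bar (M x) \<odot> N x) \<partial>sphere_measure)"
    unfolding sphere_inner_def cl_scalar_def
    by (rule integral_bounded_linear[OF bounded_linear_vec_nth i, symmetric])
  moreover have "cl_scalar (cl_bar (M x) \<odot> N x) = hdot (M x) (N x)" for x
    using cl_scalar_bar_cnj[of "M x" "N x"] by (simp add: cl_cnj_real hpoly_real[OF M])
  ultimately show ?thesis by (simp only:)
qed

lemma ang_orthonormal:
  assumes mb: "monogenic_basis d Mb" and j: "j < d l" "j' < d l'"
  shows "(\<integral>x. hdot (ang Mb n l j x) (ang Mb n' l' j' x) \<partial>sphere_measure)
    = (if n mod 2 = n' mod 2 \<and> l = l' \<and> j = j' then 1 else 0)"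
proof -
  note M = monogenic_basisD[OF mb j(1)] and N = monogenic_basisD[OF mb j(2)]
  note so = sphere_orthogonal[OF M(1,2) N(1,2)] and so' = sphere_orthogonal[OF N(1,2) M(1,2)]
  have base: "(\<integral>x. hdot (Mb l j x) (Mb l' j' x) \<partial>sphere_measure) = (if l = l' \<and> j = j' then 1 else 0)"
  proof (cases "l = l'")
    case True
    then show ?thesis using sphere_inner_hdot[OF M(1) N(1)] M(3)[of j'] j by simp
  qed (simp add: so(1))
  have mixed: "(\<integral>x. hdot (cl_vec x \<odot> Mb l j x) (Mb l' j' x) \<partial>sphere_measure) = 0"
  proof -
    show ?thesis
      using Bochner_Integration.integral_cnj[of sphere_measure "\<lambda>x. hdot (Mb l' j' x) (cl_vec x \<odot> Mb l j x)"]
      by (simp only: cnj_hdot so'(2) complex_cnj_zero)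
  qed
  show ?thesis
    by (cases "even n"; cases "even n'")
      (simp_all add: ang_def so base mixed even_iff_mod_2_eq_zero odd_iff_mod_2_eq_one)
qed

lemma lag_norm_pos:
  assumes "a > -1"
  shows "lag_norm t a > 0"
proof -
  have "0 < Gamma (real t + a + 1)" using assms by (intro Gamma_real_pos) simp
  then show ?thesis by (simp add: lag_norm_def)
qed

lemma bas_L2:
  fixes Mb :: "nat \<Rightarrow> nat \<Rightarrow> 'm::{finite,linorder} cl_fun"
  assumes c: "c > -1" and mb: "monogenic_basis d Mb" and s: "s \<ge> 0" and i: "i \<in> idx d"
  shows "bas c Mb s i \<in> L2 c"
proof -
  obtain n l j where i: "i = (n, l, j)" "j < d l" using i by (auto simp: idx_def)
  let ?a = "alph TYPE('m) c n l + s"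
  have a: "?a > -1" using alph_gt[OF c, where 'm = 'm, of n l] s by simp
  have m: "laguerre t b \<in> borel_measurable borel" for t b unfolding laguerre_def[abs_def] by measurable
  have "gfun (beta c l + s) (1/2) (laguerre (n div 2) ?a) (ang Mb n l j) \<in> L2 c"
  proof (rule gfun_L2[OF c hpoly_ang[OF mb i(2)] m])
    show "?a = delta TYPE('m) c / 2 - 1 + (real (l + n mod 2) + (beta c l + s))"
      using beta_add[OF c, of l] by (simp add: alph_eq[OF c])
    show "integrable lborel (\<lambda>r. if r > 0 then r powr ?a * exp (- (1/2 + 1/2) * r) * (laguerre (n div 2) ?a r * laguerre (n div 2) ?a r) else 0)"
      by (rule laguerre_integrable2[OF a]) simp
  qed
  then show ?thesis unfolding L2_eq_sq_int i(1) bas_def by (simp add: sq_int_scaleR)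
qed

lemma bas_orthonormal:
  fixes Mb :: "nat \<Rightarrow> nat \<Rightarrow> 'm::{finite,linorder} cl_fun"
  assumes c: "c > -1" and mb: "monogenic_basis d Mb" and s: "s \<ge> 0"
  shows "orthonormal (wmeas c) (idx d) (bas c Mb s)"
  unfolding orthonormal_def
proof (intro conjI ballI)
  show "bas c Mb s i \<in> sq_int (wmeas c)" if "i \<in> idx d" for i
    using bas_L2[OF c mb s that] by (simp add: L2_eq_sq_int)
  fix i i' assume "i \<in> idx d" "i' \<in> idx d"
  then obtain n l j n' l' j' where i: "i = (n, l, j)" "j < d l" and i': "i' = (n', l', j')" "j' < d l'"
    by (auto simp: idx_def)
  let ?a = "alph TYPE('m) c n l + s" and ?a' = "alph TYPE('m) c n' l' + s"
  let ?t = "n div 2" and ?t' = "n' div 2"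
  have a: "?a > -1" using alph_gt[OF c, where 'm = 'm, of n l] s by simp
  have m: "laguerre t b \<in> borel_measurable borel" for t b unfolding laguerre_def[abs_def] by measurable
  \<comment> \<open>The exponent of the radial integral is the mean of the two Laguerre parameters.
    Laguerre orthogonality applies where they coincide; for different parity, degree or
    \<open>j\<close> the angular factor is zero.\<close>
  define A where "A = delta TYPE('m) c / 2 - 1 + (real (l + n mod 2) + real (l' + n' mod 2) + (beta c l + s) + (beta c l' + s)) / 2"
  have Aa: "A = (?a + ?a') / 2"
    unfolding A_def alph_eq[OF c] of_nat_add beta_add[OF c, symmetric] by (simp add: field_simps)
  have A: "A > -1" unfolding Aa using a alph_gt[OF c, where 'm = 'm, of n' l'] s by simp
  have "iprod (wmeas c) (gfun (beta c l + s) (1/2) (laguerre ?t ?a) (ang Mb n l j))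
      (gfun (beta c l' + s) (1/2) (laguerre ?t' ?a') (ang Mb n' l' j'))
    = of_real (lag_mean A (1/2 + 1/2) (\<lambda>r. laguerre ?t ?a r * laguerre ?t' ?a' r) / 2) *
      (\<integral>x. hdot (ang Mb n l j x) (ang Mb n' l' j' x) \<partial>sphere_measure)"
    by (rule gfun_iprod(2)[OF c hpoly_ang[OF mb i(2)] hpoly_ang[OF mb i'(2)] m m A_def laguerre_integrable2[OF A]]) simp
  then have I: "iprod (wmeas c) (bas c Mb s i) (bas c Mb s i')
    = of_real (lag_norm ?t ?a * lag_norm ?t' ?a' * (lag_mean A 1 (\<lambda>r. laguerre ?t ?a r * laguerre ?t' ?a' r) / 2)) *
      (\<integral>x. hdot (ang Mb n l j x) (ang Mb n' l' j' x) \<partial>sphere_measure)"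
    by (simp add: bas_def i i' iprod_scaleR_left iprod_scaleR_right)
  show "iprod (wmeas c) (bas c Mb s i) (bas c Mb s i') = (if i = i' then 1 else 0)"
  proof (cases "n mod 2 = n' mod 2 \<and> l = l' \<and> j = j'")
    case True
    then have aa: "?a' = ?a" "A = ?a" by (simp_all add: alph_def Aa)
    have "n = n' \<longleftrightarrow> ?t = ?t'" using True by (metis div_mult_mod_eq)
    then have ii: "i = i' \<longleftrightarrow> ?t = ?t'" using True i i' by auto
    have one: "lag_norm ?t ?a * lag_norm ?t ?a * (Gamma (real ?t + ?a + 1) / fact ?t / 2) = 1"
    proof -
      have "0 < Gamma (real ?t + ?a + 1)" using a by (intro Gamma_real_pos) simp
      then show ?thesis by (simp add: lag_norm_def field_simps)
    qed
    have lag: "lag_mean A 1 (\<lambda>r. laguerre ?t ?a r * laguerre ?t' ?a' r)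
        = (if ?t = ?t' then Gamma (real ?t' + ?a + 1) / fact ?t' else 0)"
      unfolding aa by (rule laguerre_orthogonal[OF a])
    have an: "(\<integral>x. hdot (ang Mb n l j x) (ang Mb n' l' j' x) \<partial>sphere_measure) = 1"
      unfolding ang_orthonormal[OF mb i(2) i'(2)] using True by simp
    show ?thesis
    proof (cases "?t = ?t'")
      case True
      show ?thesis unfolding I lag an ii unfolding aa(1) True[symmetric] by (simp only: simp_thms if_True one of_real_1 mult_1_right)
    next
      case False
      then show ?thesis unfolding I lag an ii by simp
    qed
  next
    case False
    then show ?thesis
      unfolding I ang_orthonormal[OF mb i(2) i'(2)] using i i' by auto
  qed
qed

text \<open>The normalisation constants absorb a square root of each coefficient of
  \<open>laguerre_mult\<close>, which leaves the square roots in
  \<open>norm_mult_bas\<close>.\<close>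

lemma lag_norm_shift:
  assumes "a > -1"
  shows "lag_norm t (a + 1) * (real t + a + 1) = sqrt (real t + a + 1) * lag_norm t a"
    and "lag_norm t (a + 1) * (real t + 1) = sqrt (real t + 1) * lag_norm (Suc t) a"
proof -
  have p: "real t + a + 1 > 0" using assms by simp
  have G: "Gamma (real t + (a + 1) + 1) = (real t + a + 1) * Gamma (real t + a + 1)"
  proof -
    have "real t + a + 1 \<notin> \<int>\<^sub>\<le>\<^sub>0" using p by (auto elim!: nonpos_Ints_cases)
    moreover have "real t + (a + 1) + 1 = (real t + a + 1) + 1" by simp
    ultimately show ?thesis by (simp only: Gamma_plus1 not_False_eq_True)
  qed
  have G0: "Gamma (real t + a + 1) > 0" using p by (rule Gamma_real_pos)
  show "lag_norm t (a + 1) * (real t + a + 1) = sqrt (real t + a + 1) * lag_norm t a"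
  proof -
    have "lag_norm t (a + 1) * sqrt (real t + a + 1) = lag_norm t a"
      unfolding lag_norm_def G using p G0 by (simp add: real_sqrt_mult[symmetric])
    then have "lag_norm t (a + 1) * (sqrt (real t + a + 1) * sqrt (real t + a + 1)) = lag_norm t a * sqrt (real t + a + 1)"
      by (simp only: mult.assoc[symmetric])
    moreover have "sqrt (real t + a + 1) * sqrt (real t + a + 1) = real t + a + 1" using p by simp
    ultimately show ?thesis by (simp only: mult.commute)
  qed
  show "lag_norm t (a + 1) * (real t + 1) = sqrt (real t + 1) * lag_norm (Suc t) a"
  proof -
    have "Gamma (real (Suc t) + a + 1) = Gamma (real t + (a + 1) + 1)" by (simp add: add_ac)
    then have "lag_norm (Suc t) a = sqrt (real t + 1) * lag_norm t (a + 1)"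
      unfolding lag_norm_def by (simp add: real_sqrt_mult[symmetric] algebra_simps)
    then have "sqrt (real t + 1) * lag_norm (Suc t) a = (sqrt (real t + 1) * sqrt (real t + 1)) * lag_norm t (a + 1)"
      by (simp only: mult.assoc)
    then show ?thesis by (simp add: mult.commute)
  qed
qed

text \<open>\<open>laguerre_mult\<close> at \<open>s = r^2\<close>, where the second factor
  \<open>r\<close> is taken from the raised radial power. Passing from \<open>n\<close> to
  \<open>n + 2\<close> raises the Laguerre degree by one and keeps the parity, hence also the
  angular part and the parameter.\<close>

lemma norm_mult_bas:
  fixes Mb :: "nat \<Rightarrow> nat \<Rightarrow> 'm::{finite,linorder} cl_fun"
  assumes c: "c > -1"
  shows "norm x *\<^sub>R bas c Mb 1 (n, l, j) x
    = sqrt (real (n div 2) + alph TYPE('m) c n l + 1) *\<^sub>R bas c Mb 0 (n, l, j) x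
      - sqrt (real (n div 2) + 1) *\<^sub>R bas c Mb 0 (n + 2, l, j) x"
proof -
  define a where "a = alph TYPE('m) c n l"
  define t where "t = n div 2"
  define r where "r = norm x"
  have a: "a > -1" unfolding a_def by (rule alph_gt[OF c])
  have t2: "(n + 2) div 2 = Suc t" and a2: "alph TYPE('m) c (n + 2) l = a" and ang2: "ang Mb (n + 2) l j = ang Mb n l j"
    by (simp_all add: t_def a_def alph_def ang_def)
  have r: "r * r powr (beta c l + 1) = r powr beta c l * r\<^sup>2"
    by (cases "r = 0") (simp_all add: r_def powr_add power2_eq_square)
  have L: "r\<^sup>2 * laguerre t (a + 1) (r\<^sup>2) = (real t + a + 1) * laguerre t a (r\<^sup>2) - (real t + 1) * laguerre (Suc t) a (r\<^sup>2)"
    by (rule laguerre_mult)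
  define E where "E = r powr beta c l * exp (- (1/2) * r\<^sup>2)"
  have "r * (lag_norm t (a + 1) * (r powr (beta c l + 1) * exp (- (1/2) * r\<^sup>2) * laguerre t (a + 1) (r\<^sup>2)))
      = lag_norm t (a + 1) * (r * r powr (beta c l + 1)) * exp (- (1/2) * r\<^sup>2) * laguerre t (a + 1) (r\<^sup>2)"
    by (simp only: mult_ac)
  also have "\<dots> = lag_norm t (a + 1) * E * (r\<^sup>2 * laguerre t (a + 1) (r\<^sup>2))"
    unfolding r E_def by (simp only: mult_ac)
  also have "\<dots> = (lag_norm t (a + 1) * (real t + a + 1)) * (E * laguerre t a (r\<^sup>2))
      - (lag_norm t (a + 1) * (real t + 1)) * (E * laguerre (Suc t) a (r\<^sup>2))"
    unfolding L by (simp only: right_diff_distrib mult_ac)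
  also have "\<dots> = sqrt (real t + a + 1) * (lag_norm t a * (E * laguerre t a (r\<^sup>2)))
      - sqrt (real t + 1) * (lag_norm (Suc t) a * (E * laguerre (Suc t) a (r\<^sup>2)))"
    unfolding lag_norm_shift[OF a] by (simp only: mult_ac)
  finally have "(r * (lag_norm t (a + 1) * (r powr (beta c l + 1) * exp (- (1/2) * r\<^sup>2) * laguerre t (a + 1) (r\<^sup>2)))) *\<^sub>R ang Mb n l j x
     = (sqrt (real t + a + 1) * (lag_norm t a * (E * laguerre t a (r\<^sup>2)))
      - sqrt (real t + 1) * (lag_norm (Suc t) a * (E * laguerre (Suc t) a (r\<^sup>2)))) *\<^sub>R ang Mb n l j x" by simp
  then show ?thesis
    unfolding bas_def prod.case gfun_def t2 a2 ang2 t_def[symmetric] a_def[symmetric] r_def[symmetric] scaleR_diff_left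
    by (simp add: E_def)
qed

text \<open>A nonzero factor suffices to carry the eigenvalue equation of the transform from
  \<open>phi\<close> to the normalised functions.\<close>

lemma phi_bas:
  fixes Mb :: "nat \<Rightarrow> nat \<Rightarrow> 'm::{finite,linorder} cl_fun"
  assumes c: "c > -1"
  shows "\<exists>k. k \<noteq> 0 \<and> phi c n l (Mb l j) = (\<lambda>x. k *\<^sub>R bas c Mb 0 (n, l, j) x)"
proof -
  define N where "N = lag_norm (n div 2) (alph TYPE('m) c n l + 0)"
  have N: "N > 0" unfolding N_def using alph_gt[OF c, where 'm = 'm, of n l] by (intro lag_norm_pos) simp
  define k where "k = (if even n then 1 else - 1) * (2 ^ n * (1 + c) ^ n * fact (n div 2)) / N"
  have k: "k \<noteq> 0" using c N by (auto simp: k_def)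
  define q where "q = (if even n then 1 else - 1) * (2 ^ n * (1 + c) ^ n * fact (n div 2))"
  have kN: "k * N = q" using N by (simp add: k_def q_def)
  define a where "a = alph TYPE('m) c n l"
  have a: "a = gam TYPE('m) c l / 2 - 1" if "even n" using that by (simp add: a_def alph_def)
  have a': "a = gam TYPE('m) c l / 2" if "odd n" using that by (simp add: a_def alph_def odd_iff_mod_2_eq_one)
  have "phi c n l (Mb l j) x = k *\<^sub>R bas c Mb 0 (n, l, j) x" for x
  proof -
    have "k *\<^sub>R bas c Mb 0 (n, l, j) x = (k * N) *\<^sub>R gfun (beta c l) (1/2) (laguerre (n div 2) a) (ang Mb n l j) x"
      by (simp add: bas_def N_def a_def)
    also have "\<dots> = phi c n l (Mb l j) x"
      unfolding kN
    proof (cases "even n")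
      case True
      then show "q *\<^sub>R gfun (beta c l) (1/2) (laguerre (n div 2) a) (ang Mb n l j) x = phi c n l (Mb l j) x"
        unfolding a[OF True] by (simp add: phi_def gfun_def ang_def q_def Let_def mult_ac)
    next
      case False
      then show "q *\<^sub>R gfun (beta c l) (1/2) (laguerre (n div 2) a) (ang Mb n l j) x = phi c n l (Mb l j) x"
        unfolding a'[OF False] by (simp add: phi_def gfun_def ang_def q_def Let_def mult_ac)
    qed
    finally show ?thesis ..
  qed
  with k show ?thesis by blast
qed

section \<open>Completeness\<close>

text \<open>Closeness is demanded only where \<open>w\<close> does not vanish, so approximation on a
  compact set is enough when \<open>w\<close> is supported there.\<close>

lemma integral_zero_by_approximation:
  fixes w :: "'a::euclidean_space \<Rightarrow> complex" and g :: "'a \<Rightarrow> real"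
  assumes w: "integrable M w" and g: "integrable M (\<lambda>x. g x *\<^sub>R w x)"
    and approx: "\<And>e. e > 0 \<Longrightarrow> \<exists>p. integrable M (\<lambda>x. p x *\<^sub>R w x) \<and> (\<integral>x. p x *\<^sub>R w x \<partial>M) = 0
       \<and> (\<forall>x\<in>space M. w x \<noteq> 0 \<longrightarrow> \<bar>g x - p x\<bar> \<le> e)"
  shows "(\<integral>x. g x *\<^sub>R w x \<partial>M) = 0"
proof -
  have "norm (\<integral>x. g x *\<^sub>R w x \<partial>M) \<le> 0 + e" if e: "e > 0" for e :: real
  proof -
    define W where "W = (\<integral>x. norm (w x) \<partial>M)"
    have W: "W \<ge> 0" by (simp add: W_def)
    obtain p where p: "integrable M (\<lambda>x. p x *\<^sub>R w x)" "(\<integral>x. p x *\<^sub>R w x \<partial>M) = 0"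
      "\<And>x. x \<in> space M \<Longrightarrow> w x \<noteq> 0 \<Longrightarrow> \<bar>g x - p x\<bar> \<le> e / (W + 1)"
    proof -
      have "0 < e / (W + 1)" using e W by (intro divide_pos_pos) auto
      from approx[OF this] show ?thesis using that by blast
    qed
    have "(\<integral>x. g x *\<^sub>R w x \<partial>M) = (\<integral>x. (g x - p x) *\<^sub>R w x \<partial>M)"
      using g p(1,2) by (simp add: scaleR_diff_left)
    also have "norm \<dots> \<le> (\<integral>x. e / (W + 1) * norm (w x) \<partial>M)"
    proof (rule Bochner_Integration.integral_norm_bound_integral)
      show "integrable M (\<lambda>x. (g x - p x) *\<^sub>R w x)" using g p(1) by (simp add: scaleR_diff_left)
      show "integrable M (\<lambda>x. e / (W + 1) * norm (w x))" using w by simp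
      fix x assume x: "x \<in> space M"
      show "norm ((g x - p x) *\<^sub>R w x) \<le> e / (W + 1) * norm (w x)"
      proof (cases "w x = 0")
        case False
        show ?thesis unfolding norm_scaleR real_norm_def by (rule mult_right_mono[OF p(3)[OF x False] norm_ge_zero])
      qed simp
    qed
    also have "\<dots> = e / (W + 1) * W" unfolding W_def by (rule integral_mult_right_zero)
    also have "\<dots> \<le> 0 + e" using e W by (simp add: field_simps)
    finally show ?thesis .
  qed
  then have "norm (\<integral>x. g x *\<^sub>R w x \<partial>M) \<le> 0" by (rule field_le_epsilon)
  then show ?thesis by simp
qed

text \<open>From polynomials to continuous functions by Stone-Weierstrass on the ball that supports
  \<open>w\<close>, to indicators of closed sets by dominated convergence, and to all Borel sets
  because closed sets form an intersection-stable generator. A function with zero integral over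
  every Borel set vanishes almost everywhere.\<close>

lemma AE_zero_if_polynomial_moments_zero:
  fixes w :: "'a::euclidean_space \<Rightarrow> complex"
  assumes w: "integrable lborel w" and supp: "\<And>x. norm x > R \<Longrightarrow> w x = 0"
    and mom: "\<And>p. real_polynomial_function p \<Longrightarrow> (\<integral>x. p x *\<^sub>R w x \<partial>lborel) = 0"
  shows "AE x in lborel. w x = 0"
proof -
  have [measurable]: "w \<in> borel_measurable borel" using borel_measurable_integrable[OF w] by simp
  have int: "integrable lborel (\<lambda>x. g x *\<^sub>R w x)" if g: "continuous_on UNIV g" for g :: "'a \<Rightarrow> real"
  proof -
    have [measurable]: "g \<in> borel_measurable borel" by (rule borel_measurable_continuous_onI[OF g])
    have "compact (g ` cball 0 R)"
      by (rule compact_continuous_image[OF continuous_on_subset[OF g subset_UNIV] compact_cball])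
    from compact_imp_bounded[OF this] obtain B where "\<And>y. y \<in> g ` cball 0 R \<Longrightarrow> norm y \<le> B"
      unfolding bounded_iff by blast
    then have B: "norm (g x) \<le> B" if "x \<in> cball 0 R" for x using that by blast
    have "norm (g x *\<^sub>R w x) \<le> norm (B *\<^sub>R w x)" for x
    proof (cases "norm x \<le> R")
      case True
      then have "norm (g x) \<le> norm B" using order.trans[OF B abs_ge_self] by (simp add: dist_norm)
      then show ?thesis unfolding norm_scaleR real_norm_def by (rule mult_right_mono[OF _ norm_ge_zero])
    next
      case False
      then show ?thesis using supp[of x] by simp
    qed
    then have "AE x in lborel. norm (g x *\<^sub>R w x) \<le> norm (B *\<^sub>R w x)" by (rule AE_I2)
    moreover have "integrable lborel (\<lambda>x. B *\<^sub>R w x)" using w by simp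
    moreover have "(\<lambda>x. g x *\<^sub>R w x) \<in> borel_measurable lborel" by measurable
    ultimately show ?thesis using Bochner_Integration.integrable_bound by blast
  qed
  have cont0: "(\<integral>x. g x *\<^sub>R w x \<partial>lborel) = 0" if g: "continuous_on UNIV g" for g :: "'a \<Rightarrow> real"
  proof (rule integral_zero_by_approximation[OF w int[OF g]])
    fix e :: real assume "e > 0"
    obtain p where p: "real_polynomial_function p" "\<And>x. x \<in> cball 0 R \<Longrightarrow> \<bar>g x - p x\<bar> < e"
      by (rule Stone_Weierstrass_real_polynomial_function[OF compact_cball[of 0 R] continuous_on_subset[OF g subset_UNIV] \<open>e > 0\<close>], rule that)
    have "continuous_on UNIV p"
      using p(1) by (simp add: continuous_on_polymonial_function real_polynomial_function_eq)
    moreover have "\<bar>g x - p x\<bar> \<le> e" if "w x \<noteq> 0" for x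
      using p(2)[of x] supp[of x] that by (cases "norm x \<le> R") auto
    ultimately show "\<exists>p. integrable lborel (\<lambda>x. p x *\<^sub>R w x) \<and> (\<integral>x. p x *\<^sub>R w x \<partial>lborel) = 0
       \<and> (\<forall>x\<in>space lborel. w x \<noteq> 0 \<longrightarrow> \<bar>g x - p x\<bar> \<le> e)"
      using int[of p] mom[OF p(1)] by (intro exI[of _ p]) simp
  qed
  have iA: "integrable lborel (\<lambda>x. indicator A x *\<^sub>R w x)" if "A \<in> sets borel" for A
    using that w by (intro integrable_mult_indicator) auto
  have w0: "(\<integral>x. w x \<partial>lborel) = 0" using cont0[of "\<lambda>x. 1"] by simp
  have closed0: "(\<integral>x. indicator C x *\<^sub>R w x \<partial>lborel) = 0" if C: "closed C" for C
  proof (cases "C = {}")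
    case False
    \<comment> \<open>Continuous functions decreasing to the indicator of \<open>C\<close>;
      closedness makes the distance positive off \<open>C\<close>.\<close>
    define g where "g n x = max 0 (1 - real n * infdist x C)" for n and x :: 'a
    have g: "continuous_on UNIV (g n)" for n
      unfolding g_def[abs_def] by (intro continuous_intros)
    have [measurable]: "g n \<in> borel_measurable borel" for n by (rule borel_measurable_continuous_onI[OF g])
    have [measurable]: "C \<in> sets borel" using C by (rule borel_closed)
    have "(\<lambda>n. \<integral>x. g n x *\<^sub>R w x \<partial>lborel) \<longlonglongrightarrow> (\<integral>x. indicator C x *\<^sub>R w x \<partial>lborel)"
    proof (rule integral_dominated_convergence[where w = "\<lambda>x. norm (w x)"])
      show "AE x in lborel. (\<lambda>n. g n x *\<^sub>R w x) \<longlonglongrightarrow> indicator C x *\<^sub>R w x"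
      proof (rule AE_I2)
        fix x
        have "(\<lambda>n. g n x) \<longlonglongrightarrow> indicator C x"
        proof (cases "x \<in> C")
          case True
          then have "infdist x C = 0" using in_closed_iff_infdist_zero[OF C False] by simp
          then show ?thesis using True by (simp add: g_def)
        next
          case F: False
          then have pos: "infdist x C > 0"
            using in_closed_iff_infdist_zero[OF C False, of x] infdist_nonneg[of x C] by (simp add: less_le)
          obtain N where N: "real N * infdist x C > 1" using reals_Archimedean3[OF pos] by blast
          have "\<forall>\<^sub>F n in sequentially. g n x = 0"
          proof (rule eventually_sequentiallyI[of N])
            fix n assume that: "n \<ge> N"
            have "real N * infdist x C \<le> real n * infdist x C" using that pos by (intro mult_right_mono) auto
            then show "g n x = 0" using N by (simp add: g_def)
          qed
          then show ?thesis using F by (simp add: tendsto_eventually)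
        qed
        then show "(\<lambda>n. g n x *\<^sub>R w x) \<longlonglongrightarrow> indicator C x *\<^sub>R w x" by (intro tendsto_intros)
      qed
      show "AE x in lborel. norm (g n x *\<^sub>R w x) \<le> norm (w x)" for n
      proof (rule AE_I2)
        fix x
        have "0 \<le> real n * infdist x C" by (simp add: infdist_nonneg)
        then have "\<bar>g n x\<bar> \<le> 1" by (simp add: g_def)
        then show "norm (g n x *\<^sub>R w x) \<le> norm (w x)"
          unfolding norm_scaleR by (intro mult_left_le_one_le) auto
      qed
      show "integrable lborel (\<lambda>x. norm (w x))" using w by (rule integrable_norm)
    qed measurable
    then show ?thesis unfolding cont0[OF g] LIMSEQ_const_iff by (rule sym)
  qed simp
  have "(\<integral>x. indicator A x *\<^sub>R w x \<partial>lborel) = 0" if "A \<in> sets borel" for A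
  proof -
    have sb: "sets borel = sigma_sets UNIV (Collect closed :: 'a set set)"
      by (simp add: borel_eq_closed)
    have "A \<in> sigma_sets UNIV (Collect closed)" using that by (simp only: sb)
    then show ?thesis
    proof (rule sigma_sets_induct_disjoint[where P = "\<lambda>A. (\<integral>x. indicator A x *\<^sub>R w x \<partial>lborel) = 0", rotated 2])
      show "Int_stable (Collect closed :: 'a set set)" by (simp add: Int_stable_def closed_Int)
      show "Collect closed \<subseteq> Pow (UNIV :: 'a set)" by simp
      show "(\<integral>x. indicator C x *\<^sub>R w x \<partial>lborel) = 0" if "C \<in> Collect closed" for C
        using closed0 that by simp
      show "(\<integral>x. indicator {} x *\<^sub>R w x \<partial>lborel) = 0" by simp
    next
      fix A assume A: "A \<in> sigma_sets UNIV (Collect closed)" "(\<integral>x. indicator A x *\<^sub>R w x \<partial>lborel) = 0"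
      have "indicator (UNIV - A) x *\<^sub>R w x = w x - indicator A x *\<^sub>R w x" for x
        by (simp add: indicator_def)
      then show "(\<integral>x. indicator (UNIV - A) x *\<^sub>R w x \<partial>lborel) = 0"
        using A w w0 iA[of A] by (simp add: sb)
    next
      fix A :: "nat \<Rightarrow> 'a set"
      assume disj: "disjoint_family A" and rA: "range A \<subseteq> sigma_sets UNIV (Collect closed)"
        and A0: "\<And>i. (\<integral>x. indicator (A i) x *\<^sub>R w x \<partial>lborel) = 0"
      have A: "A i \<in> sets borel" for i using rA unfolding sb by blast
      have "(\<integral>x. indicator (\<Union>i. A i) x *\<^sub>R w x \<partial>lborel) = (\<Sum>i. \<integral>x. indicator (A i) x *\<^sub>R w x \<partial>lborel)"
      proof (rule lebesgue_integral_countable_add[of A lborel w, unfolded set_lebesgue_integral_def set_integrable_def])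
        show "A i \<in> sets lborel" for i using A by simp
        show "A i \<inter> A j = {}" if "i \<noteq> j" for i j
          using disj that by (simp add: disjoint_family_on_def)
        have "(\<Union>i. A i) \<in> sets borel" using A by (intro sets.countable_UN) auto
        then show "integrable lborel (\<lambda>x. indicator (\<Union>i. A i) x *\<^sub>R w x)" by (rule iA)
      qed
      then show "(\<integral>x. indicator (\<Union>i. A i) x *\<^sub>R w x \<partial>lborel) = 0" by (simp add: A0)
    qed
  qed
  then show ?thesis
    by (intro sigma_finite_measure.density_zero[OF lborel.sigma_finite_measure_axioms w]) (simp add: set_lebesgue_integral_def)
qed

section \<open>Radial moments and continuous radial test functions\<close>

lemma radial_integrable_power:
  fixes u :: "real ^ 'm \<Rightarrow> complex"
  assumes [measurable]: "u \<in> borel_measurable borel"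
    and u: "\<And>e. e > 0 \<Longrightarrow> integrable lborel (\<lambda>x. exp (- e * (norm x)\<^sup>2) *\<^sub>R u x)" and a: "a > 0"
  shows "integrable lborel (\<lambda>x. (((norm x)\<^sup>2) ^ k * exp (- a * (norm x)\<^sup>2)) *\<^sub>R u x)"
proof -
  obtain C where C: "C \<ge> 0" "\<And>r. r \<ge> 0 \<Longrightarrow> r ^ (2 * k) \<le> C * exp (a / 2 * r\<^sup>2)"
    using power_le_exp_square[of "a / 2" "2 * k"] a by auto
  have b: "norm ((((norm x)\<^sup>2) ^ k * exp (- a * (norm x)\<^sup>2)) *\<^sub>R u x)
      \<le> norm (C *\<^sub>R (exp (- (a / 2) * (norm x)\<^sup>2) *\<^sub>R u x))" for x
  proof -
    have "((norm x)\<^sup>2) ^ k * exp (- a * (norm x)\<^sup>2) \<le> C * exp (a / 2 * (norm x)\<^sup>2) * exp (- a * (norm x)\<^sup>2)"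
      using C(2)[of "norm x"] by (intro mult_right_mono) (simp_all add: power_mult)
    also have "\<dots> = C * exp (- (a / 2) * (norm x)\<^sup>2)"
      by (simp add: mult.assoc exp_add[symmetric])
    finally have "\<bar>((norm x)\<^sup>2) ^ k * exp (- a * (norm x)\<^sup>2)\<bar> \<le> \<bar>C\<bar> * \<bar>exp (- (a / 2) * (norm x)\<^sup>2)\<bar>"
      using C by simp
    from mult_right_mono[OF this norm_ge_zero[of "u x"]] show ?thesis
      by (simp only: norm_scaleR real_norm_def mult.assoc)
  qed
  show ?thesis
  proof (rule Bochner_Integration.integrable_bound)
    show "integrable lborel (\<lambda>x. C *\<^sub>R (exp (- (a / 2) * (norm x)\<^sup>2) *\<^sub>R u x))"
      by (intro integrable_scaleR_right u) (use a in simp)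
    show "AE x in lborel. norm ((((norm x)\<^sup>2) ^ k * exp (- a * (norm x)\<^sup>2)) *\<^sub>R u x)
      \<le> norm (C *\<^sub>R (exp (- (a / 2) * (norm x)\<^sup>2) *\<^sub>R u x))" by (rule AE_I2[OF b])
  qed measurable
qed

text \<open>The power series of the exponential turns moments against one Gaussian into moments against
  narrower ones; the step \<open>1/4\<close> stays below half the initial rate, which dominates the series.\<close>

lemma radial_moments_shift:
  fixes u :: "real ^ 'm \<Rightarrow> complex"
  assumes [measurable]: "u \<in> borel_measurable borel"
    and u: "\<And>e. e > 0 \<Longrightarrow> integrable lborel (\<lambda>x. exp (- e * (norm x)\<^sup>2) *\<^sub>R u x)" and a: "a \<ge> 1/2"
    and mom: "\<And>k. (\<integral>x. (((norm x)\<^sup>2) ^ k * exp (- a * (norm x)\<^sup>2)) *\<^sub>R u x \<partial>lborel) = 0"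
  shows "(\<integral>x. (((norm x)\<^sup>2) ^ k * exp (- (a + 1/4) * (norm x)\<^sup>2)) *\<^sub>R u x \<partial>lborel) = 0"
proof -
  define S where "S N s = (\<Sum>n<N. (- (s / 4)) ^ n / fact n)" for N and s :: real
  define h where "h N x = (((norm x)\<^sup>2) ^ k * exp (- a * (norm x)\<^sup>2) * S N ((norm x)\<^sup>2)) *\<^sub>R u x" for N and x :: "real ^ 'm"
  have int: "integrable lborel (\<lambda>x. (((norm x)\<^sup>2) ^ j * exp (- a * (norm x)\<^sup>2)) *\<^sub>R u x)" for j
    using a by (intro radial_integrable_power u) auto
  have h0: "(\<integral>x. h N x \<partial>lborel) = 0" for N
  proof -
    have "h N x = (\<Sum>n<N. ((- (1/4)) ^ n / fact n) *\<^sub>R ((((norm x)\<^sup>2) ^ (k + n) * exp (- a * (norm x)\<^sup>2)) *\<^sub>R u x))" for x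
    proof -
      have p: "(- ((norm x)\<^sup>2 / 4)) ^ n = (- (1/4)) ^ n * ((norm x)\<^sup>2) ^ n" for n
        unfolding power_mult_distrib[symmetric] by simp
      show ?thesis
        by (simp only: h_def S_def p sum_distrib_left scaleR_sum_left scaleR_scaleR power_add)
          (intro sum.cong refl arg_cong2[where f = "(*\<^sub>R)"], simp)
    qed
    then have "(\<integral>x. h N x \<partial>lborel) = (\<integral>x. (\<Sum>n<N. ((- (1/4)) ^ n / fact n) *\<^sub>R
        ((((norm x)\<^sup>2) ^ (k + n) * exp (- a * (norm x)\<^sup>2)) *\<^sub>R u x)) \<partial>lborel)" by (simp only:)
    also have "\<dots> = (\<Sum>n<N. \<integral>x. ((- (1/4)) ^ n / fact n) *\<^sub>R
        ((((norm x)\<^sup>2) ^ (k + n) * exp (- a * (norm x)\<^sup>2)) *\<^sub>R u x) \<partial>lborel)"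
      by (intro Bochner_Integration.integral_sum integrable_scaleR_right int)
    also have "\<dots> = 0"
      by (simp only: integral_scaleR_right mom scaleR_zero_right sum.neutral_const)
    finally show ?thesis .
  qed
  have lim: "(\<lambda>N. h N x) \<longlonglongrightarrow> (((norm x)\<^sup>2) ^ k * exp (- (a + 1/4) * (norm x)\<^sup>2)) *\<^sub>R u x" for x
  proof -
    have "(\<lambda>N. S N s) \<longlonglongrightarrow> exp (- (s / 4))" for s
      using exp_converges[of "- (s / 4)"]
      unfolding sums_def S_def real_scaleR_def divide_inverse by (simp only: mult.commute)
    then have "(\<lambda>N. h N x) \<longlonglongrightarrow> (((norm x)\<^sup>2) ^ k * exp (- a * (norm x)\<^sup>2) * exp (- ((norm x)\<^sup>2 / 4))) *\<^sub>R u x"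
      unfolding h_def by (intro tendsto_intros)
    also have "((norm x)\<^sup>2) ^ k * exp (- a * (norm x)\<^sup>2) * exp (- ((norm x)\<^sup>2 / 4))
        = ((norm x)\<^sup>2) ^ k * exp (- (a + 1/4) * (norm x)\<^sup>2)"
      by (simp add: mult.assoc exp_add[symmetric] algebra_simps)
    finally show ?thesis .
  qed
  have bound: "norm (h N x) \<le> norm ((((norm x)\<^sup>2) ^ k * exp (- (a - 1/4) * (norm x)\<^sup>2)) *\<^sub>R u x)" for N x
  proof -
    define s where "s = (norm x)\<^sup>2"
    have s: "s \<ge> 0" by (simp add: s_def)
    have "\<bar>S N s\<bar> \<le> (\<Sum>n<N. (s / 4) ^ n / fact n)"
      unfolding S_def using s by (intro order.trans[OF sum_abs] sum_mono) (simp add: power_abs)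
    also have "\<dots> \<le> exp (s / 4)"
    proof -
      have S: "(\<lambda>n. (s / 4) ^ n / fact n) sums exp (s / 4)"
        using exp_converges[of "s / 4"] by (simp only: real_scaleR_def divide_inverse mult.commute)
      show ?thesis
        unfolding sums_unique[OF S] by (rule sum_le_suminf[OF sums_summable[OF S]]) (use s in simp_all)
    qed
    finally have S: "\<bar>S N s\<bar> \<le> exp (s / 4)" .
    have "\<bar>s ^ k * exp (- a * s) * S N s\<bar> \<le> s ^ k * exp (- a * s) * exp (s / 4)"
      unfolding abs_mult using S s by (intro mult_mono) auto
    also have "\<dots> = s ^ k * exp (- (a - 1/4) * s)"
      by (simp add: mult.assoc exp_add[symmetric] algebra_simps)
    finally have "\<bar>s ^ k * exp (- a * s) * S N s\<bar> \<le> \<bar>s ^ k * exp (- (a - 1/4) * s)\<bar>" by linarith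
    from mult_right_mono[OF this norm_ge_zero[of "u x"]] show ?thesis
      unfolding h_def norm_scaleR real_norm_def s_def .
  qed
  have "(\<lambda>N. \<integral>x. h N x \<partial>lborel) \<longlonglongrightarrow> (\<integral>x. (((norm x)\<^sup>2) ^ k * exp (- (a + 1/4) * (norm x)\<^sup>2)) *\<^sub>R u x \<partial>lborel)"
  proof (rule integral_dominated_convergence)
    show "integrable lborel (\<lambda>x. norm ((((norm x)\<^sup>2) ^ k * exp (- (a - 1/4) * (norm x)\<^sup>2)) *\<^sub>R u x))"
      using a by (intro integrable_norm radial_integrable_power u) auto
    show "h N \<in> borel_measurable lborel" for N
      unfolding h_def S_def by measurable
    show "(\<lambda>x. (((norm x)\<^sup>2) ^ k * exp (- (a + 1/4) * (norm x)\<^sup>2)) *\<^sub>R u x) \<in> borel_measurable lborel" by measurable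
  qed (use lim bound in auto)
  then show ?thesis unfolding h0 LIMSEQ_const_iff by (rule sym)
qed

text \<open>In the variable \<open>y = exp (- r^2 / 4)\<close> the half-line of radii becomes
  bounded and Gaussians of rate \<open>1/2 + j/4\<close> become powers \<open>y^j\<close> times the
  initial Gaussian. Their integrals against \<open>u\<close> vanish, and the Weierstrass theorem on
  \<open>[0, 1]\<close> extends this to every continuous \<open>G\<close>.\<close>

lemma radial_continuous_zero:
  fixes u :: "real ^ 'm \<Rightarrow> complex"
  assumes um [measurable]: "u \<in> borel_measurable borel"
    and u: "\<And>e. e > 0 \<Longrightarrow> integrable lborel (\<lambda>x. exp (- e * (norm x)\<^sup>2) *\<^sub>R u x)"
    and mom: "\<And>k. (\<integral>x. (((norm x)\<^sup>2) ^ k * exp (- (1/2) * (norm x)\<^sup>2)) *\<^sub>R u x \<partial>lborel) = 0"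
    and G: "continuous_on {0..1} G"
  shows "(\<integral>x. G (exp (- (1/4) * (norm x)\<^sup>2)) *\<^sub>R (exp (- (1/2) * (norm x)\<^sup>2) *\<^sub>R u x) \<partial>lborel) = 0"
proof -
  define w where "w x = exp (- (1/2) * (norm x)\<^sup>2) *\<^sub>R u x" for x :: "real ^ 'm"
  define y where "y x = exp (- (1/4) * (norm x)\<^sup>2)" for x :: "real ^ 'm"
  have y01: "y x \<in> {0..1}" for x by (simp add: y_def)
  have ym [measurable]: "y \<in> borel_measurable borel" unfolding y_def[abs_def] by measurable
  have wm [measurable]: "w \<in> borel_measurable borel" unfolding w_def[abs_def] by measurable
  have w: "integrable lborel w" unfolding w_def by (rule u) simp
  have int: "integrable lborel (\<lambda>x. g (y x) *\<^sub>R w x)" if g: "continuous_on {0..1} g" for g :: "real \<Rightarrow> real"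
  proof -
    have "compact (g ` {0..1})" by (rule compact_continuous_image[OF g]) simp
    from compact_imp_bounded[OF this] obtain B where B: "\<And>z. z \<in> g ` {0..1} \<Longrightarrow> norm z \<le> B"
      unfolding bounded_iff by blast
    have b: "norm (g (y x) *\<^sub>R w x) \<le> norm (B *\<^sub>R w x)" for x
    proof -
      have "norm (g (y x)) \<le> B" by (intro B imageI y01)
      then have "norm (g (y x)) \<le> norm B" unfolding real_norm_def by linarith
      then show ?thesis unfolding norm_scaleR real_norm_def by (rule mult_right_mono[OF _ norm_ge_zero])
    qed
    have "(\<lambda>s. indicator {0..1} s *\<^sub>R g s) \<in> borel_measurable borel"
      by (rule borel_measurable_continuous_on_indicator[OF _ g]) simp
    then have "(\<lambda>x. indicator {0..1} (y x) *\<^sub>R g (y x)) \<in> borel_measurable borel"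
      by (rule measurable_compose[OF ym])
    then have gm: "(\<lambda>x. g (y x)) \<in> borel_measurable borel"
      by (rule measurable_cong[THEN iffD1, rotated]) (simp add: indicator_simps(1)[OF y01])
    show ?thesis
    proof (rule Bochner_Integration.integrable_bound)
      show "integrable lborel (\<lambda>x. B *\<^sub>R w x)" using w by simp
      show "(\<lambda>x. g (y x) *\<^sub>R w x) \<in> borel_measurable lborel"
        using gm wm by (simp add: borel_measurable_scaleR)
    qed (rule AE_I2[OF b])
  qed
  \<comment> \<open>Each application of the shift uses the vanishing of all moments at the current
    rate, hence the statement for every \<open>k\<close>.\<close>
  have M: "(\<integral>x. (((norm x)\<^sup>2) ^ k * exp (- (1/2 + real j / 4) * (norm x)\<^sup>2)) *\<^sub>R u x \<partial>lborel) = 0" for j k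
  proof (induction j arbitrary: k)
    case 0
    show ?case using mom[of k] by simp
  next
    case (Suc j)
    have e: "1/2 + real (Suc j) / 4 = (1/2 + real j / 4) + 1/4" by (simp add: field_simps)
    have a: "1/2 + real j / 4 \<ge> 1/2" by simp
    show ?case unfolding e by (rule radial_moments_shift[where a = "1/2 + real j / 4", OF um u a Suc.IH])
  qed
  have P: "(\<integral>x. y x ^ j *\<^sub>R w x \<partial>lborel) = 0" for j
  proof -
    have "y x ^ j *\<^sub>R w x = (((norm x)\<^sup>2) ^ 0 * exp (- (1/2 + real j / 4) * (norm x)\<^sup>2)) *\<^sub>R u x" for x
    proof -
      have "y x ^ j * exp (- (1/2) * (norm x)\<^sup>2) = exp (- (1/2 + real j / 4) * (norm x)\<^sup>2)"
      proof -
        have "y x ^ j = exp (real j * (- (1/4) * (norm x)\<^sup>2))" unfolding y_def by (rule exp_of_nat_mult[symmetric])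
        then have "y x ^ j * exp (- (1/2) * (norm x)\<^sup>2) = exp (real j * (- (1/4) * (norm x)\<^sup>2) + - (1/2) * (norm x)\<^sup>2)"
          by (simp only: exp_add)
        then show ?thesis by (simp add: algebra_simps)
      qed
      then show ?thesis by (simp add: w_def)
    qed
    then show ?thesis using M[of 0 j] by simp
  qed
  have "(\<integral>x. G (y x) *\<^sub>R w x \<partial>lborel) = 0"
  proof (rule integral_zero_by_approximation[OF w int[OF G]])
    fix e :: real assume e: "e > 0"
    obtain p where p: "real_polynomial_function p" "\<And>s. s \<in> {0..1} \<Longrightarrow> \<bar>G s - p s\<bar> < e"
      by (rule Stone_Weierstrass_real_polynomial_function[OF compact_Icc G e], rule that)
    obtain a n where an: "p = (\<lambda>s. \<Sum>i\<le>(n::nat). a i * s ^ i)"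
      using real_polynomial_function_imp_sum[OF p(1)] by auto
    have i: "integrable lborel (\<lambda>x. y x ^ j *\<^sub>R w x)" for j
      by (rule int[of "\<lambda>s. s ^ j"]) (intro continuous_intros)
    have e1: "(\<lambda>x. p (y x) *\<^sub>R w x) = (\<lambda>x. \<Sum>j\<le>n. a j *\<^sub>R (y x ^ j *\<^sub>R w x))"
      by (simp add: an scaleR_sum_left fun_eq_iff)
    have "integrable lborel (\<lambda>x. p (y x) *\<^sub>R w x)" "(\<integral>x. p (y x) *\<^sub>R w x \<partial>lborel) = 0"
      unfolding e1 by (intro Bochner_Integration.integrable_sum integrable_scaleR_right i)
        (simp add: i P del: scaleR_scaleR)
    moreover have "\<bar>G (y x) - p (y x)\<bar> \<le> e" for x using p(2)[OF y01[of x]] by simp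
    ultimately show "\<exists>p. integrable lborel (\<lambda>x. p x *\<^sub>R w x) \<and> (\<integral>x. p x *\<^sub>R w x \<partial>lborel) = 0
       \<and> (\<forall>x\<in>space lborel. w x \<noteq> 0 \<longrightarrow> \<bar>G (y x) - p x\<bar> \<le> e)"
      by (intro exI[of _ "\<lambda>x. p (y x)"]) simp
  qed
  then show ?thesis by (simp only: y_def w_def)
qed

text \<open>For \<open>N > 1\<close> a continuous function that is positive exactly between
  \<open>1 / N\<close> and \<open>N\<close>. Vanishing near the origin permits division by
  \<open>r powr beta\<close>, vanishing for large \<open>r\<close> permits division by the
  Gaussian.\<close>

definition cutoff :: "real \<Rightarrow> real \<Rightarrow> real" where
  "cutoff N r = max 0 ((r - 1 / N) * (N - r))"

lemma radial_cutoff_zero: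
  fixes u :: "real ^ 'm \<Rightarrow> complex"
  assumes um: "u \<in> borel_measurable borel"
    and u: "\<And>e. e > 0 \<Longrightarrow> integrable lborel (\<lambda>x. exp (- e * (norm x)\<^sup>2) *\<^sub>R u x)"
    and mom: "\<And>k. (\<integral>x. (((norm x)\<^sup>2) ^ k * exp (- (1/2) * (norm x)\<^sup>2)) *\<^sub>R u x \<partial>lborel) = 0"
    and H: "continuous_on UNIV H" and N: "N > 1"
  shows "(\<integral>x. (H (norm x) * cutoff N (norm x)) *\<^sub>R u x \<partial>lborel) = 0"
proof -
  \<comment> \<open>Inverse of the substitution \<open>s = exp (- r^2 / 4)\<close>. The factor
    \<open>exp ((\<rho> s)^2 / 2)\<close> in \<open>K\<close> cancels the Gaussian of rate
    \<open>1/2\<close>, so \<open>G\<close> reproduces the wanted radial function.\<close>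
  define \<rho> where "\<rho> s = sqrt (- 4 * ln s)" for s :: real
  define y0 where "y0 = exp (- (1/4) * N\<^sup>2)"
  define K where "K s = exp ((\<rho> s)\<^sup>2 / 2) * (H (\<rho> s) * cutoff N (\<rho> s))" for s
  \<comment> \<open>Towards \<open>s = 0\<close> the radius \<open>\<rho> s\<close> grows without
    bound; below \<open>y0\<close>, the image of \<open>r = N\<close>, the cutoff is zero anyway,
    and \<open>K y0 = 0\<close> makes the two pieces fit continuously.\<close>
  define G where "G s = (if s \<le> y0 then 0 else K s)" for s
  have y0: "0 < y0" by (simp add: y0_def)
  have rho: "\<rho> (exp (- (1/4) * r\<^sup>2)) = r" if "r \<ge> 0" for r
    using that by (simp add: \<rho>_def)
  have K0: "K y0 = 0" unfolding K_def y0_def using rho[of N] N by (simp add: cutoff_def)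
  have "continuous_on {0..1} G"
    unfolding G_def
  proof (rule continuous_on_cases_le)
    have r: "continuous_on {s \<in> {0..1}. y0 \<le> s} \<rho>"
      unfolding \<rho>_def by (intro continuous_intros) (use y0 in auto)
    show "continuous_on {s \<in> {0..1}. y0 \<le> s} K"
      unfolding K_def cutoff_def
      by (intro continuous_intros r continuous_on_compose2[OF H r]) auto
  qed (use K0 in \<open>auto intro: continuous_on_id\<close>)
  note Z = radial_continuous_zero[OF um u mom this]
  have "G (exp (- (1/4) * (norm x)\<^sup>2)) *\<^sub>R (exp (- (1/2) * (norm x)\<^sup>2) *\<^sub>R u x) = (H (norm x) * cutoff N (norm x)) *\<^sub>R u x" for x
  proof (cases "norm x < N")
    case True
    then have "exp (- (1/4) * (norm x)\<^sup>2) > y0"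
      using N by (simp add: y0_def power_strict_mono)
    then have "G (exp (- (1/4) * (norm x)\<^sup>2)) = exp ((norm x)\<^sup>2 / 2) * (H (norm x) * cutoff N (norm x))"
      using rho[of "norm x"] by (simp add: G_def K_def)
    moreover have "exp ((norm x)\<^sup>2 / 2) * exp (- (1/2) * (norm x)\<^sup>2) = 1" by (simp flip: exp_add)
    ultimately show ?thesis by (simp add: mult_ac)
  next
    case False
    then have "N\<^sup>2 \<le> (norm x)\<^sup>2" using N by (intro power_mono) auto
    then have "G (exp (- (1/4) * (norm x)\<^sup>2)) = 0" by (simp add: G_def y0_def)
    moreover have "cutoff N (norm x) = 0"
    proof -
      have "1 / N \<le> 1" using N by simp
      then have "1 / N \<le> norm x" using False N by linarith
      then have "(norm x - 1 / N) * (N - norm x) \<le> 0" using False by (intro mult_nonneg_nonpos) auto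
      then show ?thesis by (simp add: cutoff_def)
    qed
    ultimately show ?thesis by simp
  qed
  with Z show ?thesis by (simp only:)
qed

lemma cutoff_nonneg: "0 \<le> cutoff N r"
  by (simp add: cutoff_def)

lemma cutoff_eq_0:
  assumes "N > 1" "r \<le> 1 / N \<or> N \<le> r"
  shows "cutoff N r = 0"
proof -
  have N: "1 / N \<le> 1" using assms(1) by simp
  from assms(2) have "(r - 1 / N) * (N - r) \<le> 0"
  proof
    assume "r \<le> 1 / N"
    moreover from this have "r \<le> N" using N assms(1) by linarith
    ultimately show ?thesis by (intro mult_nonpos_nonneg) simp_all
  next
    assume "N \<le> r"
    moreover from this have "1 / N \<le> r" using N assms(1) by linarith
    ultimately show ?thesis by (intro mult_nonneg_nonpos) simp_all
  qed
  then show ?thesis by (simp add: cutoff_def)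
qed

lemma cutoff_pos: "1 / N < r \<Longrightarrow> r < N \<Longrightarrow> cutoff N r > 0"
  by (simp add: cutoff_def)

text \<open>Domination by a Gaussian of rate 1 reduces integrability of cut-off pairings to square
  integrability of a \<open>gfun\<close>.\<close>

lemma cutoff_bound:
  assumes N: "N > 1" and r: "r \<ge> 0"
  shows "cutoff N r \<le> N * N * exp (N\<^sup>2) * exp (- r\<^sup>2)"
proof (cases "r < N")
  case True
  have N1: "0 \<le> 1 / N" using N by simp
  have "(r - 1 / N) * (N - r) \<le> N * N"
  proof -
    have "(r - 1 / N) * (N - r) \<le> N * (N - r)"
      using True N1 by (intro mult_right_mono) linarith+
    also have "\<dots> \<le> N * N" using N r by (intro mult_left_mono) simp_all
    finally show ?thesis .
  qed
  then have "cutoff N r \<le> N * N" by (simp add: cutoff_def)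
  also have "\<dots> \<le> N * N * (exp (N\<^sup>2) * exp (- r\<^sup>2))"
  proof -
    have "r\<^sup>2 \<le> N\<^sup>2" using True r by (intro power_mono) auto
    then have "1 \<le> exp (N\<^sup>2) * exp (- r\<^sup>2)" by (simp flip: exp_add)
    from mult_left_mono[OF this, of "N * N"] show ?thesis by simp
  qed
  finally show ?thesis by (simp add: mult.assoc)
next
  case False
  then show ?thesis using cutoff_eq_0[OF N, of r] by simp
qed

lemma gfun_power_L2:
  fixes S :: "'m::{finite,linorder} cl_fun"
  assumes c: "c > -1" and S: "hpoly k S" and b: "real k + b \<ge> 0" and y: "y > 0"
  shows "gfun b y (\<lambda>s. s ^ j) S \<in> L2 c"
proof (rule gfun_L2[OF c S _ refl])
  let ?a = "delta TYPE('m) c / 2 - 1 + (real k + b)"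
  have a: "?a > -1" using delta_pos[OF c, where 'm = 'm] b by linarith
  show "integrable lborel (\<lambda>s. if s > 0 then s powr ?a * exp (- (y + y) * s) * (s ^ j * s ^ j) else 0)"
    unfolding power_add[symmetric] using integrable.intros[OF radial_gamma_power[OF a, of "y + y"]] y by simp
qed simp

lemma hdot_cl_blade: "hdot (cl_blade A) v = v $ A"
proof -
  have "hdot (cl_blade A) v = (\<Sum>B\<in>UNIV. if B = A then v $ A else 0)"
    unfolding hdot_def by (intro sum.cong refl) (auto simp: cl_blade_def axis_def)
  then show ?thesis by simp
qed

lemma L2_weighted_hdot_integrable:
  assumes "f \<in> L2 c" "g \<in> L2 c"
  shows "integrable lborel (\<lambda>x. weight c x *\<^sub>R hdot (f x) (g x))"
proof -
  have m: "(\<lambda>x. hdot (f x) (g x)) \<in> borel_measurable borel"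
    using assms by (auto simp: L2_def)
  show ?thesis
    using integrable_hdot[OF assms[unfolded L2_eq_sq_int]] unfolding integral_wmeas(1)[OF m] .
qed

lemma L2_iprod_lborel:
  assumes "f \<in> L2 c" "g \<in> L2 c"
  shows "iprod (wmeas c) f g = (\<integral>x. weight c x *\<^sub>R hdot (f x) (g x) \<partial>lborel)"
proof -
  have m: "(\<lambda>x. hdot (f x) (g x)) \<in> borel_measurable borel"
    using assms by (auto simp: L2_def)
  show ?thesis unfolding iprod_def by (rule integral_wmeas(2)[OF m])
qed

lemma cutoff_hdot_integrable:
  fixes P f :: "'m::{finite,linorder} cl_fun"
  assumes c: "c > -1" and f: "f \<in> L2 c" and P: "hpoly k P" and N: "N > 1"
  shows "integrable lborel (\<lambda>x. (cutoff N (norm x) * weight c x) *\<^sub>R hdot (P x) (f x))"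
proof -
  define C where "C = N * N * exp (N\<^sup>2)"
  have C: "C \<ge> 0" using N by (simp add: C_def)
  have [measurable]: "f \<in> borel_measurable borel" "P \<in> borel_measurable borel"
    using f hpoly_measurable[OF P] by (auto simp: L2_def)
  have [measurable]: "cutoff N \<in> borel_measurable borel" unfolding cutoff_def[abs_def] by measurable
  have g: "gfun 0 1 (\<lambda>s. s ^ 0) P \<in> L2 c" by (rule gfun_power_L2[OF c P]) auto
  have b: "norm ((cutoff N (norm x) * weight c x) *\<^sub>R hdot (P x) (f x))
     \<le> norm (C *\<^sub>R (weight c x *\<^sub>R hdot (gfun 0 1 (\<lambda>s. s ^ 0) P x) (f x)))" if "x \<noteq> 0" for x
  proof -
    have "cutoff N (norm x) * (weight c x * norm (hdot (P x) (f x)))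
        \<le> C * exp (- (norm x)\<^sup>2) * (weight c x * norm (hdot (P x) (f x)))"
      using cutoff_bound[OF N norm_ge_zero[of x]] by (intro mult_right_mono) (auto simp: C_def)
    then show ?thesis
      using C that by (simp add: gfun_def hdot_scaleR_left norm_mult cutoff_nonneg mult_ac)
  qed
  show ?thesis
  proof (rule Bochner_Integration.integrable_bound)
    show "integrable lborel (\<lambda>x. C *\<^sub>R (weight c x *\<^sub>R hdot (gfun 0 1 (\<lambda>s. s ^ 0) P x) (f x)))"
      by (intro integrable_scaleR_right L2_weighted_hdot_integrable g f)
    show "AE x in lborel. norm ((cutoff N (norm x) * weight c x) *\<^sub>R hdot (P x) (f x))
     \<le> norm (C *\<^sub>R (weight c x *\<^sub>R hdot (gfun 0 1 (\<lambda>s. s ^ 0) P x) (f x)))"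
      using AE_lborel_nonzero by eventually_elim (rule b)
  qed measurable
qed

lemma gfun_laguerre_sum:
  "gfun b y (laguerre k a) S x
    = (\<Sum>i\<le>k. of_real ((-1) ^ i * ((real k + a) gchoose (k - i)) / fact i) *s gfun b y (\<lambda>s. s ^ i) S x)"
  unfolding gfun_def laguerre_def scaleR_eq_scale[symmetric] scaleR_scaleR scaleR_sum_left[symmetric]
  by (simp only: sum_distrib_left times_divide_eq_right times_divide_eq_left mult_ac)

text \<open>Strong induction on \<open>k\<close>: the basis function with \<open>n = 2 k + p\<close>
  has a Laguerre polynomial of degree \<open>k\<close>, whose leading coefficient is nonzero and
  whose lower monomials are covered by the induction hypothesis.\<close>

lemma moments_zero:
  fixes Mb :: "nat \<Rightarrow> nat \<Rightarrow> 'm::{finite,linorder} cl_fun"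
  assumes c: "c > -1" and mb: "monogenic_basis d Mb" and f: "f \<in> L2 c"
    and orth: "\<And>i. i \<in> idx d \<Longrightarrow> iprod (wmeas c) (bas c Mb 0 i) f = 0"
    and j: "j < d l" and p: "p < 2"
  shows "iprod (wmeas c) f (gfun (beta c l) (1/2) (\<lambda>s. s ^ k) (ang Mb p l j)) = 0"
proof (induction k rule: less_induct)
  case (less k)
  define S where "S = ang Mb p l j"
  define a where "a = alph TYPE('m) c p l"
  define co where "co i = ((-1) ^ i * ((real k + a) gchoose (k - i)) / fact i)" for i :: nat
  let ?g = "\<lambda>i. gfun (beta c l) (1/2) (\<lambda>s. s ^ i) S"
  define n where "n = 2 * k + p"
  have n: "n div 2 = k" "alph TYPE('m) c n l = a" "ang Mb n l j = S"
    using p by (auto simp: n_def a_def alph_def S_def ang_def)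
  have b0: "real (l + p mod 2) + beta c l \<ge> 0"
  proof -
    have "0 \<le> real l / (1 + c)" using c by simp
    then show ?thesis using beta_add[OF c, of l] by simp
  qed
  have g: "?g i \<in> sq_int (wmeas c)" for i
    using gfun_power_L2[OF c hpoly_ang[OF mb j, of p] b0, of "1/2" i] by (simp add: S_def L2_eq_sq_int)
  have f': "f \<in> sq_int (wmeas c)" using f by (simp add: L2_eq_sq_int)
  have "iprod (wmeas c) (bas c Mb 0 (n, l, j)) f = 0"
    by (rule orth) (use j in \<open>simp add: idx_def\<close>)
  then have "of_real (lag_norm k a) * iprod (wmeas c) (gfun (beta c l) (1/2) (laguerre k a) S) f = 0"
    by (simp add: bas_def n iprod_scaleR_left)
  moreover have "lag_norm k a > 0" unfolding a_def by (rule lag_norm_pos[OF alph_gt[OF c]])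
  ultimately have "iprod (wmeas c) (gfun (beta c l) (1/2) (laguerre k a) S) f = 0" by simp
  then have "cnj (iprod (wmeas c) f (gfun (beta c l) (1/2) (laguerre k a) S)) = 0"
    by (simp only: cnj_iprod)
  then have "iprod (wmeas c) f (gfun (beta c l) (1/2) (laguerre k a) S) = 0" by simp
  moreover have "gfun (beta c l) (1/2) (laguerre k a) S = (\<lambda>x. \<Sum>i\<le>k. of_real (co i) *s ?g i x)"
    unfolding co_def by (rule ext) (rule gfun_laguerre_sum)
  ultimately have "iprod (wmeas c) f (\<lambda>x. \<Sum>i\<le>k. of_real (co i) *s ?g i x) = 0" by (simp only:)
  then have "(\<Sum>i\<le>k. of_real (co i) * iprod (wmeas c) f (?g i)) = 0"
    by (subst (asm) iprod_sum_right[OF f' sq_int_scale[OF g]]) (simp only: iprod_scale_right)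
  moreover have "(\<Sum>i\<le>k. of_real (co i) * iprod (wmeas c) f (?g i)) = of_real (co k) * iprod (wmeas c) f (?g k)"
  proof -
    have "(\<Sum>i\<le>k. of_real (co i) * iprod (wmeas c) f (?g i)) = (\<Sum>i\<in>{k}. of_real (co i) * iprod (wmeas c) f (?g i))"
      by (rule sum.mono_neutral_right) (use less.IH in \<open>auto simp: S_def\<close>)
    then show ?thesis by simp
  qed
  moreover have "co k \<noteq> 0" by (simp add: co_def)
  ultimately show ?case by (simp add: S_def)
qed

text \<open>The moments contain the factor \<open>r powr beta\<close>. On the support of the cutoff
  it is cancelled by its reciprocal, and a power \<open>r^q\<close> is inserted to account for even
  powers of the vector \<open>x\<close>.\<close>

lemma cutoff_ang_zero:
  fixes Mb :: "nat \<Rightarrow> nat \<Rightarrow> 'm::{finite,linorder} cl_fun"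
  assumes c: "c > -1" and mb: "monogenic_basis d Mb" and f: "f \<in> L2 c"
    and orth: "\<And>i. i \<in> idx d \<Longrightarrow> iprod (wmeas c) (bas c Mb 0 i) f = 0"
    and j: "j < d l" and p: "p < 2" and N: "N > 1"
  shows "(\<integral>x. (cutoff N (norm x) * weight c x) *\<^sub>R hdot (norm x ^ q *\<^sub>R ang Mb p l j x) (f x) \<partial>lborel) = 0"
proof -
  define S where "S = ang Mb p l j"
  define b where "b = beta c l"
  have S: "hpoly (l + p mod 2) S" unfolding S_def by (rule hpoly_ang[OF mb j])
  have b0: "real (l + p mod 2) + b \<ge> 0"
  proof -
    have "0 \<le> real l / (1 + c)" using c by simp
    then show ?thesis using beta_add[OF c, of l] by (simp add: b_def)
  qed
  have fm [measurable]: "f \<in> borel_measurable borel" using f by (simp add: L2_def)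
  have Sm [measurable]: "S \<in> borel_measurable borel" by (rule hpoly_measurable[OF S])
  define u where "u x = (weight c x * norm x powr b) *\<^sub>R hdot (S x) (f x)" for x :: "(real, 'm) vec"
  have um: "u \<in> borel_measurable borel" unfolding u_def[abs_def] by measurable
  have ug: "(((norm x)\<^sup>2) ^ k * exp (- e * (norm x)\<^sup>2)) *\<^sub>R u x = weight c x *\<^sub>R hdot (gfun b e (\<lambda>s. s ^ k) S x) (f x)" for e k x
    by (simp add: u_def gfun_def hdot_scaleR_left scaleR_complex_conv mult_ac)
  \<comment> \<open>Replacing \<open>r\<close> by \<open>max r (1 / N)\<close> keeps the reciprocal
    power continuous at the origin and changes nothing where the cutoff is positive.\<close>
  have "(\<integral>x. ((max (norm x) (1 / N) powr (- b) * norm x ^ q) * cutoff N (norm x)) *\<^sub>R u x \<partial>lborel) = 0"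
  proof (rule radial_cutoff_zero[OF um, where H = "\<lambda>r. max r (1 / N) powr (- b) * r ^ q"])
    show "integrable lborel (\<lambda>x. exp (- e * (norm x)\<^sup>2) *\<^sub>R u x)" if "e > 0" for e
      using L2_weighted_hdot_integrable[OF gfun_power_L2[OF c S b0 that, of 0] f] ug[of _ 0 e] by simp
    show "(\<integral>x. (((norm x)\<^sup>2) ^ k * exp (- (1/2) * (norm x)\<^sup>2)) *\<^sub>R u x \<partial>lborel) = 0" for k
    proof -
      have g: "gfun b (1/2) (\<lambda>s. s ^ k) S \<in> L2 c" by (rule gfun_power_L2[OF c S b0]) simp
      have "iprod (wmeas c) f (gfun b (1/2) (\<lambda>s. s ^ k) S) = 0"
        unfolding b_def S_def by (rule moments_zero[OF c mb f orth j p])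
      then have "cnj (iprod (wmeas c) (gfun b (1/2) (\<lambda>s. s ^ k) S) f) = 0" by (simp only: cnj_iprod)
      then have "iprod (wmeas c) (gfun b (1/2) (\<lambda>s. s ^ k) S) f = 0" by simp
      then show ?thesis unfolding ug L2_iprod_lborel[OF g f] .
    qed
    have "max r (1 / N) \<noteq> 0" for r
    proof -
      have "0 < 1 / N" using N by simp
      also have "\<dots> \<le> max r (1 / N)" by simp
      finally show ?thesis by simp
    qed
    then show "continuous_on UNIV (\<lambda>r. max r (1 / N) powr (- b) * r ^ q)"
      by (intro continuous_intros) auto
  qed (rule N)
  moreover have "((max (norm x) (1 / N) powr (- b) * norm x ^ q) * cutoff N (norm x)) *\<^sub>R u x
      = (cutoff N (norm x) * weight c x) *\<^sub>R hdot (norm x ^ q *\<^sub>R S x) (f x)" for x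
  proof (cases "norm x \<le> 1 / N")
    case True
    then show ?thesis using cutoff_eq_0[OF N, of "norm x"] by simp
  next
    case False
    have "0 < 1 / N" using N by simp
    then have r: "norm x > 0" using False by linarith
    have "max (norm x) (1 / N) powr (- b) * norm x powr b = 1"
      using False r by (simp add: max_def powr_minus)
    then have e: "max (norm x) (1 / N) powr (- b) * norm x ^ q * cutoff N (norm x) * (weight c x * norm x powr b)
       = cutoff N (norm x) * weight c x * norm x ^ q"
      by (metis (no_types, opaque_lifting) mult.assoc mult.commute mult_1)
    show ?thesis unfolding u_def scaleR_scaleR e by (simp add: hdot_scaleR_left scaleR_complex_conv)
  qed
  ultimately show ?thesis by (simp only: S_def)
qed

lemma xpow_sum: "xpow s x (\<Sum>i\<in>I. a i *\<^sub>R v i) = (\<Sum>i\<in>I. a i *\<^sub>R xpow s x (v i))"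
  by (induction s) (simp_all add: cl_mult_sum_right cl_mult_scaleR_right)

theorem bas_complete:
  fixes Mb :: "nat \<Rightarrow> nat \<Rightarrow> 'm::{finite,linorder} cl_fun"
  assumes c: "c > -1" and mb: "monogenic_basis d Mb" and f: "f \<in> L2 c"
    and orth: "\<And>i. i \<in> idx d \<Longrightarrow> iprod (wmeas c) (bas c Mb 0 i) f = 0"
  shows "AE x in lborel. f x = 0"
proof -
  have fm [measurable]: "f \<in> borel_measurable borel" using f by (simp add: L2_def)
  \<comment> \<open>Pairing of a polynomial with the cut-off \<open>f\<close>. It is shown to vanish
    on \<open>x^s M\<close>, hence on Fischer sums, hence on all polynomials with real Clifford
    coefficients.\<close>
  define \<Phi> where "\<Phi> N P = (\<integral>x. (cutoff N (norm x) * weight c x) *\<^sub>R hdot (P x) (f x) \<partial>lborel)" for N and P :: "'m cl_fun"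
  have int: "integrable lborel (\<lambda>x. (cutoff N (norm x) * weight c x) *\<^sub>R hdot (P x) (f x))"
    if "hpoly k P" "N > 1" for k N P
    by (rule cutoff_hdot_integrable[OF c f that])
  \<comment> \<open>Since \<open>x x = - r^2\<close>, an even power of \<open>x\<close> is a power
    of \<open>r\<close> up to sign and an odd one leaves a single factor \<open>x\<close>: these are
    the two kinds of angular functions in \<open>ang\<close>.\<close>
  have base: "\<Phi> N (\<lambda>x. xpow s x (Mb l j x)) = 0" if N: "N > 1" and j: "j < d l" for N s l j
  proof (cases "even s")
    case True
    then obtain t where s: "s = 2 * t" by (elim evenE)
    have x: "(cutoff N (norm x) * weight c x) *\<^sub>R hdot (xpow s x (Mb l j x)) (f x)
      = (-1) ^ t *\<^sub>R ((cutoff N (norm x) * weight c x) *\<^sub>R hdot (norm x ^ s *\<^sub>R ang Mb 0 l j x) (f x))" for x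
      by (simp only: s xpow_double ang_def hdot_scaleR_left) (simp add: scaleR_complex_conv mult_ac)
    show ?thesis unfolding \<Phi>_def x integral_scaleR_right
      using cutoff_ang_zero[OF c mb f orth j _ N, of 0 s] by simp
  next
    case False
    then obtain t where s: "s = Suc (2 * t)" by (elim oddE) auto
    have x: "(cutoff N (norm x) * weight c x) *\<^sub>R hdot (xpow s x (Mb l j x)) (f x)
      = (-1) ^ t *\<^sub>R ((cutoff N (norm x) * weight c x) *\<^sub>R hdot (norm x ^ (2 * t) *\<^sub>R ang Mb 1 l j x) (f x))" for x
      by (simp only: s xpow.simps xpow_double ang_def hdot_scaleR_left cl_mult_scaleR_right)
        (simp add: scaleR_complex_conv hdot_scaleR_left mult_ac)
    show ?thesis unfolding \<Phi>_def x integral_scaleR_right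
      using cutoff_ang_zero[OF c mb f orth j _ N, of 1 "2 * t"] by simp
  qed
  have fis: "\<Phi> N P = 0" if "fischer_sum k P" and N: "N > 1" for N k P
    using that(1)
  proof (induction rule: fischer_sum.induct)
    case (fischer_term l M s)
    have "M \<in> monogenics l" by (rule monogenics_hpolyI[OF fischer_term])
    then obtain a :: "nat \<Rightarrow> real" where M: "\<And>x. M x = (\<Sum>j<d l. a j *\<^sub>R Mb l j x)"
      using mb unfolding monogenic_basis_def by blast
    have x: "(cutoff N (norm x) * weight c x) *\<^sub>R hdot (xpow s x (M x)) (f x)
      = (\<Sum>j<d l. a j *\<^sub>R ((cutoff N (norm x) * weight c x) *\<^sub>R hdot (xpow s x (Mb l j x)) (f x)))" for x
      by (simp only: M xpow_sum hdot_sum_left hdot_scaleR_left scaleR_complex_conv sum_distrib_left)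
        (simp only: mult_ac)
    have i: "integrable lborel (\<lambda>x. (cutoff N (norm x) * weight c x) *\<^sub>R hdot (xpow s x (Mb l j x)) (f x))"
      if "j < d l" for j
      by (rule int[OF hpoly_xpow[OF monogenic_basisD(1)[OF mb that]] N])
    have "\<Phi> N (\<lambda>x. xpow s x (M x)) = (\<Sum>j<d l. a j *\<^sub>R \<Phi> N (\<lambda>x. xpow s x (Mb l j x)))"
      unfolding \<Phi>_def x
      by (subst Bochner_Integration.integral_sum) (auto intro!: integrable_scaleR_right i simp del: scaleR_scaleR)
    then show ?case by (simp add: base[OF N])
  next
    case (fischer_add k P Q)
    have "\<Phi> N (\<lambda>x. P x + Q x) = \<Phi> N P + \<Phi> N Q"
      unfolding \<Phi>_def hdot_add_left scaleR_add_right
      by (intro Bochner_Integration.integral_add int[OF fischer_sum_hpoly[OF fischer_add.hyps(1)] N]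
          int[OF fischer_sum_hpoly[OF fischer_add.hyps(2)] N])
    then show ?case using fischer_add.IH by simp
  qed
  have hs: "integrable lborel (\<lambda>x. (cutoff N (norm x) * weight c x) *\<^sub>R hdot (P x) (f x)) \<and> \<Phi> N P = 0"
    if "hsum P" and N: "N > 1" for N P
    using that(1)
  proof (induction rule: hsum.induct)
    case (hsum_hpoly k P)
    then show ?case using int[OF hsum_hpoly N] fis[OF fischer_decomposition N] by blast
  next
    case (hsum_add P Q)
    then show ?case
      unfolding \<Phi>_def hdot_add_left scaleR_add_right by simp
  qed
  \<comment> \<open>Pairing with \<open>p x\<close> times a blade isolates one coefficient of
    \<open>f\<close>. The radii \<open>N + 2\<close> exceed 1, as the cutoff requires, and their
    shells exhaust the space without the origin.\<close>
  have "AE x in lborel. cutoff (real N + 2) (norm x) *\<^sub>R (weight c x *\<^sub>R (f x $ A)) = 0" for A and N :: nat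
  proof -
    define n where "n = real N + 2"
    have n: "n > 1" by (simp add: n_def)
    have "AE x in lborel. (cutoff n (norm x) * weight c x) *\<^sub>R (f x $ A) = 0"
    proof (rule AE_zero_if_polynomial_moments_zero[where R = n])
      have "hpoly 0 (\<lambda>x. cl_blade A)" by (intro hpoly_const cl_real_blade)
      from int[OF this n] show "integrable lborel (\<lambda>x. (cutoff n (norm x) * weight c x) *\<^sub>R (f x $ A))"
        by (simp only: hdot_cl_blade)
      show "(cutoff n (norm x) * weight c x) *\<^sub>R (f x $ A) = 0" if "norm x > n" for x
        using cutoff_eq_0[OF n, of "norm x"] that by simp
      fix p :: "(real, 'm) vec \<Rightarrow> real" assume p: "real_polynomial_function p"
      have "hsum (\<lambda>x. p x *\<^sub>R cl_blade A)"
        by (intro hsum_real_polynomial_mult p hsum_hpoly[of 0] hpoly_const cl_real_blade)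
      from hs[OF this n] have "(\<integral>x. (cutoff n (norm x) * weight c x) *\<^sub>R hdot (p x *\<^sub>R cl_blade A) (f x) \<partial>lborel) = 0"
        unfolding \<Phi>_def by blast
      moreover have "(cutoff n (norm x) * weight c x) *\<^sub>R hdot (p x *\<^sub>R cl_blade A) (f x)
          = p x *\<^sub>R ((cutoff n (norm x) * weight c x) *\<^sub>R (f x $ A))" for x
        by (simp only: hdot_scaleR_left hdot_cl_blade scaleR_complex_conv mult_ac)
      ultimately show "(\<integral>x. p x *\<^sub>R ((cutoff n (norm x) * weight c x) *\<^sub>R (f x $ A)) \<partial>lborel) = 0"
        by (simp only:)
    qed
    then show ?thesis by (simp add: n_def)
  qed
  then have "AE x in lborel. \<forall>N::nat. \<forall>A. cutoff (real N + 2) (norm x) *\<^sub>R (weight c x *\<^sub>R (f x $ A)) = 0"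
    unfolding AE_all_countable by (intro allI)
  then show ?thesis
    using AE_lborel_nonzero
  proof eventually_elim
    case (elim x)
    have r: "norm x > 0" using elim(2) by simp
    obtain N :: nat where N: "real N \<ge> max (norm x) (1 / norm x)" using real_arch_simple by blast
    have "1 / (real N + 2) < norm x"
    proof -
      have "1 / norm x < real N + 2" using N by simp
      then have "1 < (real N + 2) * norm x" using r by (simp add: divide_less_eq)
      moreover have "0 < real N + 2" by linarith
      ultimately show ?thesis by (simp add: divide_less_eq mult.commute)
    qed
    moreover have "norm x < real N + 2" using N by simp
    ultimately have cp: "cutoff (real N + 2) (norm x) > 0" by (rule cutoff_pos)
    have w: "weight c x > 0" using r by (simp add: weight_def)
    have "f x $ A = 0" for A
      using elim(1)[rule_format, of N A] cp w by simp
    then show ?case by (simp add: vec_eq_iff)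
  qed
qed

section \<open>The inequality\<close>

lemma bas_parseval:
  assumes c: "c > -1" and mb: "monogenic_basis d Mb" and g: "g \<in> L2 c"
  shows "((\<lambda>i. (cmod (iprod (wmeas c) (bas c Mb 0 i) g))\<^sup>2) has_sum nsq (wmeas c) g) (idx d)"
proof (rule parseval[OF bas_orthonormal[OF c mb]])
  show "g \<in> sq_int (wmeas c)" using g by (simp add: L2_eq_sq_int)
  show "AE x in wmeas c. h x = 0" if "h \<in> sq_int (wmeas c)" "\<And>i. i \<in> idx d \<Longrightarrow> iprod (wmeas c) (bas c Mb 0 i) h = 0" for h
    unfolding AE_wmeas using bas_complete[OF c mb _ that(2)] that(1) by (simp add: L2_eq_sq_int)
qed simp

lemma L2_eq_by_coefficients:
  assumes c: "c > -1" and mb: "monogenic_basis d Mb" and g: "g \<in> L2 c" and h: "h \<in> L2 c"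
    and eq: "\<And>i. i \<in> idx d \<Longrightarrow> iprod (wmeas c) (bas c Mb 0 i) g = iprod (wmeas c) (bas c Mb 0 i) h"
  shows "AE x in lborel. g x = h x"
proof -
  have gh: "g \<in> sq_int (wmeas c)" "h \<in> sq_int (wmeas c)" using g h by (simp_all add: L2_eq_sq_int)
  have "AE x in lborel. g x - h x = 0"
  proof (rule bas_complete[OF c mb])
    show "(\<lambda>x. g x - h x) \<in> L2 c" using sq_int_diff[OF gh] by (simp add: L2_eq_sq_int)
    fix i assume i: "i \<in> idx d"
    have "bas c Mb 0 i \<in> sq_int (wmeas c)" by (rule orthonormalD(1)[OF bas_orthonormal[OF c mb] i]) simp
    then show "iprod (wmeas c) (bas c Mb 0 i) (\<lambda>x. g x - h x) = 0"
      using eq[OF i] by (simp add: iprod_diff_right gh)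
  qed
  then show ?thesis by eventually_elim simp
qed

lemma cl_vec_mult_measurable:
  fixes f :: "'m::{finite,linorder} cl_fun"
  assumes [measurable]: "f \<in> borel_measurable borel"
  shows "(\<lambda>x. cl_vec x \<odot> f x) \<in> borel_measurable borel"
proof -
  have "linear (cl_vec :: (real, 'm) vec \<Rightarrow> _)"
    unfolding cl_vec_def by (auto intro!: linearI simp: scaleR_add_left sum.distrib scaleR_sum_right)
  then have v: "continuous_on UNIV (cl_vec :: (real, 'm) vec \<Rightarrow> _)"
    by (simp add: linear_continuous_on linear_conv_bounded_linear)
  have "continuous_on UNIV (\<lambda>p :: (real, 'm) vec \<times> 'm clifford. cl_vec (fst p) \<odot> snd p)"
    by (intro bounded_bilinear.continuous_on[OF bounded_bilinear_cl_mult] continuous_on_compose2[OF v] continuous_intros) auto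
  from borel_measurable_continuous_on[OF this, of "\<lambda>x. (x, f x)" borel] show ?thesis
    by (simp add: borel_prod[symmetric])
qed

section \<open>Multiplication by \<open>r\<close> and the action of the transform on
  coefficients\<close>

definition rmult :: "'m::{finite,linorder} cl_fun \<Rightarrow> 'm cl_fun" where
  "rmult f x = norm x *\<^sub>R f x"

lemma rmult_measurable: "f \<in> borel_measurable borel \<Longrightarrow> rmult f \<in> borel_measurable borel"
  unfolding rmult_def[abs_def] by measurable

lemma L2_norm_cl_vec:
  assumes f: "f \<in> borel_measurable borel"
  shows "L2_norm c (\<lambda>x. cl_vec x \<odot> f x)
    = (if rmult f \<in> L2 c then ennreal (sqrt (nsq (wmeas c) (rmult f))) else \<infinity>)"
proof -
  have n: "norm (cl_vec x \<odot> f x) = norm (rmult f x)" for x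
    by (simp add: norm_cl_vec_mult rmult_def)
  have iff: "(\<lambda>x. cl_vec x \<odot> f x) \<in> L2 c \<longleftrightarrow> rmult f \<in> L2 c"
    using cl_vec_mult_measurable[OF f] rmult_measurable[OF f] by (simp add: L2_eq_sq_int sq_int_def n)
  have "nsq (wmeas c) (\<lambda>x. cl_vec x \<odot> f x) = nsq (wmeas c) (rmult f)"
    by (simp add: nsq_def n)
  then show ?thesis using iff L2_norm_eq[of "\<lambda>x. cl_vec x \<odot> f x" c]
    by (cases "rmult f \<in> L2 c") (simp_all add: L2_norm_def)
qed

lemma nsq_zero_AE:
  assumes "f \<in> L2 c"
  shows "nsq (wmeas c) f = 0 \<longleftrightarrow> (AE x in lborel. f x = 0)"
  using nsq_eq_zero[of f "wmeas c"] assms by (simp add: L2_eq_sq_int AE_wmeas)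

definition eig :: "real \<Rightarrow> nat \<Rightarrow> nat \<Rightarrow> complex" where
  "eig c n l = (- \<i>) ^ n * exp (- (\<i> * of_real (pi * real l / (2 * (1 + c)))))"

lemma cmod_eig: "cmod (eig c n l) = 1"
  by (simp add: eig_def norm_mult norm_power norm_exp_eq_Re)

lemma eig_Suc_Suc: "eig c (n + 2) l = - eig c n l"
  by (simp add: eig_def power_add power2_eq_square)

text \<open>Unitarity moves the transform to the basis function: the inner product of
  \<open>F e\<close> and \<open>F f\<close> is that of \<open>e\<close> and \<open>f\<close>, and
  \<open>F e\<close> is \<open>eig\<close> times \<open>e\<close>. As \<open>eig\<close> is
  unimodular, its conjugate is removed by multiplying with \<open>eig\<close>.\<close>

lemma fourier_coefficient:
  fixes Mb :: "nat \<Rightarrow> nat \<Rightarrow> 'm::{finite,linorder} cl_fun"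
  assumes c: "c > -1" and mb: "monogenic_basis d Mb" and F: "deformed_fourier c d Mb F" and f: "f \<in> L2 c"
    and j: "j < d l"
  shows "iprod (wmeas c) (bas c Mb 0 (n, l, j)) (F f) = eig c n l * iprod (wmeas c) (bas c Mb 0 (n, l, j)) f"
proof -
  let ?e = "bas c Mb 0 (n, l, j)"
  have U: "unitary_on_L2 c F" using F by (simp add: deformed_fourier_def)
  have Ff: "F f \<in> L2 c" using U f by (simp add: unitary_on_L2_def)
  have e: "?e \<in> L2 c" by (rule bas_L2[OF c mb]) (use j in \<open>simp_all add: idx_def\<close>)
  have Fe: "F ?e \<in> L2 c" using U e by (simp add: unitary_on_L2_def)
  obtain k where k: "k \<noteq> 0" "phi c n l (Mb l j) = (\<lambda>x. k *\<^sub>R ?e x)" using phi_bas[OF c] by blast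
  have ph: "phi c n l (Mb l j) \<in> L2 c" unfolding k(2) using e by (simp add: L2_eq_sq_int sq_int_scaleR)
  \<comment> \<open>The eigenvalue equation is given for \<open>phi\<close>; homogeneity of
    \<open>F\<close> carries it to the normalised multiple.\<close>
  have ek: "?e = (\<lambda>x. of_real (1 / k) *s phi c n l (Mb l j) x)"
    by (rule ext) (use k(1) in \<open>simp add: k(2) scaleR_eq_scale[symmetric] del: of_real_divide\<close>)
  have "AE x in lborel. F (\<lambda>y. of_real (1 / k) *s phi c n l (Mb l j) y) x = of_real (1 / k) *s F (phi c n l (Mb l j)) x"
    using U ph unfolding unitary_on_L2_def by blast
  moreover have "AE x in lborel. F (phi c n l (Mb l j)) x = eig c n l *s phi c n l (Mb l j) x"
    using F j unfolding deformed_fourier_def eig_def by blast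
  ultimately have "AE x in lborel. F ?e x = eig c n l *s ?e x"
    unfolding ek[symmetric]
  proof eventually_elim
    case (elim x)
    have "?e x = of_real (1 / k) *s phi c n l (Mb l j) x" using ek by (rule fun_cong)
    with elim show ?case by (simp add: vector_smult_assoc mult.commute)
  qed
  then have "iprod (wmeas c) (F ?e) (F f) = iprod (wmeas c) (\<lambda>x. eig c n l *s ?e x) (F f)"
    using Fe e Ff by (intro iprod_cong_AE) (auto simp: AE_wmeas L2_def intro!: borel_measurable_vec_scale)
  also have "\<dots> = cnj (eig c n l) * iprod (wmeas c) ?e (F f)" by (rule iprod_scale_left)
  also have "iprod (wmeas c) (F ?e) (F f) = iprod (wmeas c) ?e f"
  proof -
    have "L2_inner c (F ?e) (F f) = L2_inner c ?e f" using U e f unfolding unitary_on_L2_def by blast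
    then show ?thesis by (simp only: L2_inner_eq_iprod[OF Fe Ff] L2_inner_eq_iprod[OF e f])
  qed
  finally have 1: "cnj (eig c n l) * iprod (wmeas c) ?e (F f) = iprod (wmeas c) ?e f" ..
  have "eig c n l * cnj (eig c n l) = 1"
    using complex_norm_square[of "eig c n l"] by (simp add: cmod_eig)
  then have "iprod (wmeas c) ?e (F f) = eig c n l * (cnj (eig c n l) * iprod (wmeas c) ?e (F f))"
    by (simp only: mult.assoc[symmetric] mult_1)
  then show ?thesis unfolding 1 .
qed

text \<open>The factor \<open>r\<close> is real and moves to the basis function, where
  \<open>norm_mult_bas\<close> splits the product into two members of the first system. Thus the
  formula makes sense for every \<open>g\<close> in the space.\<close>

lemma rmult_coefficient:
  fixes Mb :: "nat \<Rightarrow> nat \<Rightarrow> 'm::{finite,linorder} cl_fun"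
  assumes c: "c > -1" and mb: "monogenic_basis d Mb" and g: "g \<in> L2 c" and j: "j < d l"
  shows "iprod (wmeas c) (bas c Mb 1 (n, l, j)) (rmult g)
    = of_real (sqrt (real (n div 2) + alph TYPE('m) c n l + 1)) * iprod (wmeas c) (bas c Mb 0 (n, l, j)) g
      - of_real (sqrt (real (n div 2) + 1)) * iprod (wmeas c) (bas c Mb 0 (n + 2, l, j)) g"
proof -
  let ?A = "sqrt (real (n div 2) + alph TYPE('m) c n l + 1)" and ?B = "sqrt (real (n div 2) + 1)"
  have e: "bas c Mb 0 (k, l, j) \<in> sq_int (wmeas c)" for k
    using bas_L2[OF c mb, of 0 "(k, l, j)"] j by (simp add: idx_def L2_eq_sq_int)
  have g': "g \<in> sq_int (wmeas c)" using g by (simp add: L2_eq_sq_int)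
  have "iprod (wmeas c) (bas c Mb 1 (n, l, j)) (rmult g) = iprod (wmeas c) (\<lambda>x. norm x *\<^sub>R bas c Mb 1 (n, l, j) x) g"
    by (simp add: iprod_def rmult_def hdot_scaleR_left hdot_scaleR_right)
  also have "\<dots> = iprod (wmeas c) (\<lambda>x. ?A *\<^sub>R bas c Mb 0 (n, l, j) x - ?B *\<^sub>R bas c Mb 0 (n + 2, l, j) x) g"
    by (simp only: norm_mult_bas[OF c])
  also have "\<dots> = iprod (wmeas c) (\<lambda>x. ?A *\<^sub>R bas c Mb 0 (n, l, j) x) g - iprod (wmeas c) (\<lambda>x. ?B *\<^sub>R bas c Mb 0 (n + 2, l, j) x) g"
    by (rule iprod_diff_left[OF g' sq_int_scaleR[OF e] sq_int_scaleR[OF e]])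
  finally show ?thesis by (simp only: iprod_scaleR_left)
qed

lemma has_sum_diff_real:
  fixes f g :: "'a \<Rightarrow> real"
  assumes "(f has_sum a) I" "(g has_sum b) I"
  shows "((\<lambda>i. f i - g i) has_sum (a - b)) I"
  using has_sum_add[OF assms(1) has_sum_cmult_right[OF assms(2), of "-1"]] by simp

text \<open>The parallelogram identity, and the expansion of a square whose cross term is
  \<open>|p|^2 - |q|^2\<close>. With \<open>p = P i\<close> and \<open>q = Q i\<close> the second is
  the quadratic form in \<open>t\<close> behind the Cauchy-Schwarz inequality.\<close>

lemma cmod_diff_sum_squares:
  "(cmod (p - q))\<^sup>2 + (cmod (p + q))\<^sup>2 = 2 * (cmod p)\<^sup>2 + 2 * (cmod q)\<^sup>2"
  "(cmod (of_real t * (p - q) - (p + q)))\<^sup>2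
     = t\<^sup>2 * (cmod (p - q))\<^sup>2 + (cmod (p + q))\<^sup>2 - 2 * t * ((cmod p)\<^sup>2 - (cmod q)\<^sup>2)"
  unfolding cmod_power2 by (simp_all add: power2_eq_square algebra_simps)

text \<open>The two weighted norms are \<open>\<parallel>P - Q\<parallel>\<close> and \<open>\<parallel>P + Q\<parallel>\<close> for the raising and lowering parts \<open>P\<close>, \<open>Q\<close>
  of the coefficient sequence, and \<open>\<parallel>P\<parallel>\<^sup>2 - \<parallel>Q\<parallel>\<^sup>2\<close> is a weighted sum of the squared coefficients.\<close>

lemma uncertainty_coefficients:
  fixes Mb :: "nat \<Rightarrow> nat \<Rightarrow> 'm::{finite,linorder} cl_fun" and f and c :: real
  defines "q \<equiv> \<lambda>i. iprod (wmeas c) (bas c Mb 0 i) f"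
  defines "P \<equiv> \<lambda>(n, l, j). of_real (sqrt (real (n div 2) + alph TYPE('m) c n l + 1)) * q (n, l, j)"
  defines "Q \<equiv> \<lambda>(n, l, j). of_real (sqrt (real (n div 2) + 1)) * q (n + 2, l, j)"
  assumes c: "c > -1" and mb: "monogenic_basis d Mb" and F: "deformed_fourier c d Mb F" and f: "f \<in> L2 c"
    and rf: "rmult f \<in> L2 c" and rFf: "rmult (F f) \<in> L2 c"
  shows "(delta TYPE('m) c / 2 * nsq (wmeas c) f)\<^sup>2 \<le> nsq (wmeas c) (rmult f) * nsq (wmeas c) (rmult (F f))"
    and "nsq (wmeas c) (rmult f) * nsq (wmeas c) (rmult (F f)) = (delta TYPE('m) c / 2 * nsq (wmeas c) f)\<^sup>2 \<Longrightarrow>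
      nsq (wmeas c) f > 0 \<Longrightarrow>
      \<exists>t>0. (\<forall>i\<in>idx d. of_real t * (P i - Q i) = P i + Q i) \<and>
        (\<forall>n l j. (n, l, j) \<in> idx d \<longrightarrow> l > 0 \<or> odd n \<longrightarrow> q (n, l, j) = 0)"
proof -
  let ?I = "idx d" and ?\<mu> = "wmeas c :: (real, 'm) vec measure"
  define \<delta> where "\<delta> = delta TYPE('m) c"
  have \<delta>: "\<delta> > 0" unfolding \<delta>_def by (rule delta_pos[OF c])
  define wt :: "nat \<times> nat \<times> nat \<Rightarrow> real" where "wt = (\<lambda>(n, l, j). alph TYPE('m) c n l + 1)"
  have U: "unitary_on_L2 c F" using F by (simp add: deformed_fourier_def)
  have Ff: "F f \<in> L2 c" using U f by (simp add: unitary_on_L2_def)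
  have on1: "orthonormal ?\<mu> ?I (bas c Mb 1)" by (rule bas_orthonormal[OF c mb]) simp
  have rf': "rmult f \<in> sq_int ?\<mu>" "rmult (F f) \<in> sq_int ?\<mu>" using rf rFf by (simp_all add: L2_eq_sq_int)
  have cf: "iprod ?\<mu> (bas c Mb 1 i) (rmult f) = P i - Q i" if "i \<in> ?I" for i
    using that rmult_coefficient[OF c mb f] by (auto simp: idx_def P_def Q_def q_def)
  have cF: "(cmod (iprod ?\<mu> (bas c Mb 1 i) (rmult (F f))))\<^sup>2 = (cmod (P i + Q i))\<^sup>2" if i: "i \<in> ?I" for i
  proof -
    obtain n l j where i': "i = (n, l, j)" "j < d l" using i by (auto simp: idx_def)
    have "iprod ?\<mu> (bas c Mb 1 i) (rmult (F f)) = eig c n l * (P i + Q i)"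
      using i' rmult_coefficient[OF c mb Ff, of j l n] fourier_coefficient[OF c mb F f, of j l]
      by (simp add: P_def Q_def q_def eig_Suc_Suc[simplified] algebra_simps)
    then show ?thesis by (simp add: norm_mult cmod_eig)
  qed
  define a where "a = (\<Sum>\<^sub>\<infinity>i\<in>?I. (cmod (P i - Q i))\<^sup>2)"
  define b where "b = (\<Sum>\<^sub>\<infinity>i\<in>?I. (cmod (P i + Q i))\<^sup>2)"
  have sa: "(\<lambda>i. (cmod (P i - Q i))\<^sup>2) summable_on ?I" and a_le: "a \<le> nsq ?\<mu> (rmult f)"
    using bessel[OF on1 rf'(1)] cf by (simp_all add: a_def cong: summable_on_cong infsum_cong)
  have sb: "(\<lambda>i. (cmod (P i + Q i))\<^sup>2) summable_on ?I" and b_le: "b \<le> nsq ?\<mu> (rmult (F f))"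
    using bessel[OF on1 rf'(2)] cF by (simp_all add: b_def cong: summable_on_cong infsum_cong)
  \<comment> \<open>Bessel controls \<open>P - Q\<close> and \<open>P + Q\<close>; the parallelogram
    identity gives summability of \<open>P\<close> and \<open>Q\<close> separately, so that their
    sums may be subtracted.\<close>
  have sab: "(\<lambda>i. 2 * (cmod (P i))\<^sup>2 + 2 * (cmod (Q i))\<^sup>2) summable_on ?I"
    using summable_on_add[OF sa sb] by (simp only: cmod_diff_sum_squares(1))
  have sP: "(\<lambda>i. (cmod (P i))\<^sup>2) summable_on ?I" and sQ: "(\<lambda>i. (cmod (Q i))\<^sup>2) summable_on ?I"
    by (rule summable_on_comparison_test[OF sab], simp, simp)+
  \<comment> \<open>The terms of \<open>Q\<close> are shifted: \<open>Q\<close> at \<open>n\<close>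
    is \<open>h\<close> at \<open>n + 2\<close>, and the indices \<open>n < 2\<close> that are not
    reached have \<open>n div 2 = 0\<close>. Afterwards \<open>|P|^2\<close> and \<open>h\<close>
    involve the same coefficient, and \<open>t + \<alpha> + 1 - t\<close> leaves the weight
    \<open>\<alpha> + 1\<close>.\<close>
  define h where "h = (\<lambda>(n, l, j). real (n div 2) * (cmod (q (n, l, j)))\<^sup>2)"
  define sh where "sh = (\<lambda>(n::nat, l::nat, j::nat). (n + 2, l, j))"
  have inj: "inj_on sh ?I" by (auto simp: inj_on_def sh_def)
  have shI: "sh ` ?I \<subseteq> ?I" by (auto simp: sh_def idx_def)
  have hsh: "h (sh i) = (cmod (Q i))\<^sup>2" for i
    by (cases i) (simp add: h_def sh_def Q_def norm_mult power_mult_distrib)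
  have h0: "h i = 0" if "i \<in> ?I - sh ` ?I" for i
  proof -
    obtain n l j where i: "i = (n, l, j)" by (cases i)
    have "n < 2"
    proof (rule ccontr)
      assume "\<not> n < 2"
      then have "i = sh (n - 2, l, j)" "(n - 2, l, j) \<in> ?I" using that i by (auto simp: sh_def idx_def)
      then show False using that by auto
    qed
    then show ?thesis by (simp add: h_def i)
  qed
  have hs1: "(h has_sum infsum (\<lambda>i. (cmod (Q i))\<^sup>2) ?I) (sh ` ?I)"
    using has_sum_infsum[OF sQ] unfolding has_sum_reindex[OF inj] by (simp add: o_def hsh)
  have hs: "(h has_sum infsum (\<lambda>i. (cmod (Q i))\<^sup>2) ?I) ?I"
    by (rule has_sum_cong_neutral[THEN iffD1, OF _ _ _ hs1]) (use h0 shI in auto)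
  have wtP: "(cmod (P i))\<^sup>2 - h i = wt i * (cmod (q i))\<^sup>2" for i
  proof -
    obtain n l j where i: "i = (n, l, j)" by (cases i)
    have "0 \<le> real (n div 2) + alph TYPE('m) c n l + 1" using alph_gt[OF c, where 'm = 'm, of n l] by linarith
    then show ?thesis by (simp add: i P_def h_def wt_def norm_mult power_mult_distrib algebra_simps)
  qed
  define D where "D = (\<Sum>\<^sub>\<infinity>i\<in>?I. (cmod (P i))\<^sup>2) - (\<Sum>\<^sub>\<infinity>i\<in>?I. (cmod (Q i))\<^sup>2)"
  have hD: "((\<lambda>i. wt i * (cmod (q i))\<^sup>2) has_sum D) ?I"
    unfolding wtP[symmetric] D_def by (rule has_sum_diff_real[OF has_sum_infsum[OF sP] hs])
  have hD': "((\<lambda>i. (cmod (P i))\<^sup>2 - (cmod (Q i))\<^sup>2) has_sum D) ?I"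
    unfolding D_def by (rule has_sum_diff_real[OF has_sum_infsum[OF sP] has_sum_infsum[OF sQ]])
  have pars: "((\<lambda>i. (cmod (q i))\<^sup>2) has_sum nsq ?\<mu> f) ?I"
    unfolding q_def by (rule bas_parseval[OF c mb f])
  have hE: "((\<lambda>i. (wt i - \<delta> / 2) * (cmod (q i))\<^sup>2) has_sum (D - \<delta> / 2 * nsq ?\<mu> f)) ?I"
    unfolding left_diff_distrib by (rule has_sum_diff_real[OF hD has_sum_cmult_right[OF pars]])
  have wt: "wt (n, l, j) - \<delta> / 2 = real l / (1 + c) + real (n mod 2)" for n l j
    by (simp add: wt_def \<delta>_def alph_eq[OF c])
  have wt0: "0 \<le> wt i - \<delta> / 2" for i
    using c by (cases i) (simp add: wt)
  have D_ge: "\<delta> / 2 * nsq ?\<mu> f \<le> D"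
    using has_sum_nonneg[OF hE] wt0 by simp
  have D0: "0 \<le> D" using D_ge \<delta> by (meson divide_nonneg_nonneg less_imp_le mult_nonneg_nonneg nsq_nonneg order.trans zero_le_numeral)
  \<comment> \<open>A sum of squares for each real \<open>t\<close>, hence a nonnegative quadratic
    polynomial: this gives \<open>D^2 \<le> a b\<close>, and a zero of it forces every single term
    to vanish.\<close>
  have hT: "((\<lambda>i. (cmod (of_real t * (P i - Q i) - (P i + Q i)))\<^sup>2) has_sum (t\<^sup>2 * a + b - 2 * t * D)) ?I" for t
    unfolding cmod_diff_sum_squares(2) a_def b_def
    by (intro has_sum_diff_real has_sum_add has_sum_cmult_right has_sum_infsum sa sb hD')
  have quad: "0 \<le> t\<^sup>2 * a + b - 2 * t * D" for t
    using has_sum_nonneg[OF hT[of t]] by simp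
  have a0: "0 \<le> a" and b0: "0 \<le> b" by (simp_all add: a_def b_def infsum_nonneg)
  have Dab: "D\<^sup>2 \<le> a * b"
  proof (cases "a = 0")
    case True
    have "D = 0"
    proof (rule ccontr)
      assume "D \<noteq> 0"
      \<comment> \<open>With \<open>a = 0\<close> this \<open>t\<close> makes the quadratic
        polynomial equal to \<open>-1\<close>.\<close>
      then show False using quad[of "(b + 1) / (2 * D)"] True by simp
    qed
    then show ?thesis using True by simp
  next
    case False
    then have "a > 0" using a0 by simp
    then have "0 \<le> a * ((D / a)\<^sup>2 * a + b - 2 * (D / a) * D)" using quad[of "D / a"] by simp
    also have "\<dots> = a * b - D\<^sup>2" using \<open>a > 0\<close> by (simp add: field_simps power2_eq_square)
    finally show ?thesis by simp
  qed
  have ab_le: "a * b \<le> nsq ?\<mu> (rmult f) * nsq ?\<mu> (rmult (F f))"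
    by (intro mult_mono a_le b_le b0 nsq_nonneg)
  have dD: "(\<delta> / 2 * nsq ?\<mu> f)\<^sup>2 \<le> D\<^sup>2"
    using D_ge \<delta> by (intro power_mono) simp_all
  show "(delta TYPE('m) c / 2 * nsq (wmeas c) f)\<^sup>2 \<le> nsq (wmeas c) (rmult f) * nsq (wmeas c) (rmult (F f))"
    using dD Dab ab_le unfolding \<delta>_def by linarith
  assume eq: "nsq (wmeas c) (rmult f) * nsq (wmeas c) (rmult (F f)) = (delta TYPE('m) c / 2 * nsq (wmeas c) f)\<^sup>2"
    and pos: "nsq (wmeas c) f > 0"
  have d_pos: "\<delta> / 2 * nsq ?\<mu> f > 0" using \<delta> pos by simp
  \<comment> \<open>The chain from \<open>(\<delta> / 2 * nsq f)^2\<close> through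
    \<open>D^2\<close> and \<open>a b\<close> to the product of the squared norms is closed by the
    assumed equality, so all its members coincide.\<close>
  have D2: "D\<^sup>2 = (\<delta> / 2 * nsq ?\<mu> f)\<^sup>2" and abD: "a * b = D\<^sup>2"
    using eq dD Dab ab_le unfolding \<delta>_def by linarith+
  then have Deq: "D = \<delta> / 2 * nsq ?\<mu> f"
    using D0 d_pos by (simp add: power2_eq_iff_nonneg)
  have Dpos: "D > 0" unfolding Deq by (rule d_pos)
  have apos: "a > 0" using a0 abD Dpos by (cases "a = 0") auto
  \<comment> \<open>The double root of the quadratic polynomial.\<close>
  define t where "t = D / a"
  have tpos: "t > 0" using Dpos apos by (simp add: t_def)
  have "t\<^sup>2 * a + b - 2 * t * D = 0"
  proof -
    have "a * (t\<^sup>2 * a + b - 2 * t * D) = a * b - D\<^sup>2" using apos by (simp add: t_def field_simps power2_eq_square)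
    then show ?thesis using abD apos by simp
  qed
  then have hT0: "((\<lambda>i. (cmod (of_real t * (P i - Q i) - (P i + Q i)))\<^sup>2) has_sum 0) ?I" using hT[of t] by simp
  have "of_real t * (P i - Q i) = P i + Q i" if "i \<in> ?I" for i
    using nonneg_infsum_le_0D[OF _ has_sum_imp_summable[OF hT0] _ that] infsumI[OF hT0] by simp
  moreover have "q (n, l, j) = 0" if i: "(n, l, j) \<in> ?I" and nl: "l > 0 \<or> odd n" for n l j
  proof -
    have hE0: "((\<lambda>i. (wt i - \<delta> / 2) * (cmod (q i))\<^sup>2) has_sum 0) ?I" using hE Deq by simp
    have "(wt (n, l, j) - \<delta> / 2) * (cmod (q (n, l, j)))\<^sup>2 = 0"
      by (rule nonneg_infsum_le_0D[OF _ has_sum_imp_summable[OF hE0] _ i]) (use wt0 infsumI[OF hE0] in simp_all)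
    moreover have "wt (n, l, j) - \<delta> / 2 > 0"
    proof -
      have "0 \<le> real l / (1 + c)" using c by simp
      moreover have "l > 0 \<Longrightarrow> 0 < real l / (1 + c)" using c by simp
      moreover have "odd n \<Longrightarrow> real (n mod 2) = 1" by (simp add: odd_iff_mod_2_eq_one)
      ultimately show ?thesis unfolding wt using nl by (auto intro: add_pos_nonneg)
    qed
    ultimately show ?thesis by simp
  qed
  ultimately show "\<exists>t>0. (\<forall>i\<in>idx d. of_real t * (P i - Q i) = P i + Q i) \<and>
        (\<forall>n l j. (n, l, j) \<in> idx d \<longrightarrow> l > 0 \<or> odd n \<longrightarrow> q (n, l, j) = 0)"
    using tpos by (intro exI[of _ t]) blast
qed

section \<open>Gaussians\<close>

definition gauss :: "real \<Rightarrow> 'm::{finite,linorder} clifford \<Rightarrow> 'm cl_fun" where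
  "gauss b a x = exp (- b * (norm x)\<^sup>2) *\<^sub>R a"

lemma norm_cl_blade: "norm (cl_blade A) = 1"
proof -
  have "of_real ((norm (cl_blade A))\<^sup>2) = (1 :: complex)"
    unfolding hdot_self[symmetric] hdot_cl_blade by (simp add: cl_blade_def)
  then have "(norm (cl_blade A))\<^sup>2 = 1" by (simp only: of_real_eq_1_iff)
  then show ?thesis by (simp add: power2_eq_1_iff) (metis norm_ge_zero neg_0_le_iff_le not_one_le_zero)
qed

lemma gauss_measurable [measurable]: "gauss b a \<in> borel_measurable borel"
  unfolding gauss_def[abs_def] by measurable

text \<open>Only almost everywhere: \<open>0 powr 0 = 0\<close>, so the \<open>gfun\<close> vanishes
  at the origin, where the Gaussian has the value \<open>a\<close>.\<close>

lemma gauss_AE_gfun: "AE x in lborel. gauss b a x = gfun 0 b (\<lambda>s. 1) (\<lambda>x. a) x"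
  using AE_lborel_nonzero by eventually_elim (simp add: gauss_def gfun_def)

lemma rmult_gauss_gfun: "rmult (gauss b a) = gfun 1 b (\<lambda>s. 1) (\<lambda>x. a)"
  by (simp add: fun_eq_iff rmult_def gauss_def gfun_def)

lemma gauss_L2:
  fixes a :: "'m::{finite,linorder} clifford"
  assumes c: "c > -1" and b: "b > 0"
  shows "gauss b a \<in> L2 c" and "rmult (gauss b a) \<in> L2 c"
proof -
  \<comment> \<open>\<open>hpoly\<close> admits real constants only, so integrability is shown for
    the unit blade, whose norm is 1, and then scaled by \<open>norm a\<close>.\<close>
  let ?e = "cl_blade {} :: 'm clifford"
  have h: "hpoly 0 (\<lambda>x :: (real, 'm) vec. ?e)" by (intro hpoly_const cl_real_blade)
  have ne: "norm ?e = 1" by (rule norm_cl_blade)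
  have g0: "gfun 0 b (\<lambda>s. 1) (\<lambda>x. ?e) \<in> L2 c" and g1: "gfun 1 b (\<lambda>s. 1) (\<lambda>x. ?e) \<in> L2 c"
    using gfun_power_L2[OF c h _ b, of 0 0] gfun_power_L2[OF c h _ b, of 1 0] by simp_all
  have "gauss b ?e \<in> sq_int (wmeas c)"
  proof (rule sq_int_cong_AE)
    show "gfun 0 b (\<lambda>s. 1) (\<lambda>x. ?e) \<in> sq_int (wmeas c)" using g0 by (simp add: L2_eq_sq_int)
    show "AE x in wmeas c. gfun 0 b (\<lambda>s. 1) (\<lambda>x. ?e) x = gauss b ?e x"
      unfolding AE_wmeas using gauss_AE_gfun[of b ?e] by eventually_elim simp
  qed simp
  then have i: "integrable (wmeas c) (\<lambda>x. (norm (gauss b ?e x))\<^sup>2 * (norm a)\<^sup>2)"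
    by (intro integrable_mult_left sq_int_integrable)
  moreover have "(norm (gauss b ?e x))\<^sup>2 * (norm a)\<^sup>2 = (norm (gauss b a x))\<^sup>2" for x
    by (simp add: gauss_def ne power_mult_distrib)
  ultimately show "gauss b a \<in> L2 c" by (simp add: L2_eq_sq_int sq_int_def)
  have "rmult (gauss b ?e) \<in> sq_int (wmeas c)" unfolding rmult_gauss_gfun using g1 by (simp add: L2_eq_sq_int)
  then have i: "integrable (wmeas c) (\<lambda>x. (norm (rmult (gauss b ?e) x))\<^sup>2 * (norm a)\<^sup>2)"
    by (intro integrable_mult_left sq_int_integrable)
  moreover have "(norm (rmult (gauss b ?e) x))\<^sup>2 * (norm a)\<^sup>2 = (norm (rmult (gauss b a) x))\<^sup>2" for x
    by (simp add: rmult_def gauss_def ne power_mult_distrib)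
  ultimately show "rmult (gauss b a) \<in> L2 c"
    using rmult_measurable[OF gauss_measurable] by (simp add: L2_eq_sq_int sq_int_def)
qed

definition gauss_nsq :: "'m::{finite,linorder} itself \<Rightarrow> real \<Rightarrow> real \<Rightarrow> real" where
  "gauss_nsq m c b = nsq (wmeas c) (gauss b (cl_blade {} :: 'm clifford))"

text \<open>Gamma integrals at \<open>\<delta> / 2\<close> and \<open>\<delta> / 2 + 1\<close>: the
  functional equation of Gamma gives the ratio \<open>\<delta> / (4 b)\<close>. The third identity
  compares the rates \<open>b\<close> and \<open>1 / (4 b)\<close>, whose doubles are reciprocal to
  each other; the transform exchanges these rates.\<close>

lemma gauss_nsq:
  fixes a :: "'m::{finite,linorder} clifford"
  assumes c: "c > -1" and b: "b > 0"
  shows "nsq (wmeas c) (gauss b a) = (norm a)\<^sup>2 * gauss_nsq TYPE('m) c b"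
    and "nsq (wmeas c) (rmult (gauss b a)) = (norm a)\<^sup>2 * (delta TYPE('m) c / (4 * b) * gauss_nsq TYPE('m) c b)"
    and "gauss_nsq TYPE('m) c (1 / (4 * b)) = (2 * b) powr (delta TYPE('m) c) * gauss_nsq TYPE('m) c b"
proof -
  let ?e = "cl_blade {} :: 'm clifford"
  define \<delta> where "\<delta> = delta TYPE('m) c"
  have \<delta>: "\<delta> > 0" unfolding \<delta>_def by (rule delta_pos[OF c])
  define \<sigma> where "\<sigma> = Re (\<integral>x. hdot ?e ?e \<partial>(sphere_measure :: (real, 'm) vec measure))"
  have h: "hpoly 0 (\<lambda>x :: (real, 'm) vec. ?e)" by (intro hpoly_const cl_real_blade)
  have ne: "norm ?e = 1" by (rule norm_cl_blade)
  have I: "nsq (wmeas c) (gfun k b (\<lambda>s. 1) (\<lambda>x. ?e)) = Gamma (\<delta> / 2 + k) / (2 * b) powr (\<delta> / 2 + k) / 2 * \<sigma>"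
    if k: "k \<ge> 0" and b: "b > 0" for k b :: real
  proof -
    have a: "\<delta> / 2 - 1 + k > -1" using \<delta> k by simp
    note G = radial_gamma[OF a, of "b + b"]
    have "of_real (nsq (wmeas c) (gfun k b (\<lambda>s. 1) (\<lambda>x. ?e))) = iprod (wmeas c) (gfun k b (\<lambda>s. 1) (\<lambda>x. ?e)) (gfun k b (\<lambda>s. 1) (\<lambda>x. ?e))"
      by (rule iprod_self[symmetric])
    also have "\<dots> = of_real (lag_mean (\<delta> / 2 - 1 + k) (b + b) (\<lambda>s. 1 * 1) / 2) * (\<integral>x. hdot ?e ?e \<partial>(sphere_measure :: (real, 'm) vec measure))"
    proof (rule gfun_iprod(2)[OF c h h])
      show "\<delta> / 2 - 1 + k = delta TYPE('m) c / 2 - 1 + (real 0 + real 0 + k + k) / 2" by (simp add: \<delta>_def)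
      show "integrable lborel (\<lambda>s. if s > 0 then s powr (\<delta> / 2 - 1 + k) * exp (- (b + b) * s) * (1 * 1) else 0)"
        using integrable.intros[OF G] b by (simp cong: if_cong)
    qed simp_all
    also have "lag_mean (\<delta> / 2 - 1 + k) (b + b) (\<lambda>s. 1 * 1) = Gamma (\<delta> / 2 + k) / (2 * b) powr (\<delta> / 2 + k)"
      using has_bochner_integral_integral_eq[OF G] b by (simp add: lag_mean_def add_ac cong: if_cong)
    finally have "Re (of_real (nsq (wmeas c) (gfun k b (\<lambda>s. 1) (\<lambda>x. ?e))))
      = Re (of_real (Gamma (\<delta> / 2 + k) / (2 * b) powr (\<delta> / 2 + k) / 2) * (\<integral>x. hdot ?e ?e \<partial>(sphere_measure :: (real, 'm) vec measure)))"
      by (rule arg_cong)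
    then show ?thesis by (simp only: Re_complex_of_real Im_complex_of_real \<sigma>_def times_complex.sel)
  qed
  have m: "gfun 0 b (\<lambda>s. 1) (\<lambda>x. ?e) \<in> borel_measurable borel" for b by (rule gfun_measurable[OF h]) simp
  have N0: "gauss_nsq TYPE('m) c b = Gamma (\<delta> / 2) / (2 * b) powr (\<delta> / 2) / 2 * \<sigma>" if "b > 0" for b
  proof -
    have "gauss_nsq TYPE('m) c b = nsq (wmeas c) (gfun 0 b (\<lambda>s. 1) (\<lambda>x. ?e))"
      unfolding gauss_nsq_def by (rule nsq_cong_AE) (simp_all add: AE_wmeas gauss_AE_gfun m)
    then show ?thesis using I[of 0 b] that by simp
  qed
  have sc: "nsq (wmeas c) g = (norm a)\<^sup>2 * nsq (wmeas c) h" if "\<And>x. norm (g x) = norm a * norm (h x)"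
    for g h :: "'m cl_fun"
    unfolding nsq_def that power_mult_distrib by simp
  show "nsq (wmeas c) (gauss b a) = (norm a)\<^sup>2 * gauss_nsq TYPE('m) c b"
    unfolding gauss_nsq_def by (rule sc) (simp add: gauss_def ne)
  have "nsq (wmeas c) (rmult (gauss b a)) = (norm a)\<^sup>2 * nsq (wmeas c) (rmult (gauss b ?e))"
    by (rule sc) (simp add: rmult_def gauss_def ne)
  also have "nsq (wmeas c) (rmult (gauss b ?e)) = Gamma (\<delta> / 2 + 1) / (2 * b) powr (\<delta> / 2 + 1) / 2 * \<sigma>"
    unfolding rmult_gauss_gfun by (rule I) (use b in simp_all)
  also have "\<dots> = \<delta> / (4 * b) * gauss_nsq TYPE('m) c b"
  proof -
    have "\<delta> / 2 \<notin> \<int>\<^sub>\<le>\<^sub>0" using \<delta> by (auto elim!: nonpos_Ints_cases)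
    then have G: "Gamma (\<delta> / 2 + 1) = \<delta> / 2 * Gamma (\<delta> / 2)" by (rule Gamma_plus1)
    have p: "(2 * b) powr (\<delta> / 2 + 1) = (2 * b) powr (\<delta> / 2) * (2 * b)" using b by (simp add: powr_add)
    have "(2 * b) powr (\<delta> / 2) \<noteq> 0" using b by simp
    then show ?thesis unfolding N0[OF b] G p using b by (simp add: field_simps)
  qed
  finally show "nsq (wmeas c) (rmult (gauss b a)) = (norm a)\<^sup>2 * (delta TYPE('m) c / (4 * b) * gauss_nsq TYPE('m) c b)"
    by (simp only: \<delta>_def)
  show "gauss_nsq TYPE('m) c (1 / (4 * b)) = (2 * b) powr (delta TYPE('m) c) * gauss_nsq TYPE('m) c b"
  proof -
    have b': "1 / (4 * b) > 0" using b by simp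
    have "(2 * (1 / (4 * b))) powr (\<delta> / 2) = 1 / (2 * b) powr (\<delta> / 2)"
      using b by (simp add: powr_divide)
    moreover have "(2 * b) powr \<delta> = (2 * b) powr (\<delta> / 2) * (2 * b) powr (\<delta> / 2)"
      using b by (simp flip: powr_add)
    moreover have "(2 * b) powr (\<delta> / 2) \<noteq> 0" using b by simp
    ultimately show ?thesis
      unfolding N0[OF b] N0[OF b'] \<delta>_def[symmetric] by (simp add: field_simps)
  qed
qed

text \<open>Radial part of the inner product of a Gaussian of rate \<open>b\<close> with the basis
  function of degree zero and index \<open>n = 2 t\<close>: \<open>lag_mean_laguerre\<close> at
  \<open>y = b + 1/2\<close>, normalised. Up to Gamma factors it is geometric in \<open>t\<close>
  with ratio \<open>(b - 1/2) / (b + 1/2)\<close>.\<close>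

definition gauss_coeff :: "real \<Rightarrow> real \<Rightarrow> nat \<Rightarrow> real" where
  "gauss_coeff \<alpha> b t = lag_norm t \<alpha> / 2 *
     (Gamma (real t + \<alpha> + 1) / fact t * ((b - 1/2) ^ t / (b + 1/2) powr (real t + \<alpha> + 1)))"

lemma gauss_coeff_0_pos:
  assumes "\<alpha> > -1" "b > 0"
  shows "gauss_coeff \<alpha> b 0 > 0"
proof -
  have "Gamma (\<alpha> + 1) > 0" using assms by (intro Gamma_real_pos) simp
  then show ?thesis using lag_norm_pos[OF assms(1), of 0] assms by (simp add: gauss_coeff_def)
qed

text \<open>The two-term recurrence that the equality case imposes on the coefficients of
  \<open>f\<close>, with \<open>\<tau> = 2 b\<close>.\<close>

lemma gauss_coeff_Suc:
  assumes \<alpha>: "\<alpha> > -1" and b: "b > 0"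
  shows "(b + 1/2) * sqrt (real t + 1) * gauss_coeff \<alpha> b (Suc t) = (b - 1/2) * sqrt (real t + \<alpha> + 1) * gauss_coeff \<alpha> b t"
proof -
  define w where "w = (b - 1/2) ^ t / (b + 1/2) powr (real t + \<alpha> + 1)"
  define G where "G = Gamma (real t + \<alpha> + 1) / fact t"
  have p: "real t + \<alpha> + 1 > 0" using \<alpha> by simp
  have "real t + \<alpha> + 1 \<notin> \<int>\<^sub>\<le>\<^sub>0" using p by (auto elim!: nonpos_Ints_cases)
  moreover have "real (Suc t) + \<alpha> + 1 = (real t + \<alpha> + 1) + 1" by simp
  ultimately have GS: "Gamma (real (Suc t) + \<alpha> + 1) = (real t + \<alpha> + 1) * Gamma (real t + \<alpha> + 1)"
    by (simp only: Gamma_plus1 not_False_eq_True)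
  have w: "(b + 1/2) * ((b - 1/2) ^ Suc t / (b + 1/2) powr (real (Suc t) + \<alpha> + 1)) = (b - 1/2) * w"
  proof -
    have "(b + 1/2) powr (real (Suc t) + \<alpha> + 1) = (b + 1/2) powr (real t + \<alpha> + 1) * (b + 1/2)"
      using b powr_add[of "b + 1/2" "real t + \<alpha> + 1" 1] by (simp add: add_ac)
    moreover have "b + 1/2 \<noteq> 0" using b by simp
    ultimately show ?thesis unfolding w_def by simp
  qed
  have s: "sqrt (real t + 1) * lag_norm (Suc t) \<alpha> * ((real t + \<alpha> + 1) * G / (real t + 1)) = sqrt (real t + \<alpha> + 1) * lag_norm t \<alpha> * G"
  proof -
    have "sqrt (real t + 1) * lag_norm (Suc t) \<alpha> * ((real t + \<alpha> + 1) * G / (real t + 1))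
        = lag_norm t (\<alpha> + 1) * (real t + \<alpha> + 1) * G * ((real t + 1) / (real t + 1))"
      unfolding lag_norm_shift(2)[OF \<alpha>, symmetric] by (simp only: times_divide_eq_right times_divide_eq_left mult_ac)
    then show ?thesis unfolding lag_norm_shift(1)[OF \<alpha>] by simp
  qed
  have "(b + 1/2) * sqrt (real t + 1) * gauss_coeff \<alpha> b (Suc t)
     = (sqrt (real t + 1) * lag_norm (Suc t) \<alpha> * (Gamma (real (Suc t) + \<alpha> + 1) / fact (Suc t))) / 2
        * ((b + 1/2) * ((b - 1/2) ^ Suc t / (b + 1/2) powr (real (Suc t) + \<alpha> + 1)))"
  proof -
    have "B * s * (L / 2 * (H * W)) = (s * L * H) / 2 * (B * W)" for B s L H W :: real by simp
    then show ?thesis unfolding gauss_coeff_def .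
  qed
  also have "Gamma (real (Suc t) + \<alpha> + 1) / fact (Suc t) = (real t + \<alpha> + 1) * G / (real t + 1)"
    unfolding GS G_def by (simp add: mult_ac)
  finally show ?thesis unfolding s w
    by (simp add: gauss_coeff_def G_def w_def mult_ac)
qed

text \<open>Replacing \<open>b\<close> by \<open>1 / (4 b)\<close> negates the ratio
  \<open>(b - 1/2) / (b + 1/2)\<close>. The sign \<open>(-1) ^ t\<close> is the eigenvalue of the
  transform at \<open>n = 2 t\<close>, \<open>l = 0\<close>, so it sends a Gaussian to a multiple of
  the one with the dual rate.\<close>

lemma gauss_coeff_dual:
  assumes b: "b > 0"
  shows "(-1) ^ t * gauss_coeff \<alpha> b t = (2 * b) powr (- (\<alpha> + 1)) * gauss_coeff \<alpha> (1 / (4 * b)) t"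
proof -
  define e where "e = \<alpha> + 1"
  have 1: "1 / (4 * b) - 1/2 = - ((b - 1/2) / (2 * b))" and 2: "1 / (4 * b) + 1/2 = (b + 1/2) / (2 * b)"
    using b by (simp_all add: field_simps)
  have 3: "real t + \<alpha> + 1 = real t + e" by (simp add: e_def)
  have p: "(2 * b) powr (real t + e) = (2 * b) ^ t * (2 * b) powr e"
    using b by (simp add: powr_add powr_realpow)
  have q: "((b + 1/2) / (2 * b)) powr (real t + e) = (b + 1/2) powr (real t + e) / ((2 * b) ^ t * (2 * b) powr e)"
    using b by (simp add: powr_divide p)
  have r: "(- ((b - 1/2) / (2 * b))) ^ t = (-1) ^ t * (b - 1/2) ^ t / (2 * b) ^ t"
    by (subst power_minus) (simp add: power_divide)
  have n: "(2 * b) ^ t \<noteq> 0" "(2 * b) powr e \<noteq> 0" "(b + 1/2) powr (real t + e) \<noteq> 0" using b by simp_all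
  have eq: "(2 * b) powr (- e) * ((- ((b - 1/2) / (2 * b))) ^ t / ((b + 1/2) / (2 * b)) powr (real t + e))
      = (-1) ^ t * ((b - 1/2) ^ t / (b + 1/2) powr (real t + e))"
    unfolding q r powr_minus using n by (simp add: divide_simps del: power_mult_distrib)
  have gen: "x * (L / 2 * (H * W)) = y * (L / 2 * (H * V))" if "y * V = x * W" for x y L H V W :: real
  proof -
    have "x * (L / 2 * (H * W)) = L / 2 * H * (x * W)" by simp
    also have "\<dots> = y * (L / 2 * (H * V))" unfolding that[symmetric] by simp
    finally show ?thesis .
  qed
  show ?thesis
    unfolding gauss_coeff_def 1 2 3 e_def[symmetric] by (rule gen[OF eq])
qed

text \<open>Constants are monogenic of degree 0, so spherical orthogonality removes every angular
  function except \<open>Mb 0 j\<close>. Real \<open>a\<close> makes the constant an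
  \<open>hpoly\<close>; complex \<open>a\<close> follows by splitting into real and imaginary
  parts.\<close>

lemma gauss_coefficient_real:
  fixes Mb :: "nat \<Rightarrow> nat \<Rightarrow> 'm::{finite,linorder} cl_fun"
  assumes c: "c > -1" and mb: "monogenic_basis d Mb" and j: "j < d l" and a: "cl_real a" and b: "b > 0"
  shows "iprod (wmeas c) (bas c Mb 0 (n, l, j)) (gauss b a)
    = (if l = 0 \<and> even n then of_real (gauss_coeff (delta TYPE('m) c / 2 - 1) b (n div 2)) *
        (\<integral>x. hdot (Mb 0 j x) a \<partial>sphere_measure) else 0)"
proof -
  define \<alpha> where "\<alpha> = alph TYPE('m) c n l"
  have \<alpha>: "\<alpha> > -1" unfolding \<alpha>_def by (rule alph_gt[OF c])
  define t where "t = n div 2"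
  define A where "A = delta TYPE('m) c / 2 - 1 + (real (l + n mod 2) + real 0 + (beta c l + 0) + 0) / 2"
  have A: "A > -1"
  proof -
    have "0 \<le> real l / (1 + c)" using c by simp
    then have "0 \<le> (real (l + n mod 2) + real 0 + (beta c l + 0) + 0) / 2" using beta_add[OF c, of l] by simp
    then show ?thesis unfolding A_def using delta_pos[OF c, where 'm = 'm] by linarith
  qed
  have h: "hpoly 0 (\<lambda>x :: (real, 'm) vec. a)" by (rule hpoly_const[OF a])
  have ml: "laguerre t \<alpha> \<in> borel_measurable borel" unfolding laguerre_def[abs_def] by measurable
  have m: "gfun 0 b (\<lambda>s. 1) (\<lambda>x :: (real, 'm) vec. a) \<in> borel_measurable borel" by (rule gfun_measurable[OF h]) simp
  have bm: "bas c Mb 0 (n, l, j) \<in> borel_measurable borel"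
    using bas_L2[OF c mb, of 0 "(n, l, j)"] j by (simp add: idx_def L2_def)
  have "iprod (wmeas c) (bas c Mb 0 (n, l, j)) (gauss b a) = iprod (wmeas c) (bas c Mb 0 (n, l, j)) (gfun 0 b (\<lambda>s. 1) (\<lambda>x. a))"
    by (rule iprod_cong_AE) (simp_all add: AE_wmeas gauss_AE_gfun m bm)
  also have "\<dots> = of_real (lag_norm t \<alpha>) * iprod (wmeas c) (gfun (beta c l + 0) (1/2) (laguerre t \<alpha>) (ang Mb n l j)) (gfun 0 b (\<lambda>s. 1) (\<lambda>x. a))"
    unfolding bas_def prod.case iprod_scaleR_left by (simp add: t_def \<alpha>_def)
  also have "iprod (wmeas c) (gfun (beta c l + 0) (1/2) (laguerre t \<alpha>) (ang Mb n l j)) (gfun 0 b (\<lambda>s. 1) (\<lambda>x. a))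
    = of_real (lag_mean A (1/2 + b) (\<lambda>s. laguerre t \<alpha> s * 1) / 2) * (\<integral>x. hdot (ang Mb n l j x) a \<partial>sphere_measure)"
  proof (rule gfun_iprod(2)[OF c hpoly_ang[OF mb j] h ml _ A_def])
    show "integrable lborel (\<lambda>s. if s > 0 then s powr A * exp (- (1/2 + b) * s) * (laguerre t \<alpha> s * 1) else 0)"
      using laguerre_integrable[OF A, of "1/2 + b" 0 t \<alpha>] b by (simp cong: if_cong)
  qed simp
  finally have I: "iprod (wmeas c) (bas c Mb 0 (n, l, j)) (gauss b a)
     = of_real (lag_norm t \<alpha>) * (of_real (lag_mean A (1/2 + b) (\<lambda>s. laguerre t \<alpha> s * 1) / 2) * (\<integral>x. hdot (ang Mb n l j x) a \<partial>sphere_measure))" .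
  note M = monogenic_basisD[OF mb j]
  note so = sphere_orthogonal[OF h hpoly_0_dirac[OF h] M(1,2)] and so' = sphere_orthogonal[OF M(1,2) h hpoly_0_dirac[OF h]]
  show ?thesis
  proof (cases "l = 0 \<and> even n")
    case True
    then have \<alpha>': "\<alpha> = delta TYPE('m) c / 2 - 1" and A': "A = \<alpha>" and an: "ang Mb n l j = Mb 0 j"
      by (auto simp: \<alpha>_def A_def alph_eq[OF c] beta_def ang_def)
    have "lag_mean A (1/2 + b) (\<lambda>s. laguerre t \<alpha> s * 1) = Gamma (real t + \<alpha> + 1) / fact t * ((b - 1/2) ^ t / (b + 1/2) powr (real t + \<alpha> + 1))"
      unfolding A' using lag_mean_laguerre[OF \<alpha>, of "1/2 + b" t] b by (simp add: add.commute)
    then have "lag_norm t \<alpha> * (lag_mean A (1/2 + b) (\<lambda>s. laguerre t \<alpha> s * 1) / 2) = gauss_coeff \<alpha> b t"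
      by (simp only: gauss_coeff_def) simp
    then have "of_real (lag_norm t \<alpha>) * of_real (lag_mean A (1/2 + b) (\<lambda>s. laguerre t \<alpha> s * 1) / 2) = (of_real (gauss_coeff \<alpha> b t) :: complex)"
      by (simp only: of_real_mult[symmetric])
    then show ?thesis unfolding I mult.assoc[symmetric] an using True by (simp add: \<alpha>' t_def)
  next
    case False
    have "(\<integral>x. hdot (ang Mb n l j x) a \<partial>sphere_measure) = 0"
    proof (cases "even n")
      case True
      then show ?thesis using False so'(1) by (simp add: ang_def)
    next
      case odd: False
      then show ?thesis
        using Bochner_Integration.integral_cnj[of sphere_measure "\<lambda>x. hdot a (cl_vec x \<odot> Mb l j x)"] so(2)
        by (simp add: ang_def cnj_hdot)
    qed
    then show ?thesis unfolding I by (simp only: False if_False mult_zero_right)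
  qed
qed

lemma real_imag_parts:
  fixes a :: "'m::{finite,linorder} clifford"
  obtains u v where "cl_real u" "cl_real v" "a = u + \<i> *s v"
proof (rule that)
  show "cl_real (\<chi> A. of_real (Re (a $ A)))" "cl_real (\<chi> A. of_real (Im (a $ A)))" by (simp_all add: cl_real_def)
  show "a = (\<chi> A. of_real (Re (a $ A))) + \<i> *s (\<chi> A. of_real (Im (a $ A)))"
    by (simp add: vec_eq_iff complex_eq_iff)
qed

lemma gauss_coefficient:
  fixes Mb :: "nat \<Rightarrow> nat \<Rightarrow> 'm::{finite,linorder} cl_fun"
  assumes c: "c > -1" and mb: "monogenic_basis d Mb" and j: "j < d l" and b: "b > 0"
  shows "iprod (wmeas c) (bas c Mb 0 (n, l, j)) (gauss b a)
    = (if l = 0 \<and> even n then of_real (gauss_coeff (delta TYPE('m) c / 2 - 1) b (n div 2)) *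
        (\<integral>x. hdot (Mb 0 j x) a \<partial>sphere_measure) else 0)"
proof -
  obtain u v where uv: "cl_real u" "cl_real v" "a = u + \<i> *s v" by (rule real_imag_parts)
  have e: "bas c Mb 0 (n, l, j) \<in> sq_int (wmeas c)"
    using bas_L2[OF c mb, of 0 "(n, l, j)"] j by (simp add: idx_def L2_eq_sq_int)
  have g: "gauss b w \<in> sq_int (wmeas c)" for w :: "'m clifford" using gauss_L2(1)[OF c b] by (simp add: L2_eq_sq_int)
  have ga: "gauss b a = (\<lambda>x. gauss b u x + \<i> *s gauss b v x)"
    by (simp add: fun_eq_iff gauss_def uv(3) scaleR_add_right scaleR_eq_scale vector_smult_assoc mult.commute)
  have I: "iprod (wmeas c) (bas c Mb 0 (n, l, j)) (gauss b a)
    = iprod (wmeas c) (bas c Mb 0 (n, l, j)) (gauss b u) + \<i> * iprod (wmeas c) (bas c Mb 0 (n, l, j)) (gauss b v)"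
    unfolding ga by (simp only: iprod_add_right[OF e g sq_int_scale[OF g]] iprod_scale_right)
  show ?thesis
  proof (cases "l = 0")
    case True
    then have M: "hpoly 0 (Mb 0 j)" using monogenic_basisD(1)[OF mb j] by simp
    have i: "integrable sphere_measure (\<lambda>x. hdot (Mb 0 j x) w)" for w
      by (intro integrable_sphere continuous_hdot hpoly_continuous[OF M] continuous_on_const)
    have K: "(\<integral>x. hdot (Mb 0 j x) a \<partial>sphere_measure) = (\<integral>x. hdot (Mb 0 j x) u \<partial>sphere_measure) + \<i> * (\<integral>x. hdot (Mb 0 j x) v \<partial>sphere_measure)"
      unfolding uv(3) hdot_add_right hdot_scale_right using i by simp
    show ?thesis
      unfolding I K gauss_coefficient_real[OF c mb j uv(1) b] gauss_coefficient_real[OF c mb j uv(2) b]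
      by (simp add: algebra_simps)
  next
    case False
    then show ?thesis
      unfolding I gauss_coefficient_real[OF c mb j uv(1) b] gauss_coefficient_real[OF c mb j uv(2) b] by simp
  qed
qed

text \<open>Both sides have the same coefficients by \<open>gauss_coeff_dual\<close>, whose exponent
  \<open>\<alpha> + 1\<close> is \<open>\<delta> / 2\<close> in degree zero.\<close>

lemma fourier_gauss:
  fixes Mb :: "nat \<Rightarrow> nat \<Rightarrow> 'm::{finite,linorder} cl_fun"
  assumes c: "c > -1" and mb: "monogenic_basis d Mb" and F: "deformed_fourier c d Mb F" and b: "b > 0"
  shows "AE x in lborel. F (gauss b a) x = (2 * b) powr (- (delta TYPE('m) c / 2)) *\<^sub>R gauss (1 / (4 * b)) a x"
proof (rule L2_eq_by_coefficients[OF c mb])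
  have U: "unitary_on_L2 c F" using F by (simp add: deformed_fourier_def)
  have b': "1 / (4 * b) > 0" using b by simp
  note g = gauss_L2(1)[OF c b, of a] and g' = gauss_L2(1)[OF c b', of a]
  show "F (gauss b a) \<in> L2 c" using U g by (simp add: unitary_on_L2_def)
  show "(\<lambda>x. (2 * b) powr (- (delta TYPE('m) c / 2)) *\<^sub>R gauss (1 / (4 * b)) a x) \<in> L2 c"
    using g' by (simp add: L2_eq_sq_int sq_int_scaleR)
  fix i assume "i \<in> idx d"
  then obtain n l j where i: "i = (n, l, j)" "j < d l" by (auto simp: idx_def)
  let ?\<alpha> = "delta TYPE('m) c / 2 - 1"
  have "iprod (wmeas c) (bas c Mb 0 i) (F (gauss b a)) = eig c n l * iprod (wmeas c) (bas c Mb 0 i) (gauss b a)"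
    unfolding i(1) by (rule fourier_coefficient[OF c mb F g i(2)])
  also have "\<dots> = of_real ((2 * b) powr (- (delta TYPE('m) c / 2))) * iprod (wmeas c) (bas c Mb 0 i) (gauss (1 / (4 * b)) a)"
  proof (cases "l = 0 \<and> even n")
    case True
    then obtain t where n: "n = 2 * t" by (auto elim: evenE)
    have eg: "eig c n l = of_real ((-1) ^ t)" using True by (simp add: eig_def n power_mult)
    have D: "of_real ((-1) ^ t) * of_real (gauss_coeff ?\<alpha> b t)
        = (of_real ((2 * b) powr (- (delta TYPE('m) c / 2))) * of_real (gauss_coeff ?\<alpha> (1 / (4 * b)) t) :: complex)"
      using gauss_coeff_dual[OF b, of t ?\<alpha>] unfolding of_real_mult[symmetric] by simp
    show ?thesis
      unfolding i(1) gauss_coefficient[OF c mb i(2) b] gauss_coefficient[OF c mb i(2) b'] eg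
      using True D by (simp only: n) (simp add: mult.assoc[symmetric])
  next
    case False
    then show ?thesis
      unfolding i(1) gauss_coefficient[OF c mb i(2) b] gauss_coefficient[OF c mb i(2) b']
      by (simp only: if_not_P if_False mult_zero_right)
  qed
  finally show "iprod (wmeas c) (bas c Mb 0 i) (F (gauss b a))
    = iprod (wmeas c) (bas c Mb 0 i) (\<lambda>x. (2 * b) powr (- (delta TYPE('m) c / 2)) *\<^sub>R gauss (1 / (4 * b)) a x)"
    by (simp only: iprod_scaleR_right)
qed

text \<open>The rates \<open>b\<close> and \<open>1 / (4 b)\<close> give squared weighted norms
  proportional to \<open>\<delta> / (4 b)\<close> and \<open>\<delta> b\<close>, whose product
  \<open>(\<delta> / 2)^2\<close> is independent of \<open>b\<close>.\<close>

lemma gauss_attains: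
  fixes Mb :: "nat \<Rightarrow> nat \<Rightarrow> 'm::{finite,linorder} cl_fun"
  assumes c: "c > -1" and mb: "monogenic_basis d Mb" and F: "deformed_fourier c d Mb F" and b: "b > 0"
    and f: "f \<in> L2 c" and fg: "AE x in lborel. f x = gauss b a x"
  shows "rmult f \<in> L2 c" and "rmult (F f) \<in> L2 c"
    and "nsq (wmeas c) (rmult f) * nsq (wmeas c) (rmult (F f)) = (delta TYPE('m) c / 2 * nsq (wmeas c) f)\<^sup>2"
proof -
  define \<delta> where "\<delta> = delta TYPE('m) c"
  define k where "k = (2 * b) powr (- (\<delta> / 2))"
  have b': "1 / (4 * b) > 0" using b by simp
  have U: "unitary_on_L2 c F" using F by (simp add: deformed_fourier_def)
  have Ff: "F f \<in> L2 c" using U f by (simp add: unitary_on_L2_def)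
  have "AE x in lborel. F f x = F (gauss b a) x"
    using U f gauss_L2(1)[OF c b, of a] fg unfolding unitary_on_L2_def by blast
  then have FfG: "AE x in lborel. F f x = k *\<^sub>R gauss (1 / (4 * b)) a x"
    using fourier_gauss[OF c mb F b, of a] unfolding k_def \<delta>_def by eventually_elim simp
  have fm: "f \<in> borel_measurable borel" "F f \<in> borel_measurable borel" using f Ff by (simp_all add: L2_def)
  have r1: "AE x in wmeas c. rmult (gauss b a) x = rmult f x"
    unfolding AE_wmeas using fg by eventually_elim (simp add: rmult_def)
  have r2: "AE x in wmeas c. k *\<^sub>R rmult (gauss (1 / (4 * b)) a) x = rmult (F f) x"
    unfolding AE_wmeas using FfG by eventually_elim (simp add: rmult_def)
  have g1: "rmult (gauss b a) \<in> sq_int (wmeas c)" using gauss_L2(2)[OF c b] by (simp add: L2_eq_sq_int)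
  have g2: "(\<lambda>x. k *\<^sub>R rmult (gauss (1 / (4 * b)) a) x) \<in> sq_int (wmeas c)"
    by (rule sq_int_scaleR[OF gauss_L2(2)[OF c b', unfolded L2_eq_sq_int]])
  show "rmult f \<in> L2 c" unfolding L2_eq_sq_int
    by (rule sq_int_cong_AE[OF g1 r1]) (simp add: rmult_measurable fm)
  show "rmult (F f) \<in> L2 c" unfolding L2_eq_sq_int
    by (rule sq_int_cong_AE[OF g2 r2]) (simp add: rmult_measurable fm)
  define G where "G = gauss_nsq TYPE('m) c b"
  have n0: "nsq (wmeas c) f = (norm a)\<^sup>2 * G"
    unfolding G_def gauss_nsq(1)[OF c b, symmetric]
    by (rule nsq_cong_AE) (simp_all add: AE_wmeas fg fm)
  have n1: "nsq (wmeas c) (rmult f) = (norm a)\<^sup>2 * (\<delta> / (4 * b) * G)"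
    unfolding G_def \<delta>_def gauss_nsq(2)[OF c b, symmetric]
    by (rule nsq_cong_AE[OF r1, symmetric]) (simp_all add: rmult_measurable fm)
  have "nsq (wmeas c) (rmult (F f)) = nsq (wmeas c) (\<lambda>x. k *\<^sub>R rmult (gauss (1 / (4 * b)) a) x)"
    by (rule nsq_cong_AE[OF r2, symmetric]) (use g2 in \<open>simp_all add: rmult_measurable fm sq_int_def\<close>)
  also have "\<dots> = k\<^sup>2 * nsq (wmeas c) (rmult (gauss (1 / (4 * b)) a))"
    unfolding nsq_def by (simp add: power_mult_distrib)
  also have "\<dots> = k\<^sup>2 * ((norm a)\<^sup>2 * (\<delta> / (4 * (1 / (4 * b))) * ((2 * b) powr \<delta> * G)))"
    unfolding gauss_nsq(2)[OF c b'] gauss_nsq(3)[OF c b] G_def \<delta>_def ..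
  also have "\<dots> = k\<^sup>2 * (2 * b) powr \<delta> * ((norm a)\<^sup>2 * (\<delta> * b * G))" using b by simp
  \<comment> \<open>The prefactor of the transformed Gaussian compensates the change of its norm, as
    unitarity demands.\<close>
  also have "k\<^sup>2 * (2 * b) powr \<delta> = 1"
    using b by (simp add: k_def power2_eq_square flip: powr_add)
  finally have n2: "nsq (wmeas c) (rmult (F f)) = (norm a)\<^sup>2 * (\<delta> * b * G)" by simp
  show "nsq (wmeas c) (rmult f) * nsq (wmeas c) (rmult (F f)) = (delta TYPE('m) c / 2 * nsq (wmeas c) f)\<^sup>2"
    unfolding n0 n1 n2 \<delta>_def[symmetric] using b by (simp add: power2_eq_square field_simps)
qed

text \<open>Monogenics of degree zero are constant, so their values at the origin turn
  orthonormality on the sphere into a coefficient formula. It allows the constant \<open>a\<close>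
  to be rebuilt from prescribed angular coefficients.\<close>

lemma degree_zero_span:
  fixes Mb :: "nat \<Rightarrow> nat \<Rightarrow> 'm::{finite,linorder} cl_fun"
  assumes mb: "monogenic_basis d Mb" and j: "j < d 0"
  shows "(\<integral>x. hdot (Mb 0 j x) (\<Sum>k<d 0. z k *s Mb 0 k 0) \<partial>sphere_measure) = z j"
proof -
  have h: "hpoly 0 (Mb 0 k)" if "k < d 0" for k using monogenic_basisD(1)[OF mb that] .
  have i: "integrable sphere_measure (\<lambda>x. z k * hdot (Mb 0 j x) (Mb 0 k x))" if "k < d 0" for k
    by (intro integrable_mult_right integrable_sphere continuous_hdot hpoly_continuous[OF h] that j)
  have o: "(\<integral>x. hdot (Mb 0 j x) (Mb 0 k x) \<partial>sphere_measure) = (if j = k then 1 else 0)" if "k < d 0" for k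
    using ang_orthonormal[OF mb j that, of 0 0] by (simp add: ang_def)
  have "hdot (Mb 0 j x) (\<Sum>k<d 0. z k *s Mb 0 k 0) = (\<Sum>k<d 0. z k * hdot (Mb 0 j x) (Mb 0 k x))" for x
    unfolding hdot_sum_right hdot_scale_right
    by (rule sum.cong[OF refl]) (simp only: lessThan_iff hpoly_0_const[OF h, of _ x])
  then have "(\<integral>x. hdot (Mb 0 j x) (\<Sum>k<d 0. z k *s Mb 0 k 0) \<partial>sphere_measure)
    = (\<integral>x. (\<Sum>k<d 0. z k * hdot (Mb 0 j x) (Mb 0 k x)) \<partial>sphere_measure)" by simp
  also have "\<dots> = (\<Sum>k<d 0. \<integral>x. z k * hdot (Mb 0 j x) (Mb 0 k x) \<partial>sphere_measure)"
    by (rule Bochner_Integration.integral_sum) (use i in simp)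
  also have "\<dots> = (\<Sum>k<d 0. if k = j then z j else 0)"
    by (rule sum.cong[OF refl]) (use o in auto)
  also have "\<dots> = z j" using j by simp
  finally show ?thesis .
qed

lemma equality_imp_gauss:
  fixes Mb :: "nat \<Rightarrow> nat \<Rightarrow> 'm::{finite,linorder} cl_fun"
  assumes c: "c > -1" and mb: "monogenic_basis d Mb" and F: "deformed_fourier c d Mb F" and f: "f \<in> L2 c"
    and rf: "rmult f \<in> L2 c" and rFf: "rmult (F f) \<in> L2 c"
    and eq: "nsq (wmeas c) (rmult f) * nsq (wmeas c) (rmult (F f)) = (delta TYPE('m) c / 2 * nsq (wmeas c) f)\<^sup>2"
    and pos: "nsq (wmeas c) f > 0"
  shows "\<exists>a b. b > 0 \<and> (AE x in lborel. f x = gauss b a x)"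
proof -
  define q where "q i = iprod (wmeas c) (bas c Mb 0 i) f" for i
  obtain \<tau> where \<tau>: "\<tau> > 0"
    and rec: "\<And>n l j. j < d l \<Longrightarrow>
      of_real \<tau> * (of_real (sqrt (real (n div 2) + alph TYPE('m) c n l + 1)) * q (n, l, j)
        - of_real (sqrt (real (n div 2) + 1)) * q (n + 2, l, j))
      = of_real (sqrt (real (n div 2) + alph TYPE('m) c n l + 1)) * q (n, l, j)
        + of_real (sqrt (real (n div 2) + 1)) * q (n + 2, l, j)"
    and zero: "\<And>n l j. j < d l \<Longrightarrow> l > 0 \<or> odd n \<Longrightarrow> q (n, l, j) = 0"
    using uncertainty_coefficients(2)[OF c mb F f rf rFf eq pos] unfolding idx_def q_def by fastforce
  \<comment> \<open>With \<open>\<tau> = 2 b\<close> the recurrence \<open>rec\<close> becomes that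
    of \<open>gauss_coeff_Suc\<close>.\<close>
  define b where "b = \<tau> / 2"
  have b: "b > 0" using \<tau> by (simp add: b_def)
  define \<alpha> where "\<alpha> = delta TYPE('m) c / 2 - 1"
  have \<alpha>: "\<alpha> > -1" using delta_pos[OF c, where 'm = 'm] by (simp add: \<alpha>_def)
  define g where "g = gauss_coeff \<alpha> b"
  have g0: "g 0 > 0" unfolding g_def by (rule gauss_coeff_0_pos[OF \<alpha> b])
  \<comment> \<open>Both sequences obey the same two-term recurrence, whose factor
    \<open>(\<tau> + 1) * sqrt (t + 1)\<close> at the next term is nonzero, so they are
    proportional. The claim is cross-multiplied with the values at \<open>t = 0\<close>.\<close>
  have geo: "q (2 * t, 0, j) * of_real (g 0) = of_real (g t) * q (0, 0, j)" if j: "j < d 0" for t j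
  proof (induction t)
    case (Suc t)
    define A B where "A = complex_of_real (sqrt (real t + \<alpha> + 1))" and "B = complex_of_real (sqrt (real t + 1))"
    have B: "B \<noteq> 0" unfolding B_def by (simp add: add_nonneg_eq_0_iff)
    have T: "of_real \<tau> + 1 \<noteq> (0 :: complex)"
      using \<tau> by (metis add_pos_pos less_irrefl of_real_1 of_real_add of_real_eq_0_iff zero_less_one)
    have "of_real \<tau> * (A * q (2 * t, 0, j) - B * q (2 * Suc t, 0, j)) = A * q (2 * t, 0, j) + B * q (2 * Suc t, 0, j)"
      using rec[OF j, of "2 * t"] by (simp add: alph_eq[OF c] \<alpha>_def A_def B_def)
    then have R: "(of_real \<tau> + 1) * B * q (2 * Suc t, 0, j) = (of_real \<tau> - 1) * A * q (2 * t, 0, j)"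
      by (simp add: algebra_simps)
    have "(\<tau> + 1) * sqrt (real t + 1) * g (Suc t) = (\<tau> - 1) * sqrt (real t + \<alpha> + 1) * g t"
      using gauss_coeff_Suc[OF \<alpha> b, of t] by (simp add: g_def b_def field_simps)
    then have "complex_of_real ((\<tau> + 1) * sqrt (real t + 1) * g (Suc t)) = of_real ((\<tau> - 1) * sqrt (real t + \<alpha> + 1) * g t)"
      by (rule arg_cong)
    then have G: "(of_real \<tau> + 1) * B * of_real (g (Suc t)) = (of_real \<tau> - 1) * A * of_real (g t)"
      by (simp only: A_def B_def of_real_mult of_real_add of_real_diff of_real_1)
    have "((of_real \<tau> + 1) * B) * (q (2 * Suc t, 0, j) * of_real (g 0))
      = (of_real \<tau> - 1) * A * (q (2 * t, 0, j) * of_real (g 0))"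
      unfolding mult.assoc[symmetric] R ..
    also have "\<dots> = (of_real \<tau> - 1) * A * of_real (g t) * q (0, 0, j)"
      by (simp only: Suc.IH mult.assoc)
    also have "\<dots> = ((of_real \<tau> + 1) * B) * (of_real (g (Suc t)) * q (0, 0, j))"
      unfolding G[symmetric] by (simp only: mult.assoc)
    finally show ?case using B T by (simp only: mult_cancel_left mult_eq_0_iff) simp
  qed simp
  \<comment> \<open>Chosen so that the Gaussian has the coefficients of \<open>f\<close> at
    \<open>n = 0\<close>; the recurrence settles the others.\<close>
  define z where "z j = q (0, 0, j) / of_real (g 0)" for j
  define a where "a = (\<Sum>k<d 0. z k *s Mb 0 k 0)"
  have "AE x in lborel. f x = gauss b a x"
  proof (rule L2_eq_by_coefficients[OF c mb f gauss_L2(1)[OF c b]])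
    fix i assume "i \<in> idx d"
    then obtain n l j where i: "i = (n, l, j)" "j < d l" by (auto simp: idx_def)
    show "iprod (wmeas c) (bas c Mb 0 i) f = iprod (wmeas c) (bas c Mb 0 i) (gauss b a)"
      unfolding q_def[symmetric] i(1) gauss_coefficient[OF c mb i(2) b] \<alpha>_def[symmetric] g_def[symmetric]
    proof (cases "l = 0 \<and> even n")
      case True
      then obtain t where n: "n = 2 * t" by (auto elim: evenE)
      have j: "j < d 0" using True i(2) by simp
      have "q (2 * t, 0, j) = of_real (g t) * z j"
        using geo[OF j, of t] g0 unfolding z_def by (simp add: field_simps)
      then show "q (n, l, j) = (if l = 0 \<and> even n then of_real (g (n div 2)) * (\<integral>x. hdot (Mb 0 j x) a \<partial>sphere_measure) else 0)"
        unfolding a_def degree_zero_span[OF mb j] using True by (simp add: n)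
    next
      case False
      then show "q (n, l, j) = (if l = 0 \<and> even n then of_real (g (n div 2)) * (\<integral>x. hdot (Mb 0 j x) a \<partial>sphere_measure) else 0)"
        using zero[OF i(2), of n] by auto
    qed
  qed
  with b show ?thesis by blast
qed

text \<open>For finite norms the extended real statement becomes one about squared norms, on which
  the coefficient argument works.\<close>

lemma ennreal_sqrt_mult_compare:
  fixes x y z k :: real
  assumes "x \<ge> 0" "y \<ge> 0" "z \<ge> 0" "k \<ge> 0"
  shows "ennreal k * (ennreal (sqrt z))\<^sup>2 \<le> ennreal (sqrt x) * ennreal (sqrt y) \<longleftrightarrow> (k * z)\<^sup>2 \<le> x * y"
    and "ennreal (sqrt x) * ennreal (sqrt y) = ennreal k * (ennreal (sqrt z))\<^sup>2 \<longleftrightarrow> x * y = (k * z)\<^sup>2"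
proof -
  have l: "ennreal (sqrt x) * ennreal (sqrt y) = ennreal (sqrt (x * y))"
    by (simp only: real_sqrt_mult ennreal_mult real_sqrt_ge_zero assms)
  have r: "ennreal k * (ennreal (sqrt z))\<^sup>2 = ennreal (sqrt ((k * z)\<^sup>2))"
    using assms by (simp add: ennreal_power ennreal_mult)
  show "ennreal k * (ennreal (sqrt z))\<^sup>2 \<le> ennreal (sqrt x) * ennreal (sqrt y) \<longleftrightarrow> (k * z)\<^sup>2 \<le> x * y"
    unfolding l r using assms by (subst ennreal_le_iff) (simp_all only: real_sqrt_ge_zero real_sqrt_le_iff mult_nonneg_nonneg)
  show "ennreal (sqrt x) * ennreal (sqrt y) = ennreal k * (ennreal (sqrt z))\<^sup>2 \<longleftrightarrow> x * y = (k * z)\<^sup>2"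
    unfolding l r using assms by (subst ennreal_inj) (simp_all only: real_sqrt_ge_zero real_sqrt_eq_iff mult_nonneg_nonneg zero_le_power2)
qed

text \<open>Excludes the product of zero and infinity: a function whose weighted norm is infinite is
  nonzero, and a nonzero function has nonzero weighted norm.\<close>

lemma rmult_zero:
  fixes g :: "'m::{finite,linorder} cl_fun"
  assumes g: "g \<in> L2 c"
  shows "nsq (wmeas c) g = 0 \<Longrightarrow> rmult g \<in> L2 c"
    and "rmult g \<in> L2 c \<Longrightarrow> nsq (wmeas c) (rmult g) = 0 \<Longrightarrow> nsq (wmeas c) g = 0"
proof -
  have gm: "g \<in> borel_measurable borel" using g by (simp add: L2_def)
  assume "nsq (wmeas c) g = 0"
  then have "AE x in lborel. g x = 0" using nsq_zero_AE[OF g] by simp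
  then have "AE x in wmeas c. g x = rmult g x" unfolding AE_wmeas by eventually_elim (simp add: rmult_def)
  then show "rmult g \<in> L2 c" unfolding L2_eq_sq_int
    by (rule sq_int_cong_AE[OF g[unfolded L2_eq_sq_int]]) (simp add: rmult_measurable gm)
next
  assume "rmult g \<in> L2 c" "nsq (wmeas c) (rmult g) = 0"
  then have "AE x in lborel. rmult g x = 0" using nsq_zero_AE by blast
  then have "AE x in lborel. g x = 0" using AE_lborel_nonzero by eventually_elim (simp add: rmult_def)
  then show "nsq (wmeas c) g = 0" using nsq_zero_AE[OF g] by simp
qed

theorem proposition7p3:
  fixes c :: real
    and d :: "nat \<Rightarrow> nat"
    and Mb :: "nat \<Rightarrow> nat \<Rightarrow> 'm::{finite,linorder} cl_fun"
    and F :: "'m cl_fun \<Rightarrow> 'm cl_fun"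
    and f :: "'m cl_fun"
  assumes "CARD('m) \<ge> 2" and "c > -1"
    and "monogenic_basis d Mb"
    and "deformed_fourier c d Mb F"
    and "f \<in> L2 c"
  shows "L2_norm c (\<lambda>x. cl_vec x \<odot> f x) * L2_norm c (\<lambda>x. cl_vec x \<odot> F f x)
           \<ge> ennreal (delta TYPE('m) c / 2) * (L2_norm c f)\<^sup>2
       \<and> (L2_norm c (\<lambda>x. cl_vec x \<odot> f x) * L2_norm c (\<lambda>x. cl_vec x \<odot> F f x)
           = ennreal (delta TYPE('m) c / 2) * (L2_norm c f)\<^sup>2
         \<longleftrightarrow> (\<exists>(a :: 'm clifford) (\<alpha> :: real). \<alpha> > 0 \<and>
               (AE x in lborel. f x = exp (- (norm x)\<^sup>2 / \<alpha>) *\<^sub>R a)))"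
proof -
  note c = assms(2) and mb = assms(3) and F = assms(4) and f = assms(5)
  let ?\<mu> = "wmeas c :: (real, 'm) vec measure"
  define k where "k = delta TYPE('m) c / 2"
  have k: "k \<ge> 0" unfolding k_def using delta_pos[OF c, where 'm = 'm] by simp
  have U: "unitary_on_L2 c F" using F by (simp add: deformed_fourier_def)
  have Ff: "F f \<in> L2 c" using U f by (simp add: unitary_on_L2_def)
  have fm: "f \<in> borel_measurable borel" "F f \<in> borel_measurable borel" using f Ff by (simp_all add: L2_def)
  have "L2_inner c (F f) (F f) = L2_inner c f f" using U f unfolding unitary_on_L2_def by blast
  then have nF: "nsq ?\<mu> (F f) = nsq ?\<mu> f"
    by (simp only: L2_inner_eq_iprod[OF f f] L2_inner_eq_iprod[OF Ff Ff] iprod_self of_real_eq_iff)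
  note N = L2_norm_cl_vec[OF fm(1), of c] L2_norm_cl_vec[OF fm(2), of c] L2_norm_eq[OF f] k_def[symmetric]
  let ?G = "\<exists>(a :: 'm clifford) (\<alpha> :: real). \<alpha> > 0 \<and> (AE x in lborel. f x = exp (- (norm x)\<^sup>2 / \<alpha>) *\<^sub>R a)"
  have GI: ?G if "b > 0" "AE x in lborel. f x = gauss b a x" for a b
  proof (intro exI conjI)
    show "1 / b > 0" using that(1) by simp
    show "AE x in lborel. f x = exp (- (norm x)\<^sup>2 / (1 / b)) *\<^sub>R a"
      using that(2) by eventually_elim (simp add: gauss_def mult.commute)
  qed
  have GD: "rmult f \<in> L2 c \<and> rmult (F f) \<in> L2 c \<and> nsq ?\<mu> (rmult f) * nsq ?\<mu> (rmult (F f)) = (k * nsq ?\<mu> f)\<^sup>2" if G: ?G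
  proof -
    obtain a \<alpha> where \<alpha>: "\<alpha> > 0" and fa: "AE x in lborel. f x = exp (- (norm x)\<^sup>2 / \<alpha>) *\<^sub>R a" using G by blast
    have b: "1 / \<alpha> > 0" using \<alpha> by simp
    have "AE x in lborel. f x = gauss (1 / \<alpha>) a x" using fa by eventually_elim (simp add: gauss_def)
    note A = gauss_attains[OF c mb F b f this]
    show ?thesis unfolding k_def by (intro conjI A)
  qed
  show ?thesis
  proof (cases "rmult f \<in> L2 c \<and> rmult (F f) \<in> L2 c")
    case True
    then have r: "rmult f \<in> L2 c" "rmult (F f) \<in> L2 c" by simp_all
    note C = ennreal_sqrt_mult_compare[OF nsq_nonneg nsq_nonneg nsq_nonneg k]
    have le: "(k * nsq ?\<mu> f)\<^sup>2 \<le> nsq ?\<mu> (rmult f) * nsq ?\<mu> (rmult (F f))"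
      unfolding k_def by (rule uncertainty_coefficients(1)[OF c mb F f r])
    have "nsq ?\<mu> (rmult f) * nsq ?\<mu> (rmult (F f)) = (k * nsq ?\<mu> f)\<^sup>2 \<longleftrightarrow> ?G"
    proof
      assume e: "nsq ?\<mu> (rmult f) * nsq ?\<mu> (rmult (F f)) = (k * nsq ?\<mu> f)\<^sup>2"
      show ?G
      proof (cases "nsq ?\<mu> f = 0")
        case True
        \<comment> \<open>The zero function is a Gaussian with \<open>a = 0\<close>, of any
          rate.\<close>
        then have "AE x in lborel. f x = gauss 1 0 x" using nsq_zero_AE[OF f] by (simp add: gauss_def)
        then show ?thesis by (rule GI[rotated]) simp
      next
        case False
        then have "nsq ?\<mu> f > 0" by (simp add: less_le)
        from equality_imp_gauss[OF c mb F f r e[unfolded k_def] this] show ?thesis using GI by blast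
      qed
    qed (use GD in blast)
    then show ?thesis unfolding N if_P[OF r(1)] if_P[OF r(2)] C using le by blast
  next
    case False
    \<comment> \<open>One weighted norm is infinite, so \<open>f\<close> and \<open>F f\<close> are
      nonzero and the other norm is positive. The product is infinite and exceeds the finite right
      side; by \<open>GD\<close> a Gaussian would have finite norms, so both sides of the
      equivalence fail.\<close>
    then have nz: "nsq ?\<mu> f \<noteq> 0" "nsq ?\<mu> (F f) \<noteq> 0"
      using rmult_zero(1)[OF f] rmult_zero(1)[OF Ff] nF by auto
    let ?x = "if rmult f \<in> L2 c then ennreal (sqrt (nsq ?\<mu> (rmult f))) else \<infinity>"
      and ?y = "if rmult (F f) \<in> L2 c then ennreal (sqrt (nsq ?\<mu> (rmult (F f)))) else \<infinity>"
    have "?x \<noteq> 0" "?y \<noteq> 0" "?x = \<infinity> \<or> ?y = \<infinity>"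
      using False nz rmult_zero(2)[OF f] rmult_zero(2)[OF Ff] by (auto simp: ennreal_eq_0_iff dest: antisym[OF _ nsq_nonneg])
    then have "?x * ?y = \<infinity>" by (auto simp: ennreal_mult_top ennreal_top_mult)
    moreover have "ennreal k * (ennreal (sqrt (nsq ?\<mu> f)))\<^sup>2 \<noteq> \<infinity>"
      by (simp add: ennreal_power ennreal_mult_eq_top_iff)
    moreover have "\<not> ?G" using GD False by blast
    ultimately show ?thesis unfolding N by simp
  qed
qed

end
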